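(* Let $\Bbbk$ be a field and let $d = 2k+1 \ge 3$ be an odd integer. Then for all integers $n \ge d$ there exists a squarefree monomial ideal $I \subseteq S = \Bbbk[x_1,\ldots,x_n]$ generated in degree $d$ such that $I$ satisfies property $N_2$ and $\operatorname{reg}(I) = f(n,d)$.
   Context: $S=\Bbbk[x_1,\ldots,x_n]$ is the standard graded polynomial ring over a field $\Bbbk$. For an integer $d\ge 2$, define $$f(n,d)=\begin{cases} 0 & \text{if } n<d,\\ d & \text{if } n=d,\\ \left\lfloor \frac{(d-1)n}{d+1}\right\rfloor+1 & \text{if } n>d.\end{cases}$$ A squarefree monomial ideal generated in degree $d$ is an ideal all of whose minimal generators are squarefree monomials of degree $d$. Such an ideal $I$ satisfies property $N_2$ (is linearly presented) if $\operatorname{Tor}_1^S(I,\Bbbk)_j=0$ for all $j\ne d+1$. For a finitely generated graded $S$-module $M$, $\operatorname{reg}(M)=\max\{j-i\mid \operatorname{Tor}_i^S(M,\Bbbk)_j\neq 0\}$ is the Castelnuovo-Mumford regularity. *)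

theory Defs
  imports "HOL-Algebra.Algebra" "HOL-Library.Poly_Mapping"
begin

text \<open>
  Polynomials with coefficients in \<open>'a\<close> in the variables \<open>x\<^sub>0, x\<^sub>1, x\<^sub>2, \<dots>\<close>: finitely
  supported functions from exponent vectors to coefficients, multiplied by convolution.
  The ring \<open>\<k>[x\<^sub>1,\<dots>,x\<^sub>n]\<close> is the subring of those in which only \<open>x\<^sub>1,\<dots>,x\<^sub>n\<close> occur.
\<close>

type_synonym monomial = "nat \<Rightarrow>\<^sub>0 nat"
type_synonym 'a mpoly = "monomial \<Rightarrow>\<^sub>0 'a"

definition poly_ring :: "nat \<Rightarrow> ('a::field) mpoly ring" where
  "poly_ring n =
     \<lparr>carrier = {p. \<forall>m \<in> Poly_Mapping.keys p. Poly_Mapping.keys m \<subseteq> {1..n}},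
      monoid.mult = (*), one = 1, ring.zero = 0, add = (+)\<rparr>"

lemma cring_poly_ring: "cring (poly_ring n :: ('a::field) mpoly ring)"
proof (rule cringI)
  show "abelian_group (poly_ring n :: 'a mpoly ring)"
  proof (rule abelian_groupI)
    fix x y :: "'a mpoly"
    assume "x \<in> carrier (poly_ring n)" "y \<in> carrier (poly_ring n)"
    then show "x \<oplus>\<^bsub>poly_ring n\<^esub> y \<in> carrier (poly_ring n)"
      unfolding poly_ring_def using Poly_Mapping.keys_add[of x y] by fastforce
  next
    fix x :: "'a mpoly"
    assume "x \<in> carrier (poly_ring n)"
    then show "\<exists>y\<in>carrier (poly_ring n). y \<oplus>\<^bsub>poly_ring n\<^esub> x = \<zero>\<^bsub>poly_ring n\<^esub>"
      by (intro bexI[of _ "- x"]) (auto simp: poly_ring_def)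
  qed (auto simp: poly_ring_def algebra_simps)
  show "Group.comm_monoid (poly_ring n :: 'a mpoly ring)"
  proof (rule comm_monoidI)
    fix x y :: "'a mpoly"
    assume xy: "x \<in> carrier (poly_ring n)" "y \<in> carrier (poly_ring n)"
    have "Poly_Mapping.keys m \<subseteq> {1..n}" if m: "m \<in> Poly_Mapping.keys (x * y)" for m
    proof -
      obtain a b where "m = a + b" "a \<in> Poly_Mapping.keys x" "b \<in> Poly_Mapping.keys y"
        using m keys_mult[of x y] by auto
      then show ?thesis
        using xy keys_add[of a b] unfolding poly_ring_def by fastforce
    qed
    then show "x \<otimes>\<^bsub>poly_ring n\<^esub> y \<in> carrier (poly_ring n)"
      by (auto simp: poly_ring_def)
  qed (auto simp: poly_ring_def algebra_simps)
qed (auto simp: poly_ring_def algebra_simps)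

definition mon_degree :: "monomial \<Rightarrow> nat" where
  "mon_degree m = (\<Sum>i\<in>Poly_Mapping.keys m. Poly_Mapping.lookup m i)"

definition squarefree_mon :: "monomial \<Rightarrow> bool" where
  "squarefree_mon m \<longleftrightarrow> (\<forall>i. Poly_Mapping.lookup m i \<le> 1)"

definition monomials :: "nat \<Rightarrow> monomial set" where
  "monomials n = {m. Poly_Mapping.keys m \<subseteq> {1..n}}"

abbreviation mon_poly :: "monomial \<Rightarrow> ('a::field) mpoly" where
  "mon_poly m \<equiv> Poly_Mapping.single m 1"

definition monomial_ideal :: "nat \<Rightarrow> ('a::field) mpoly set \<Rightarrow> bool" where
  "monomial_ideal n I \<longleftrightarrow> (\<exists>G \<subseteq> monomials n. I = Idl\<^bsub>poly_ring n\<^esub> (mon_poly ` G))"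

text \<open>The minimal generators of a monomial ideal are the monomials in it that are minimal
  with respect to divisibility.\<close>

definition minimal_gens :: "nat \<Rightarrow> ('a::field) mpoly set \<Rightarrow> monomial set" where
  "minimal_gens n I =
     {m \<in> monomials n. mon_poly m \<in> I \<and>
        (\<forall>m' \<in> monomials n. mon_poly m' \<in> I \<and> (\<forall>i. Poly_Mapping.lookup m' i \<le> Poly_Mapping.lookup m i) \<longrightarrow> m' = m)}"

definition squarefree_monomial_ideal_gen_in_degree ::
    "nat \<Rightarrow> nat \<Rightarrow> ('a::field) mpoly set \<Rightarrow> bool" where
  "squarefree_monomial_ideal_gen_in_degree n d I \<longleftrightarrow>
     monomial_ideal n I \<and> (\<forall>m \<in> minimal_gens n I. squarefree_mon m \<and> mon_degree m = d)"

text \<open>Zero is homogeneous of every degree; there are no other homogeneous elements of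
  negative degree.\<close>

definition homogeneous :: "int \<Rightarrow> ('a::field) mpoly \<Rightarrow> bool" where
  "homogeneous e p \<longleftrightarrow> (\<forall>m \<in> Poly_Mapping.keys p. int (mon_degree m) = e)"

text \<open>
  A complex \<open>\<dots> \<rightarrow> F\<^sub>2 \<rightarrow> F\<^sub>1 \<rightarrow> F\<^sub>0 \<rightarrow> S\<close> of graded free modules of finite rank.
  \<open>F\<^sub>i\<close> is the free module on \<open>e\<^sub>i\<^sub>b\<close> for \<open>b < rnk F i\<close>, where \<open>e\<^sub>i\<^sub>b\<close> is homogeneous of
  degree \<open>gdeg F i b\<close>, so that \<open>F\<^sub>i\<close> is the direct sum of the \<open>S(- gdeg F i b)\<close>.
  The augmentation \<open>F\<^sub>0 \<rightarrow> S\<close> sends \<open>e\<^sub>0\<^sub>b\<close> to \<open>aug F b\<close>, and the differential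
  \<open>F\<^sub>i\<^sub>+\<^sub>1 \<rightarrow> F\<^sub>i\<close> sends \<open>e\<^sub>i\<^sub>+\<^sub>1\<^sub>,\<^sub>b\<close> to the sum over \<open>c < rnk F i\<close> of \<open>mat F i b c\<close> times \<open>e\<^sub>i\<^sub>c\<close>.
\<close>

record (overloaded) ('a::zero) free_complex =
  rnk :: "nat \<Rightarrow> nat"
  gdeg :: "nat \<Rightarrow> nat \<Rightarrow> int"
  aug :: "nat \<Rightarrow> 'a mpoly"
  mat :: "nat \<Rightarrow> nat \<Rightarrow> nat \<Rightarrow> 'a mpoly"

definition free_mod :: "nat \<Rightarrow> nat \<Rightarrow> (nat \<Rightarrow> ('a::field) mpoly) set" where
  "free_mod n r = {v. (\<forall>b<r. v b \<in> carrier (poly_ring n)) \<and> (\<forall>b\<ge>r. v b = 0)}"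

definition aug_map :: "('a::field) free_complex \<Rightarrow> (nat \<Rightarrow> 'a mpoly) \<Rightarrow> 'a mpoly" where
  "aug_map F v = (\<Sum>b<rnk F 0. v b * aug F b)"

definition diff_map ::
    "('a::field) free_complex \<Rightarrow> nat \<Rightarrow> (nat \<Rightarrow> 'a mpoly) \<Rightarrow> (nat \<Rightarrow> 'a mpoly)" where
  "diff_map F i v = (\<lambda>c. if c < rnk F i then \<Sum>b<rnk F (Suc i). v b * mat F i b c else 0)"

definition graded_free_resolution ::
    "nat \<Rightarrow> ('a::field) mpoly set \<Rightarrow> 'a free_complex \<Rightarrow> bool" where
  "graded_free_resolution n I F \<longleftrightarrow>
     (\<forall>b<rnk F 0. aug F b \<in> carrier (poly_ring n) \<and> homogeneous (gdeg F 0 b) (aug F b)) \<and>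
     (\<forall>i. \<forall>b<rnk F (Suc i). \<forall>c<rnk F i.
        mat F i b c \<in> carrier (poly_ring n) \<and>
        homogeneous (gdeg F (Suc i) b - gdeg F i c) (mat F i b c)) \<and>
     aug_map F ` free_mod n (rnk F 0) = I \<and>
     {v \<in> free_mod n (rnk F 0). aug_map F v = 0} = diff_map F 0 ` free_mod n (rnk F 1) \<and>
     (\<forall>i. {v \<in> free_mod n (rnk F (Suc i)). diff_map F i v = (\<lambda>_. 0)} =
          diff_map F (Suc i) ` free_mod n (rnk F (Suc (Suc i))))"

text \<open>
  The complex \<open>F \<otimes>\<^sub>S \<k>\<close>, where \<open>\<k> = S/(x\<^sub>1,\<dots>,x\<^sub>n)\<close> sits in degree 0. Since \<open>S(-a) \<otimes>\<^sub>S \<k> = \<k>(-a)\<close>,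
  the degree \<open>j\<close> part of \<open>F\<^sub>i \<otimes>\<^sub>S \<k>\<close> is the \<open>\<k>\<close>-vector space on the \<open>e\<^sub>i\<^sub>b \<otimes> 1\<close> with
  \<open>gdeg F i b = j\<close>, and the matrices of the differentials are reduced modulo
  \<open>(x\<^sub>1,\<dots>,x\<^sub>n)\<close>, that is, entrywise replaced by their constant coefficients.
\<close>

definition tensor_k :: "('a::field) free_complex \<Rightarrow> nat \<Rightarrow> int \<Rightarrow> (nat \<Rightarrow> 'a) set" where
  "tensor_k F i j = {v. \<forall>b. v b \<noteq> 0 \<longrightarrow> b < rnk F i \<and> gdeg F i b = j}"

definition diff_k :: "('a::field) free_complex \<Rightarrow> nat \<Rightarrow> (nat \<Rightarrow> 'a) \<Rightarrow> (nat \<Rightarrow> 'a)" where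
  "diff_k F i v =
     (\<lambda>c. if c < rnk F i then \<Sum>b<rnk F (Suc i). v b * Poly_Mapping.lookup (mat F i b c) 0 else 0)"

definition cycles_k :: "('a::field) free_complex \<Rightarrow> nat \<Rightarrow> int \<Rightarrow> (nat \<Rightarrow> 'a) set" where
  "cycles_k F i j =
     (case i of 0 \<Rightarrow> tensor_k F 0 j
      | Suc i' \<Rightarrow> {v \<in> tensor_k F (Suc i') j. diff_k F i' v = (\<lambda>_. 0)})"

definition boundaries_k :: "('a::field) free_complex \<Rightarrow> nat \<Rightarrow> int \<Rightarrow> (nat \<Rightarrow> 'a) set" where
  "boundaries_k F i j = diff_k F i ` tensor_k F (Suc i) j"

definition homology_k :: "('a::field) free_complex \<Rightarrow> nat \<Rightarrow> int \<Rightarrow> (nat \<Rightarrow> 'a) set monoid" where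
  "homology_k F i j =
     \<lparr>carrier = cycles_k F i j, monoid.mult = (\<lambda>v w b. v b + w b), one = (\<lambda>_. 0)\<rparr>
       Mod boundaries_k F i j"

text \<open>
  The additive group of \<open>Tor\<^sub>i\<^sup>S(I, \<k>)\<^sub>j\<close> for a homogeneous ideal \<open>I\<close> of \<open>S = \<k>[x\<^sub>1,\<dots>,x\<^sub>n]\<close>.
  Resolutions by graded free modules of finite rank exist because \<open>S\<close> is Noetherian, and
  up to isomorphism the homology does not depend on which one is chosen.
\<close>

definition Tor_k :: "nat \<Rightarrow> ('a::field) mpoly set \<Rightarrow> nat \<Rightarrow> int \<Rightarrow> (nat \<Rightarrow> 'a) set monoid" where
  "Tor_k n I = homology_k (SOME F. graded_free_resolution n I F)"

definition linearly_presented :: "nat \<Rightarrow> nat \<Rightarrow> ('a::field) mpoly set \<Rightarrow> bool" where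
  "linearly_presented n d I \<longleftrightarrow> (\<forall>j. j \<noteq> int d + 1 \<longrightarrow> trivial_group (Tor_k n I 1 j))"

text \<open>Meaningful for nonzero \<open>I\<close> only: for \<open>I = 0\<close> this is the maximum of the empty set.\<close>

definition reg :: "nat \<Rightarrow> ('a::field) mpoly set \<Rightarrow> int" where
  "reg n I = Max {j - int i | i j. \<not> trivial_group (Tor_k n I i j)}"

definition f_bound :: "nat \<Rightarrow> nat \<Rightarrow> int" where
  "f_bound n d =
     (if n < d then 0
      else if n = d then int d
      else \<lfloor>(real d - 1) * real n / (real d + 1)\<rfloor> + 1)"

end

theory Submission
  imports Defs "HOL-Library.Function_Algebras"
begin

text \<open>
  Cut the variables into consecutive blocks of \<open>k + 1\<close> variables, the last block possibly being
  shorter, and let \<open>s\<close> be the number of blocks. The products of the blocks are monomials in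
  disjoint sets of variables, hence a regular sequence, and the Koszul complex on them resolves
  the ideal \<open>J\<close> that they generate: every union \<open>W\<close> of \<open>t\<close> blocks contributes one class to
  \<open>Tor\<^sub>t\<^sub>-\<^sub>1(J, \<k>)\<close>, in degree \<open>card W\<close>, and there are no others. Let \<open>I\<close> be generated by the
  squarefree monomials of degree \<open>d = 2k + 1\<close> in \<open>J\<close>. This truncation changes \<open>Tor\<^sub>i\<close> in degree
  \<open>j\<close> only where \<open>j - i \<le> d\<close>, and it makes everything with \<open>j - i < d\<close> vanish. Two blocks have
  at most \<open>2k + 2 = d + 1\<close> elements, so \<open>Tor\<^sub>1(I, \<k>)\<close> lives in degree \<open>d + 1\<close> only. The largest
  value of \<open>j - i\<close> among the classes of \<open>J\<close> is \<open>n - s + 1\<close>, attained by the union of all blocks,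
  so that \<open>reg I = max d (n - s + 1)\<close>; and \<open>n - s\<close> is the integer part of \<open>kn / (k + 1)\<close>.

  The degrees in which \<open>Tor\<close> lives are obtained from the Koszul complex on the variables
  with coefficients in \<open>I\<close>. Since \<^const>\<open>Tor_k\<close> refers to an unspecified graded free resolution,
  two facts are required. A resolution exists, because the Taylor complex is one
  (\<open>taylor_resolution\<close>). Every resolution gives the same answer as the Koszul complex
  (\<open>trivial_Tor_iff_koszul_exact\<close>): a resolution splits into short exact sequences
  \<open>0 \<rightarrow> Z \<rightarrow> F \<rightarrow> M \<rightarrow> 0\<close> with \<open>F\<close> free, Koszul homology of \<open>F\<close> vanishes in positive
  homological degree, so replacing \<open>M\<close> by \<open>Z\<close> lowers the homological degree by one, and the last step
  compares \<open>Z \<otimes> \<k>\<close> with \<open>F \<otimes> \<k>\<close>, which is \<open>Tor\<close> by definition.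

  The Taylor complex and the Koszul complexes are graded by monomials, and in each multidegree \<open>u\<close>
  they are simplicial chain complexes over the field (\<open>pexact_iff\<close>). For the Taylor complex, and
  for the Koszul complex of a free module outside the multidegree of the monomial \<open>1\<close>, these
  simplicial complexes are cones. For \<open>I\<close> and
  squarefree \<open>u\<close> with support \<open>W\<close> the faces are the sets \<open>A \<subseteq> W\<close> such that \<open>W - A\<close> contains a
  block and has at least \<open>d\<close> elements. Apart from the bound on the cardinality this is a cone, or
  \<open>W\<close> is a union of \<open>t\<close> blocks and it consists of the sets that miss one of them, which has the
  homology of a sphere of dimension \<open>t - 2\<close> (\<open>exact_at_missing\<close>).
\<close>

section \<open>Signed boundary operators\<close>

text \<open>The parity is that of the position of \<open>v\<close> in \<open>insert v A\<close>, so this is the usual sign of a face of a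
simplex with ordered vertices.\<close>

definition signed :: "nat \<Rightarrow> nat set \<Rightarrow> 'b::ab_group_add \<Rightarrow> 'b" where
  "signed v A y = (if even (card {a \<in> A. a < v}) then y else - y)"

lemma signed_zero [simp]: "signed v A 0 = 0"
  and signed_uminus: "signed v A (- y) = - signed v A y"
  and signed_diff: "signed v A (y - z) = signed v A y - signed v A z"
  and signed_signed [simp]: "signed v A (signed v A y) = y"
  and signed_eq_0_iff [simp]: "signed v A y = 0 \<longleftrightarrow> y = 0"
  by (auto simp: signed_def)

lemma signed_sum: "signed v A (sum f B) = (\<Sum>b\<in>B. signed v A (f b))"
  by (simp add: signed_def sum_negf)

lemma signed_commute: "signed v A (signed w B y) = signed w B (signed v A y)"
  by (simp add: signed_def)

lemmas additive_zero = additive.zero[OF additive.intro]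
lemmas additive_uminus = additive.minus[OF additive.intro]
lemmas additive_diff = additive.diff[OF additive.intro]
lemmas additive_sum = additive.sum[OF additive.intro]

lemma additive_signed:
  fixes f :: "'b::ab_group_add \<Rightarrow> 'c::ab_group_add"
  assumes "\<And>y z. f (y + z) = f y + f z"
  shows "f (signed v A y) = signed v A (f y)"
  using additive_uminus[of f, OF assms] by (simp add: signed_def)

lemma signed_insert:
  assumes "v \<notin> A" "w \<noteq> v"
  shows "signed w (insert v A) y = (if v < w then - signed w A y else signed w A y)"
proof (cases "v < w")
  case True
  have "{a \<in> insert v A. a < w} = insert v {a \<in> A. a < w}" using True by auto
  then show ?thesis using True assms by (simp add: signed_def)
next
  case False
  then have "{a \<in> insert v A. a < w} = {a \<in> A. a < w}" by auto
  then show ?thesis using False by (simp add: signed_def)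
qed

text \<open>The sign depends on the order in which two vertices are adjoined; this is what makes the boundary
operators square to zero.\<close>

lemma signed_swap:
  assumes "v \<notin> A" "w \<notin> A" "v \<noteq> w"
  shows "signed v A (signed w (insert v A) y) = - signed w A (signed v (insert w A) y)"
proof (cases "v < w")
  case True
  with assms show ?thesis by (simp add: signed_insert signed_uminus signed_commute[of v A w A])
next
  case False
  with assms show ?thesis by (simp add: signed_insert signed_uminus signed_commute[of v A w A])
qed

text \<open>A chain is a function on all sets of vertices, and its support is restricted by separate
predicates, so that the boundary is a single total operator. The parameter \<open>act\<close> is the
multiplier that a coefficient picks up when the vertex \<open>v\<close> is dropped: the identity for simplicial
chains, a variable for Koszul complexes, a quotient of least common multiples for the Taylor
complex.\<close>

definition bd ::
  "nat set \<Rightarrow> (nat \<Rightarrow> nat set \<Rightarrow> 'b \<Rightarrow> 'b) \<Rightarrow> (nat set \<Rightarrow> 'b::ab_group_add) \<Rightarrow> nat set \<Rightarrow> 'b" where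
  "bd V act w A = (\<Sum>v\<in>V - A. signed v A (act v A (w (insert v A))))"

lemma bd_bd:
  assumes V: "finite V"
    and add: "\<And>v A y z. act v A (y + z) = act v A y + act v A z"
    and comm: "\<And>v w A y. \<lbrakk>v \<in> V - A; w \<in> V - A; v \<noteq> w\<rbrakk> \<Longrightarrow>
                 act v A (act w (insert v A) y) = act w A (act v (insert w A) y)"
  shows "bd V act (bd V act w) A = 0"
proof -
  define t where
    "t v w' = signed v A (act v A (signed w' (insert v A) (act w' (insert v A) (w (insert w' (insert v A))))))"
    for v w'
  have anti: "t v w' = - t w' v" if "v \<in> V - A" "w' \<in> V - A" "v \<noteq> w'" for v w'
  proof -
    have "t v w' = signed v A (signed w' (insert v A) (act v A (act w' (insert v A) (w (insert w' (insert v A))))))"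
      unfolding t_def by (simp add: additive_signed[of "act v A", OF add])
    also have "\<dots> = - signed w' A (signed v (insert w' A) (act v A (act w' (insert v A) (w (insert w' (insert v A))))))"
      using that by (intro signed_swap) auto
    also have "\<dots> = - t w' v"
      unfolding t_def using that comm[of v A w']
      by (simp add: additive_signed[of "act w' A", OF add] insert_commute)
    finally show ?thesis .
  qed
  let ?P = "{(v, w'). v \<in> V - A \<and> w' \<in> V - A \<and> v < w'}"
  have fin: "finite ?P"
    by (rule finite_subset[of _ "V \<times> V"]) (use V in auto)
  have "bd V act (bd V act w) A = (\<Sum>v\<in>V - A. \<Sum>w'\<in>V - insert v A. t v w')"
    unfolding bd_def t_def
    by (simp add: additive_sum[of "act _ _", OF add] signed_sum)
  also have "\<dots> = (\<Sum>(v, w')\<in>Sigma (V - A) (\<lambda>v. V - insert v A). t v w')"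
    using V by (subst sum.Sigma) auto
  also have "Sigma (V - A) (\<lambda>v. V - insert v A) = ?P \<union> prod.swap ` ?P"
    by (auto simp: image_iff)
  also have "(\<Sum>(v, w')\<in>?P \<union> prod.swap ` ?P. t v w') =
      (\<Sum>(v, w')\<in>?P. t v w') + (\<Sum>(v, w')\<in>prod.swap ` ?P. t v w')"
    by (rule sum.union_disjoint) (use fin in auto)
  also have "(\<Sum>(v, w')\<in>prod.swap ` ?P. t v w') = (\<Sum>(v, w')\<in>?P. t w' v)"
    by (subst sum.reindex) (auto intro!: sum.cong)
  also have "\<dots> = (\<Sum>(v, w')\<in>?P. - t v w')"
    by (rule sum.cong) (use anti in auto)
  also have "(\<Sum>(v, w')\<in>?P. t v w') + (\<Sum>(v, w')\<in>?P. - t v w') = 0"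
    by (simp add: sum_negf case_prod_unfold)
  finally show ?thesis .
qed

lemma bd_diff:
  assumes "\<And>v A y z. act v A (y + z) = act v A y + act v A z"
  shows "bd V act (\<lambda>A. w A - w' A) A = bd V act w A - bd V act w' A"
  unfolding bd_def by (simp add: additive_diff[of "act _ _", OF assms] signed_diff sum_subtractf)

section \<open>Exactness of simplicial chain complexes\<close>

abbreviation sbd :: "nat set \<Rightarrow> (nat set \<Rightarrow> 'a::ab_group_add) \<Rightarrow> nat set \<Rightarrow> 'a" where
  "sbd V \<equiv> bd V (\<lambda>v A y. y)"

definition schain :: "nat set set \<Rightarrow> nat \<Rightarrow> (nat set \<Rightarrow> 'a::ab_group_add) \<Rightarrow> bool" where
  "schain \<Delta> p c \<longleftrightarrow> (\<forall>A. c A \<noteq> 0 \<longrightarrow> A \<in> \<Delta> \<and> card A = p)"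

text \<open>Chains are indexed by the number \<open>p\<close> of vertices, and the empty set is a face with \<open>p = 0\<close>: this is
the vanishing of reduced homology in dimension \<open>p - 1\<close> with coefficients in \<open>'a\<close>.\<close>

definition exact_at :: "'a::ab_group_add itself \<Rightarrow> nat set \<Rightarrow> nat set set \<Rightarrow> nat \<Rightarrow> bool" where
  "exact_at TYPE('a) V \<Delta> p \<longleftrightarrow>
     (\<forall>c :: nat set \<Rightarrow> 'a. schain \<Delta> p c \<and> sbd V c = (\<lambda>_. 0) \<longrightarrow>
        (\<exists>c'. schain \<Delta> (Suc p) c' \<and> sbd V c' = c))"

definition down_closed :: "nat set set \<Rightarrow> bool" where
  "down_closed \<Delta> \<longleftrightarrow> (\<forall>A\<in>\<Delta>. \<forall>B. B \<subseteq> A \<longrightarrow> B \<in> \<Delta>)"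

lemma exact_atI:
  assumes "\<And>c :: nat set \<Rightarrow> 'a::ab_group_add. schain \<Delta> p c \<Longrightarrow> (\<And>A. sbd V c A = 0) \<Longrightarrow>
             \<exists>c'. schain \<Delta> (Suc p) c' \<and> (\<forall>A. sbd V c' A = c A)"
  shows "exact_at TYPE('a) V \<Delta> p"
  unfolding exact_at_def fun_eq_iff using assms by blast

lemma exact_atD:
  fixes c :: "nat set \<Rightarrow> 'a::ab_group_add"
  assumes "exact_at TYPE('a) V \<Delta> p" "schain \<Delta> p c" "\<And>A. sbd V c A = 0"
  obtains c' where "schain \<Delta> (Suc p) c'" "\<And>A. sbd V c' A = c A"
  using assms unfolding exact_at_def fun_eq_iff by blast

lemma sbd_diff: "sbd V (\<lambda>A. c A - c' A) A = sbd V c A - sbd V c' A"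
  by (rule bd_diff) simp

lemma sbd_uminus: "sbd V (\<lambda>A. - c A) A = - sbd V c A"
  by (simp add: bd_def signed_uminus sum_negf)

lemma schain_uminus: "schain \<Delta> p c \<Longrightarrow> schain \<Delta> p (\<lambda>A. - c A)"
  by (simp add: schain_def)

lemma schain_diff: "schain \<Delta> p c \<Longrightarrow> schain \<Delta> p c' \<Longrightarrow> schain \<Delta> p (\<lambda>A. c A - c' A)"
  unfolding schain_def by (metis diff_self)

lemma schain_mono: "schain \<Delta> p c \<Longrightarrow> \<Delta> \<subseteq> \<Gamma> \<Longrightarrow> schain \<Gamma> p c"
  by (auto simp: schain_def)

lemma exact_at_no_faces:
  assumes "\<And>A. A \<in> \<Delta> \<Longrightarrow> card A \<noteq> p"
  shows "exact_at TYPE('a::ab_group_add) V \<Delta> p"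
proof (rule exact_atI)
  fix c :: "nat set \<Rightarrow> 'a" assume "schain \<Delta> p c"
  then have "c = (\<lambda>_. 0)" using assms unfolding schain_def by blast
  then show "\<exists>c'. schain \<Delta> (Suc p) c' \<and> (\<forall>A. sbd V c' A = c A)"
    by (intro exI[of _ "\<lambda>_. 0"]) (simp add: schain_def bd_def)
qed

text \<open>Without vertices the empty face is a cycle that bounds nothing.\<close>

lemma not_exact_at_0:
  assumes "{} \<in> \<Delta>" "\<And>A. A \<in> \<Delta> \<Longrightarrow> card A \<noteq> Suc 0"
  shows "\<not> exact_at TYPE('a::field) V \<Delta> 0"
proof
  assume ex: "exact_at TYPE('a) V \<Delta> 0"
  define c where "c A = (if A = {} then 1 else 0 :: 'a)" for A :: "nat set"
  have c: "schain \<Delta> 0 c" "\<And>A. sbd V c A = 0"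
    using assms(1) by (auto simp: schain_def c_def bd_def)
  obtain c' where c': "schain \<Delta> (Suc 0) c'" "\<And>A. sbd V c' A = c A"
    using exact_atD[OF ex c] by blast
  have "c' A = 0" for A using c'(1) assms(2) unfolding schain_def by blast
  then have "c {} = 0" using c'(2)[of "{}"] by (simp add: bd_def)
  then show False by (simp add: c_def)
qed

lemma exact_at_cong:
  assumes "\<And>A. card A = p \<or> card A = Suc p \<Longrightarrow> A \<in> \<Delta> \<longleftrightarrow> A \<in> \<Gamma>"
  shows "exact_at TYPE('a::ab_group_add) V \<Delta> p \<longleftrightarrow> exact_at TYPE('a) V \<Gamma> p"
proof -
  have "schain \<Delta> p = (schain \<Gamma> p :: (nat set \<Rightarrow> 'a) \<Rightarrow> bool)"
    "schain \<Delta> (Suc p) = (schain \<Gamma> (Suc p) :: (nat set \<Rightarrow> 'a) \<Rightarrow> bool)"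
    unfolding schain_def by (intro ext iff_allI; use assms in blast)+
  then show ?thesis by (simp only: exact_at_def)
qed

lemma sbd_split:
  assumes "finite V" "v \<in> V" "v \<notin> A"
  shows "sbd V c A = signed v A (c (insert v A)) + (\<Sum>w\<in>V - insert v A. signed w A (c (insert w A)))"
proof -
  have "V - A = insert v (V - insert v A)" using assms by auto
  then show ?thesis using assms unfolding bd_def by (metis (no_types, lifting) Diff_iff finite_Diff insertI1 sum.insert)
qed

text \<open>Adjoining the apex \<open>v\<close> to all faces is a contracting homotopy.\<close>

lemma exact_at_cone:
  assumes V: "finite V" "\<Delta> \<subseteq> Pow V" and v: "v \<in> V" "\<And>A. A \<in> \<Delta> \<Longrightarrow> insert v A \<in> \<Delta>"
  shows "exact_at TYPE('a::ab_group_add) V \<Delta> p"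
proof (rule exact_atI)
  fix c :: "nat set \<Rightarrow> 'a"
  assume c: "schain \<Delta> p c" and cyc: "\<And>A. sbd V c A = 0"
  define h where "h A = (if v \<in> A then signed v (A - {v}) (c (A - {v})) else 0)" for A
  have "schain \<Delta> (Suc p) h"
    unfolding schain_def
  proof (intro allI impI)
    fix A assume "h A \<noteq> 0"
    then have A: "v \<in> A" "c (A - {v}) \<noteq> 0" by (auto simp: h_def split: if_splits)
    then have \<Delta>: "A - {v} \<in> \<Delta>" "card (A - {v}) = p" using c by (auto simp: schain_def)
    then have "finite A" using V by (metis PowD finite_Diff_insert finite_subset insert_absorb subsetD finite.emptyI finite_Diff2 finite_insert)
    then show "A \<in> \<Delta> \<and> card A = Suc p" using \<Delta> v(2)[of "A - {v}"] A
      by (metis card_Suc_Diff1 insert_Diff)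
  qed
  moreover have "sbd V h A = c A" for A
  proof (cases "v \<in> A")
    case False
    have "sbd V h A = signed v A (h (insert v A)) + (\<Sum>w\<in>V - insert v A. signed w A (h (insert w A)))"
      using sbd_split[of V v A] V v False by blast
    also have "(\<Sum>w\<in>V - insert v A. signed w A (h (insert w A))) = 0"
      by (rule sum.neutral) (use False in \<open>auto simp: h_def\<close>)
    finally show ?thesis using False by (simp add: h_def[of "insert v A"])
  next
    case True
    define B where "B = A - {v}"
    have A: "A = insert v B" "v \<notin> B" using True by (auto simp: B_def)
    have "sbd V h A = (\<Sum>w\<in>V - insert v B. - signed v B (signed w B (c (insert w B))))"
      unfolding bd_def A(1)
    proof (rule sum.cong)
      fix w assume w: "w \<in> V - insert v B"
      then have "h (insert w (insert v B)) = signed v (insert w B) (c (insert w B))"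
        using A by (auto simp: h_def insert_Diff_if)
      then show "signed w (insert v B) (h (insert w (insert v B))) =
          - signed v B (signed w B (c (insert w B)))"
        using w A by (auto simp: signed_insert signed_uminus signed_commute[of w B v B])
    qed simp
    also have "\<dots> = signed v B (- (\<Sum>w\<in>V - insert v B. signed w B (c (insert w B))))"
      by (simp add: signed_sum signed_uminus sum_negf)
    also have "- (\<Sum>w\<in>V - insert v B. signed w B (c (insert w B))) = signed v B (c (insert v B))"
      using sbd_split[of V v B c] V v A cyc[of B] by (intro minus_unique) (simp add: add.commute)
    finally show ?thesis using A by simp
  qed
  ultimately show "\<exists>c'. schain \<Delta> (Suc p) c' \<and> (\<forall>A. sbd V c' A = c A)" by blast
qed

subsection \<open>Links and deletions\<close>

text \<open>Splitting the faces into those with and those without the vertex \<open>v\<close> exhibits the chain complex as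
the mapping cone of the inclusion of the link of \<open>v\<close> into its deletion (\<open>sbd_join\<close>). The lemmas
\<open>exact_at_of_link_deletion\<close>, \<open>exact_at_deletion\<close> and \<open>exact_at_link\<close> are the parts of the
resulting long exact sequence in which one of the three terms drops out.\<close>

definition deletion :: "nat \<Rightarrow> nat set set \<Rightarrow> nat set set" where
  "deletion v \<Delta> = {A \<in> \<Delta>. v \<notin> A}"

definition link :: "nat \<Rightarrow> nat set set \<Rightarrow> nat set set" where
  "link v \<Delta> = {A. v \<notin> A \<and> insert v A \<in> \<Delta>}"

definition join :: "nat \<Rightarrow> (nat set \<Rightarrow> 'a) \<Rightarrow> (nat set \<Rightarrow> 'a) \<Rightarrow> nat set \<Rightarrow> 'a::ab_group_add" where
  "join v a b A = (if v \<in> A then signed v (A - {v}) (b (A - {v})) else a A)"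

lemma sbd_join:
  assumes "finite V" "v \<in> V" and a: "\<And>A. v \<in> A \<Longrightarrow> a A = 0" and b: "\<And>A. v \<in> A \<Longrightarrow> b A = 0"
  shows "sbd V (join v a b) = join v (\<lambda>A. sbd V a A + b A) (\<lambda>A. - sbd V b A)"
proof
  fix A
  show "sbd V (join v a b) A = join v (\<lambda>A. sbd V a A + b A) (\<lambda>A. - sbd V b A) A"
  proof (cases "v \<in> A")
    case False
    have "(\<Sum>w\<in>V - insert v A. signed w A (join v a b (insert w A))) =
        (\<Sum>w\<in>V - insert v A. signed w A (a (insert w A)))"
      by (rule sum.cong) (use False in \<open>auto simp: join_def\<close>)
    then show ?thesis
      using sbd_split[of V v A a] sbd_split[of V v A "join v a b"] assms False
      by (simp add: join_def)
  next
    case True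
    define B where "B = A - {v}"
    have A: "A = insert v B" "v \<notin> B" using True by (auto simp: B_def)
    have "sbd V (join v a b) A = (\<Sum>w\<in>V - insert v B. - signed v B (signed w B (b (insert w B))))"
      unfolding bd_def A(1)
    proof (rule sum.cong)
      fix w assume w: "w \<in> V - insert v B"
      then have "join v a b (insert w (insert v B)) = signed v (insert w B) (b (insert w B))"
        using A by (auto simp: join_def insert_Diff_if)
      then show "signed w (insert v B) (join v a b (insert w (insert v B))) =
          - signed v B (signed w B (b (insert w B)))"
        using w A by (auto simp: signed_insert signed_uminus signed_commute[of w B v B])
    qed simp
    also have "\<dots> = - signed v B (sbd V b B)"
      using sbd_split[of V v B b] assms A by (simp add: signed_sum sum_negf)
    finally show ?thesis using A by (simp add: join_def signed_uminus)
  qed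
qed

lemma sbd_vanishes_on_star:
  assumes "\<And>A. v \<in> A \<Longrightarrow> a A = 0" "v \<in> A"
  shows "sbd V a A = 0"
  unfolding bd_def using assms by (intro sum.neutral) auto

lemma join_decompose:
  "c = join v (\<lambda>A. if v \<in> A then 0 else c A) (\<lambda>A. if v \<in> A then 0 else signed v A (c (insert v A)))"
  by (auto simp: join_def fun_eq_iff insert_absorb)

lemma join_eq_0D:
  assumes "join v a b = (\<lambda>_. 0)"
  shows "v \<notin> A \<Longrightarrow> a A = 0" "v \<notin> A \<Longrightarrow> b A = 0"
  using fun_cong[OF assms, of A] fun_cong[OF assms, of "insert v A"] by (auto simp: join_def)

lemma schain_join:
  assumes \<Delta>: "\<Delta> \<subseteq> Pow V" "finite V"
    and a: "schain (deletion v \<Delta>) p a"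
    and b: "\<And>A. b A \<noteq> 0 \<Longrightarrow> A \<in> link v \<Delta> \<and> Suc (card A) = p"
  shows "schain \<Delta> p (join v a b)"
  unfolding schain_def
proof (intro allI impI)
  fix A assume nz: "join v a b A \<noteq> 0"
  show "A \<in> \<Delta> \<and> card A = p"
  proof (cases "v \<in> A")
    case True
    then have "b (A - {v}) \<noteq> 0" using nz by (auto simp: join_def)
    then have *: "A - {v} \<in> link v \<Delta>" "Suc (card (A - {v})) = p" using b by blast+
    then have "A \<in> \<Delta>" using True by (simp add: link_def insert_absorb)
    moreover have "finite A" using calculation \<Delta> finite_subset by blast
    ultimately show ?thesis using * True by (metis card_Suc_Diff1)
  next
    case False
    then show ?thesis using nz a by (auto simp: join_def schain_def deletion_def)
  qed
qed

lemma schain_split: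
  assumes \<Delta>: "\<Delta> \<subseteq> Pow V" "finite V" and c: "schain \<Delta> p c"
  obtains a b where "c = join v a b" "schain (deletion v \<Delta>) p a"
    "\<And>A. b A \<noteq> 0 \<Longrightarrow> A \<in> link v \<Delta> \<and> Suc (card A) = p"
proof
  let ?a = "\<lambda>A. if v \<in> A then 0 else c A"
  let ?b = "\<lambda>A. if v \<in> A then 0 else signed v A (c (insert v A))"
  show "c = join v ?a ?b" by (rule join_decompose)
  show "schain (deletion v \<Delta>) p ?a" using c by (auto simp: schain_def deletion_def)
  fix A assume "?b A \<noteq> 0"
  then have A: "v \<notin> A" "insert v A \<in> \<Delta>" "card (insert v A) = p"
    using c by (auto simp: schain_def split: if_splits)
  moreover have "finite A" using A \<Delta> finite_subset by (metis PowD finite_insert subsetD)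
  ultimately show "A \<in> link v \<Delta> \<and> Suc (card A) = p" by (simp add: link_def)
qed

lemma deletion_avoids: "schain (deletion v \<Delta>) p a \<Longrightarrow> v \<in> A \<Longrightarrow> a A = 0"
  by (auto simp: schain_def deletion_def)

lemma link_subset_deletion: "down_closed \<Delta> \<Longrightarrow> link v \<Delta> \<subseteq> deletion v \<Delta>"
  by (auto simp: link_def deletion_def down_closed_def)

lemma exact_at_of_link_deletion:
  assumes \<Delta>: "\<Delta> \<subseteq> Pow V" "finite V" "down_closed \<Delta>" and v: "v \<in> V"
    and del: "exact_at TYPE('a::ab_group_add) V (deletion v \<Delta>) p"
    and link: "\<And>q. p = Suc q \<Longrightarrow> exact_at TYPE('a) V (link v \<Delta>) q"
  shows "exact_at TYPE('a) V \<Delta> p"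
proof (rule exact_atI)
  fix c :: "nat set \<Rightarrow> 'a"
  assume c: "schain \<Delta> p c" and cyc: "\<And>A. sbd V c A = 0"
  obtain a b where ab: "c = join v a b" "schain (deletion v \<Delta>) p a"
    "\<And>A. b A \<noteq> 0 \<Longrightarrow> A \<in> link v \<Delta> \<and> Suc (card A) = p"
    using schain_split[OF \<Delta>(1,2) c] by metis
  have a0: "a A = 0" if "v \<in> A" for A using deletion_avoids[OF ab(2) that] .
  have b0: "b A = 0" if "v \<in> A" for A using ab(3)[of A] that by (auto simp: link_def)
  have "join v (\<lambda>A. sbd V a A + b A) (\<lambda>A. - sbd V b A) = (\<lambda>_. 0)"
    using cyc sbd_join[OF \<Delta>(2) v, of a b] a0 b0 ab(1) by (simp add: fun_eq_iff)
  from join_eq_0D[OF this]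
  have 1: "sbd V a A + b A = 0" and 2: "sbd V b A = 0" for A
    using sbd_vanishes_on_star[of v a] sbd_vanishes_on_star[of v b] a0 b0
    by (cases "v \<in> A"; simp)+
  have "\<exists>b'. schain (link v \<Delta>) p b' \<and> (\<forall>A. - sbd V b' A = b A)"
  proof (cases p)
    case 0
    then have "\<And>A. b A = 0" using ab(3) by blast
    then show ?thesis by (intro exI[of _ "\<lambda>_. 0"]) (simp add: schain_def bd_def)
  next
    case (Suc q)
    have "schain (link v \<Delta>) q b" using ab(3) Suc by (auto simp: schain_def)
    then obtain b' where "schain (link v \<Delta>) (Suc q) b'" "\<And>A. sbd V b' A = b A"
      using exact_atD[OF link[OF Suc]] 2 by metis
    then show ?thesis using Suc
      by (intro exI[of _ "\<lambda>A. - b' A"]) (simp add: schain_uminus sbd_uminus)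
  qed
  then obtain b' where b': "schain (link v \<Delta>) p b'" "\<And>A. - sbd V b' A = b A" by blast
  \<comment> \<open>A bounding chain b' of the part on the link is itself a chain of the deletion and corrects a to a cycle.\<close>
  have diff: "schain (deletion v \<Delta>) p (\<lambda>A. a A - b' A)"
    using ab(2) schain_mono[OF b'(1) link_subset_deletion[OF \<Delta>(3)]] by (rule schain_diff)
  have diff_cyc: "sbd V (\<lambda>A. a A - b' A) A = 0" for A
  proof -
    have "sbd V a A = - b A" using 1[of A] by (simp only: eq_neg_iff_add_eq_0)
    moreover have "sbd V b' A = - b A" unfolding b'(2)[of A, symmetric] by simp
    ultimately show ?thesis by (simp only: sbd_diff diff_self)
  qed
  obtain a' where a': "schain (deletion v \<Delta>) (Suc p) a'" "\<And>A. sbd V a' A = a A - b' A"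
    using exact_atD[OF del diff diff_cyc] by metis
  have b'0: "b' A = 0" if "v \<in> A" for A using b'(1) that by (auto simp: schain_def link_def)
  have "schain \<Delta> (Suc p) (join v a' b')"
    by (rule schain_join[OF \<Delta>(1,2) a'(1)]) (use b'(1) in \<open>auto simp: schain_def\<close>)
  moreover have "sbd V (join v a' b') = c"
    using sbd_join[OF \<Delta>(2) v, of a' b'] deletion_avoids[OF a'(1)] b'0 a'(2) b'(2) ab(1) by simp
  ultimately show "\<exists>c'. schain \<Delta> (Suc p) c' \<and> (\<forall>A. sbd V c' A = c A)" by blast
qed

lemma exact_at_deletion:
  assumes \<Delta>: "\<Delta> \<subseteq> Pow V" "finite V" "down_closed \<Delta>" and v: "v \<in> V"
    and ex: "exact_at TYPE('a::ab_group_add) V \<Delta> p"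
    and link: "exact_at TYPE('a) V (link v \<Delta>) p"
  shows "exact_at TYPE('a) V (deletion v \<Delta>) p"
proof (rule exact_atI)
  fix a :: "nat set \<Rightarrow> 'a"
  assume a: "schain (deletion v \<Delta>) p a" and cyc: "\<And>A. sbd V a A = 0"
  have aX: "schain \<Delta> p a" by (rule schain_mono[OF a]) (auto simp: deletion_def)
  obtain c' where c': "schain \<Delta> (Suc p) c'" "\<And>A. sbd V c' A = a A"
    using exact_atD[OF ex aX cyc] by metis
  obtain a' b' where ab: "c' = join v a' b'" "schain (deletion v \<Delta>) (Suc p) a'"
    "\<And>A. b' A \<noteq> 0 \<Longrightarrow> A \<in> link v \<Delta> \<and> Suc (card A) = Suc p"
    using schain_split[OF \<Delta>(1,2) c'(1)] by metis
  have b0: "b' A = 0" if "v \<in> A" for A using ab(3)[of A] that by (auto simp: link_def)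
  have eq: "join v (\<lambda>A. sbd V a' A + b' A) (\<lambda>A. - sbd V b' A) A = a A" for A
    using c'(2)[of A] sbd_join[OF \<Delta>(2) v, of a' b'] deletion_avoids[OF ab(2)] b0 ab(1) by simp
  have 1: "sbd V a' A + b' A = a A" for A
    using eq[of A] sbd_vanishes_on_star[of v a' A] deletion_avoids[OF ab(2)] b0 deletion_avoids[OF a]
    by (cases "v \<in> A") (auto simp: join_def)
  have 2: "sbd V b' A = 0" for A
  proof (cases "v \<in> A")
    case True
    then show ?thesis using sbd_vanishes_on_star[of v b'] b0 by blast
  next
    case False
    then show ?thesis using eq[of "insert v A"] deletion_avoids[OF a, of "insert v A"] by (simp add: join_def)
  qed
  have "schain (link v \<Delta>) p b'" using ab(3) by (auto simp: schain_def)
  then obtain b'' where b'': "schain (link v \<Delta>) (Suc p) b''" "\<And>A. sbd V b'' A = b' A"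
    using exact_atD[OF link] 2 by metis
  have "schain (deletion v \<Delta>) (Suc p) (\<lambda>A. a' A - (- b'' A))"
    by (rule schain_diff[OF ab(2) schain_uminus[OF schain_mono[OF b''(1) link_subset_deletion[OF \<Delta>(3)]]]])
  moreover have "sbd V (\<lambda>A. a' A - (- b'' A)) A = a A" for A
    using 1[of A] b''(2)[of A] sbd_diff[of V a' "\<lambda>A. - b'' A" A] by (simp only: sbd_uminus) simp
  ultimately show "\<exists>c'. schain (deletion v \<Delta>) (Suc p) c' \<and> (\<forall>A. sbd V c' A = a A)" by blast
qed

lemma exact_at_link:
  assumes \<Delta>: "\<Delta> \<subseteq> Pow V" "finite V" "down_closed \<Delta>" and v: "v \<in> V"
    and ex: "exact_at TYPE('a::ab_group_add) V \<Delta> (Suc p)"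
    and del: "exact_at TYPE('a) V (deletion v \<Delta>) p"
  shows "exact_at TYPE('a) V (link v \<Delta>) p"
proof (rule exact_atI)
  fix b :: "nat set \<Rightarrow> 'a"
  assume b: "schain (link v \<Delta>) p b" and cyc: "\<And>A. sbd V b A = 0"
  obtain a0 where a0: "schain (deletion v \<Delta>) (Suc p) a0" "\<And>A. sbd V a0 A = b A"
    using exact_atD[OF del schain_mono[OF b link_subset_deletion[OF \<Delta>(3)]] cyc] by metis
  define a where "a = (\<lambda>A. - a0 A)"
  have a: "schain (deletion v \<Delta>) (Suc p) a" "\<And>A. sbd V a A = - b A"
    using a0 by (simp_all add: a_def schain_uminus sbd_uminus)
  have b0: "b A = 0" if "v \<in> A" for A using b that by (auto simp: schain_def link_def)
  have c: "schain \<Delta> (Suc p) (join v a b)"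
    by (rule schain_join[OF \<Delta>(1,2) a(1)]) (use b in \<open>auto simp: schain_def\<close>)
  have "sbd V (join v a b) A = 0" for A
    using sbd_join[OF \<Delta>(2) v, of a b] deletion_avoids[OF a(1)] b0 a(2) cyc by (simp add: join_def)
  then obtain c' where c': "schain \<Delta> (Suc (Suc p)) c'" "\<And>A. sbd V c' A = join v a b A"
    using exact_atD[OF ex c] by metis
  obtain a' b' where ab: "c' = join v a' b'" "schain (deletion v \<Delta>) (Suc (Suc p)) a'"
    "\<And>A. b' A \<noteq> 0 \<Longrightarrow> A \<in> link v \<Delta> \<and> Suc (card A) = Suc (Suc p)"
    using schain_split[OF \<Delta>(1,2) c'(1)] by metis
  have b'0: "b' A = 0" if "v \<in> A" for A using ab(3)[of A] that by (auto simp: link_def)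
  have eq: "join v (\<lambda>A. sbd V a' A + b' A) (\<lambda>A. - sbd V b' A) A = join v a b A" for A
    using c'(2)[of A] sbd_join[OF \<Delta>(2) v, of a' b'] deletion_avoids[OF ab(2)] b'0 ab(1) by simp
  have "- sbd V b' A = b A" for A
    using eq[of "insert v A"] sbd_vanishes_on_star[of v b' A] b'0 b0[of A]
    by (cases "v \<in> A") (auto simp: join_def signed_def split: if_splits)
  moreover have "schain (link v \<Delta>) (Suc p) b'" using ab(3) by (auto simp: schain_def)
  ultimately show "\<exists>c'. schain (link v \<Delta>) (Suc p) c' \<and> (\<forall>A. sbd V c' A = b A)"
    by (intro exI[of _ "\<lambda>A. - b' A"]) (simp add: schain_uminus sbd_uminus)
qed

subsection \<open>Sets that miss a block\<close>

definition missing :: "(nat \<Rightarrow> nat) \<Rightarrow> nat set \<Rightarrow> nat set set" where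
  "missing blk W = {A. A \<subseteq> W \<and> blk ` A \<noteq> blk ` W}"

lemma down_closed_missing: "down_closed (missing blk W)"
  unfolding down_closed_def
proof (intro ballI allI impI)
  fix A B assume "A \<in> missing blk W" and BA: "B \<subseteq> A"
  then have A: "A \<subseteq> W" "blk ` A \<noteq> blk ` W" by (simp_all add: missing_def)
  have "blk ` B \<subseteq> blk ` A" "blk ` A \<subseteq> blk ` W" using BA A by (auto intro: image_mono)
  then have "blk ` A = blk ` W" if "blk ` B = blk ` W" using that by (intro subset_antisym) simp_all
  then have "blk ` B \<noteq> blk ` W" using A by blast
  then show "B \<in> missing blk W" using A BA by (simp add: missing_def)
qed

text \<open>The complements of the \<open>t\<close> blocks are simplices that cover this complex. Any proper subfamily of
them meets in a nonempty simplex and all of them have only the empty face in common, so the nerve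
is the boundary of a simplex with \<open>t\<close> vertices, a sphere of dimension \<open>t - 2\<close>. The induction reaches
this without the nerve by removing one vertex \<open>v\<close>. If its block has another vertex \<open>v'\<close>, the link of \<open>v\<close> is a cone over
\<open>v'\<close>, and deleting \<open>v\<close> changes nothing. If \<open>v\<close> is a block by itself, the deletion is a full
simplex and the link is the complex of the remaining blocks, so the complex is a suspension and
\<open>p\<close> moves by one.\<close>

lemma exact_at_missing:
  fixes blk :: "nat \<Rightarrow> nat"
  assumes "finite W" "W \<subseteq> V" "finite V"
  shows "exact_at TYPE('a::field) V (missing blk W) p \<longleftrightarrow> Suc p \<noteq> card (blk ` W)"
  using assms
proof (induction W arbitrary: p rule: finite_induct)
  case empty
  then show ?case by (auto simp: missing_def intro: exact_at_no_faces)
next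
  case (insert v W)
  let ?\<Delta> = "missing blk (insert v W)"
  have \<Delta>: "?\<Delta> \<subseteq> Pow V" "finite V" "v \<in> V" using insert.prems by (auto simp: missing_def)
  have dc: "down_closed ?\<Delta>" by (rule down_closed_missing)
  have IH: "exact_at TYPE('a) V (missing blk W) q \<longleftrightarrow> Suc q \<noteq> card (blk ` W)" for q
    using insert.IH insert.prems by blast
  show ?case
  proof (cases "blk v \<in> blk ` W")
    case True
    then obtain v' where v': "v' \<in> W" "blk v' = blk v" by force
    have eq: "blk ` insert v W = blk ` W" using True by auto
    have del: "deletion v ?\<Delta> = missing blk W"
      using insert.hyps unfolding deletion_def missing_def eq by auto
    have lk: "exact_at TYPE('a) V (link v ?\<Delta>) q" for q
    proof (rule exact_at_cone[where v = v'])
      show "link v ?\<Delta> \<subseteq> Pow V" using \<Delta>(1) by (auto simp: link_def missing_def)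
      show "v' \<in> V" using v' insert.prems by blast
      fix A assume "A \<in> link v ?\<Delta>"
      moreover have "blk ` insert v (insert v' A) = blk ` insert v A" using v' by auto
      moreover have "v' \<noteq> v" using v' insert.hyps by blast
      ultimately show "insert v' A \<in> link v ?\<Delta>" using v' by (auto simp: link_def missing_def)
    qed (use \<Delta> in auto)
    have "exact_at TYPE('a) V ?\<Delta> p \<longleftrightarrow> exact_at TYPE('a) V (deletion v ?\<Delta>) p"
    proof
      assume "exact_at TYPE('a) V (deletion v ?\<Delta>) p"
      then show "exact_at TYPE('a) V ?\<Delta> p"
        by (rule exact_at_of_link_deletion[OF \<Delta>(1,2) dc \<Delta>(3)]) (rule lk)
    next
      assume "exact_at TYPE('a) V ?\<Delta> p"
      then show "exact_at TYPE('a) V (deletion v ?\<Delta>) p"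
        by (rule exact_at_deletion[OF \<Delta>(1,2) dc \<Delta>(3)]) (rule lk)
    qed
    then show ?thesis using IH[of p] eq del by simp
  next
    case False
    have cd: "card (blk ` insert v W) = Suc (card (blk ` W))"
      using False insert.hyps by simp
    have "blk ` A \<noteq> blk ` insert v W" if "A \<subseteq> W" for A
      using image_mono[OF that, of blk] False by auto
    then have del: "deletion v ?\<Delta> = Pow W"
      using insert.hyps unfolding deletion_def missing_def by auto
    have lk: "link v ?\<Delta> = missing blk W"
    proof (rule Set.set_eqI)
      fix A
      show "A \<in> link v ?\<Delta> \<longleftrightarrow> A \<in> missing blk W"
      proof (cases "A \<subseteq> W")
        case True
        then have "blk v \<notin> blk ` A" using False by blast
        then have "blk ` insert v A = blk ` insert v W \<longleftrightarrow> blk ` A = blk ` W"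
          using False insert_ident[of "blk v" "blk ` A" "blk ` W"] by simp
        then show ?thesis using True insert.hyps by (auto simp: link_def missing_def)
      next
        case False
        then show ?thesis by (auto simp: link_def missing_def)
      qed
    qed
    show ?thesis
    proof (cases "W = {}")
      case True
      have eq: "?\<Delta> = {{}}" using True by (auto simp: missing_def)
      have cd1: "card (blk ` insert v W) = Suc 0" using cd True by simp
      show ?thesis
      proof (cases "p = 0")
        case True
        have "\<not> exact_at TYPE('a) V ?\<Delta> 0" by (rule not_exact_at_0) (simp_all add: eq)
        then show ?thesis unfolding True cd1 by blast
      next
        case False
        have "exact_at TYPE('a) V ?\<Delta> p" by (rule exact_at_no_faces) (use False eq in auto)
        then show ?thesis using False unfolding cd1 by blast
      qed
    next
      case False
      then obtain w where w: "w \<in> W" by blast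
      have dele: "exact_at TYPE('a) V (deletion v ?\<Delta>) q" for q
        unfolding del by (rule exact_at_cone[where v = w]) (use w insert.prems \<Delta> in auto)
      show ?thesis
      proof (cases p)
        case 0
        have "exact_at TYPE('a) V ?\<Delta> p"
          by (rule exact_at_of_link_deletion[OF \<Delta>(1,2) dc \<Delta>(3) dele]) (use 0 in simp)
        moreover have "card (blk ` W) > 0" using False insert.hyps by (simp add: card_gt_0_iff)
        ultimately show ?thesis using 0 cd by simp
      next
        case (Suc q)
        have "exact_at TYPE('a) V ?\<Delta> p \<longleftrightarrow> exact_at TYPE('a) V (link v ?\<Delta>) q"
        proof
          assume lke: "exact_at TYPE('a) V (link v ?\<Delta>) q"
          show "exact_at TYPE('a) V ?\<Delta> p"
            by (rule exact_at_of_link_deletion[OF \<Delta>(1,2) dc \<Delta>(3) dele]) (use lke Suc in simp)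
        next
          assume "exact_at TYPE('a) V ?\<Delta> p"
          then show "exact_at TYPE('a) V (link v ?\<Delta>) q"
            using exact_at_link[OF \<Delta>(1,2) dc \<Delta>(3) _ dele] Suc by simp
        qed
        then show ?thesis using IH[of q] lk Suc cd by simp
      qed
    qed
  qed
qed

section \<open>Multigraded chain complexes of polynomials\<close>

subsection \<open>Monomials\<close>

abbreviation "keys \<equiv> Poly_Mapping.keys"
abbreviation "lookup \<equiv> Poly_Mapping.lookup"
abbreviation "single \<equiv> Poly_Mapping.single"

lemma mon_degree_superset:
  assumes "finite F" "keys m \<subseteq> F"
  shows "mon_degree m = (\<Sum>i\<in>F. lookup m i)"
  unfolding mon_degree_def
  by (rule sum.mono_neutral_left) (use assms in \<open>auto simp: in_keys_iff\<close>)

lemma mon_degree_add: "mon_degree (m + m') = mon_degree m + mon_degree m'"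
proof -
  let ?F = "keys m \<union> keys m'"
  have "keys (m + m') \<subseteq> ?F" by (rule keys_add)
  then show ?thesis
    by (simp add: mon_degree_superset[of ?F] lookup_add sum.distrib)
qed

lemma keys_add_monomial:
  fixes m m' :: monomial
  shows "keys (m + m') = keys m \<union> keys m'"
  by (auto simp: in_keys_iff lookup_add)

definition sqf :: "nat set \<Rightarrow> monomial" where
  "sqf W = (\<Sum>i\<in>W. single i 1)"

lemma lookup_sqf: "finite W \<Longrightarrow> lookup (sqf W) i = (if i \<in> W then 1 else 0)"
  by (simp add: sqf_def lookup_sum lookup_single when_def)

lemma keys_sqf: "finite W \<Longrightarrow> keys (sqf W) = W"
  by (rule Set.set_eqI) (simp add: in_keys_iff lookup_sqf)

lemma mon_degree_sqf: "finite W \<Longrightarrow> mon_degree (sqf W) = card W"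
  by (simp add: mon_degree_def keys_sqf lookup_sqf)

lemma sqf_empty [simp]: "sqf {} = 0"
  by (simp add: sqf_def)

lemma sqf_Un:
  assumes "finite W" "finite W'" "W \<inter> W' = {}"
  shows "sqf (W \<union> W') = sqf W + sqf W'"
  using assms by (simp add: sqf_def sum.union_disjoint)

lemma sqf_adds_iff:
  assumes "finite W"
  shows "(\<exists>m. u = m + sqf W) \<longleftrightarrow> W \<subseteq> keys u"
proof
  assume "\<exists>m. u = m + sqf W"
  then show "W \<subseteq> keys u" using assms by (auto simp: keys_add_monomial keys_sqf)
next
  assume W: "W \<subseteq> keys u"
  have "u = (u - sqf W) + sqf W"
  proof (rule poly_mapping_eqI)
    fix i
    show "lookup u i = lookup (u - sqf W + sqf W) i"
      using W assms by (auto simp: lookup_add lookup_minus lookup_sqf in_keys_iff)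
  qed
  then show "\<exists>m. u = m + sqf W" by blast
qed

lemma lookup_single_times:
  fixes q :: "'a::field mpoly"
  shows "lookup (single e c * q) (e + m) = c * lookup q m"
  by (simp add: lookup_mult lookup_single when_mult)

lemma lookup_single_times_eq_0:
  fixes q :: "'a::field mpoly"
  assumes "\<nexists>m. k = e + m"
  shows "lookup (single e c * q) k = 0"
  using assms by (simp add: lookup_mult lookup_single when_mult)

lemma keys_single_times:
  fixes q :: "'a::field mpoly"
  shows "keys (mon_poly e * q) = (\<lambda>m. e + m) ` keys q"
proof (rule Set.set_eqI)
  fix k
  show "k \<in> keys (mon_poly e * q) \<longleftrightarrow> k \<in> (\<lambda>m. e + m) ` keys q"
  proof (cases "\<exists>m. k = e + m")
    case True
    then obtain m where "k = e + m" by blast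
    then show ?thesis using lookup_single_times[of e 1 q m] by (auto simp: in_keys_iff)
  next
    case False
    then show ?thesis using lookup_single_times_eq_0[of k e 1 q] by (auto simp: in_keys_iff)
  qed
qed

lemma lookup_signed: "lookup (signed v A q) k = signed v A (lookup q k)"
  by (simp add: signed_def)

lemma keys_signed: "keys (signed v A q) = keys q"
  by (auto simp: in_keys_iff lookup_signed)

subsection \<open>Chains labelled by squarefree monomials\<close>

text \<open>A vertex \<open>v\<close> is labelled by the squarefree monomial with support \<open>S v\<close>, and a set of vertices by
the least common multiple of its labels. The labels \<open>S v = {v}\<close> give the Koszul complex on the
variables; arbitrary labels give the Taylor complex.\<close>

locale labelled_vertices =
  fixes V :: "nat set" and S :: "nat \<Rightarrow> nat set"
  assumes finite_V: "finite V" and finite_S: "v \<in> V \<Longrightarrow> finite (S v)"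
begin

definition label :: "nat set \<Rightarrow> nat set" where
  "label A = (\<Union>v\<in>A. S v)"

abbreviation lmon :: "nat set \<Rightarrow> monomial" where
  "lmon A \<equiv> sqf (label A)"

definition pbd :: "(nat set \<Rightarrow> 'a::field mpoly) \<Rightarrow> nat set \<Rightarrow> 'a mpoly" where
  "pbd = bd V (\<lambda>v A q. mon_poly (sqf (S v - label A)) * q)"

text \<open>The simplicial complex \<open>\<Delta> u\<close> is meant for multidegree \<open>u\<close>. By the last condition the label of
every face \<open>A\<close> divides \<open>u\<close>; a coefficient at \<open>A\<close> is a scalar multiple of the monomial
\<open>u - lmon A\<close>.\<close>

definition face_family :: "(monomial \<Rightarrow> nat set set) \<Rightarrow> bool" where
  "face_family \<Delta> \<longleftrightarrow> (\<forall>u. \<Delta> u \<subseteq> Pow V \<and> down_closed (\<Delta> u) \<and> (\<forall>A\<in>\<Delta> u. label A \<subseteq> keys u))"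

text \<open>Multidegrees are counted so that the basis element of \<open>A\<close> has the multidegree of its label. The set
\<open>J\<close> restricts the total degrees: a singleton selects a graded piece, and \<open>UNIV\<close> imposes nothing.\<close>

definition pchain ::
  "(monomial \<Rightarrow> nat set set) \<Rightarrow> nat \<Rightarrow> int set \<Rightarrow> (nat set \<Rightarrow> 'a::field mpoly) \<Rightarrow> bool" where
  "pchain \<Delta> p J w \<longleftrightarrow> (\<forall>A. \<forall>m \<in> keys (w A).
     A \<in> \<Delta> (m + lmon A) \<and> card A = p \<and> int (mon_degree (m + lmon A)) \<in> J)"

text \<open>A polynomial chain is equivalent to its simplicial strands in the individual multidegrees;
\<open>assemble\<close> is the inverse construction for finitely many multidegrees.\<close>

definition strand ::
  "(monomial \<Rightarrow> nat set set) \<Rightarrow> (nat set \<Rightarrow> 'a::field mpoly) \<Rightarrow> monomial \<Rightarrow> nat set \<Rightarrow> 'a" where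
  "strand \<Delta> w u A = (if A \<in> \<Delta> u then lookup (w A) (u - lmon A) else 0)"

definition assemble ::
  "monomial set \<Rightarrow> (monomial \<Rightarrow> nat set \<Rightarrow> 'a::field) \<Rightarrow> nat set \<Rightarrow> 'a mpoly" where
  "assemble U h A = (\<Sum>u\<in>U. single (u - lmon A) (h u A))"

lemma finite_label: "A \<subseteq> V \<Longrightarrow> finite (label A)"
  unfolding label_def using finite_V finite_S finite_subset by (metis finite_UN subsetD)

lemma face_familyD:
  assumes "face_family \<Delta>" "A \<in> \<Delta> u"
  shows "A \<subseteq> V" "u = (u - lmon A) + lmon A" "\<And>B. B \<subseteq> A \<Longrightarrow> B \<in> \<Delta> u"
proof -
  show "A \<subseteq> V" using assms unfolding face_family_def by blast
  then obtain m where "u = m + lmon A"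
    using assms sqf_adds_iff[of "label A" u] finite_label unfolding face_family_def by blast
  then show "u = (u - lmon A) + lmon A" by simp
  show "B \<in> \<Delta> u" if "B \<subseteq> A" for B
    using assms that unfolding face_family_def down_closed_def by blast
qed

lemma lmon_insert:
  assumes "v \<in> V" "A \<subseteq> V"
  shows "lmon (insert v A) = sqf (S v - label A) + lmon A"
proof -
  have "label (insert v A) = (S v - label A) \<union> label A" by (auto simp: label_def)
  then show ?thesis using assms sqf_Un[of "S v - label A" "label A"] finite_S finite_label by auto
qed

text \<open>Dropping \<open>v\<close> multiplies a coefficient by the quotient of the labels, which leaves its multidegree
unchanged: the polynomial boundary acts on each strand as the simplicial one.\<close>

lemma strand_pbd:
  assumes \<Delta>: "face_family \<Delta>"
    and w: "\<And>A m. m \<in> keys (w A) \<Longrightarrow> A \<in> \<Delta> (m + lmon A)"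
  shows "sbd V (strand \<Delta> w u) A = strand \<Delta> (pbd w) u A"
proof (cases "A \<in> \<Delta> u")
  case True
  note A = face_familyD[OF \<Delta> True]
  have "sbd V (strand \<Delta> w u) A = (\<Sum>v\<in>V - A. signed v A
      (lookup (mon_poly (sqf (S v - label A)) * w (insert v A)) (u - lmon A)))"
    unfolding bd_def
  proof (rule sum.cong)
    fix v assume v: "v \<in> V - A"
    let ?e = "sqf (S v - label A)"
    have l: "lmon (insert v A) = ?e + lmon A" using v A lmon_insert by blast
    have "strand \<Delta> w u (insert v A) = lookup (mon_poly ?e * w (insert v A)) (u - lmon A)"
    proof (cases "insert v A \<in> \<Delta> u")
      case True
      have "u = (u - lmon (insert v A)) + ?e + lmon A"
        using face_familyD(2)[OF \<Delta> True] l by (simp add: add.assoc)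
      then have "u - lmon A = ?e + (u - lmon (insert v A))"
        by (metis add.commute add_diff_cancel_right')
      then show ?thesis using True by (simp add: strand_def lookup_single_times)
    next
      case False
      have "lookup (mon_poly ?e * w (insert v A)) (u - lmon A) = 0"
      proof (rule ccontr)
        assume "lookup (mon_poly ?e * w (insert v A)) (u - lmon A) \<noteq> 0"
        then obtain m where m: "m \<in> keys (w (insert v A))" "u - lmon A = ?e + m"
          using keys_single_times[of ?e "w (insert v A)"] by (auto simp flip: in_keys_iff)
        then have "u = m + lmon (insert v A)" using A(2) l by (simp add: ac_simps)
        then show False using w[OF m(1)] False by simp
      qed
      then show ?thesis using False by (simp add: strand_def)
    qed
    then show "signed v A (strand \<Delta> w u (insert v A)) =
        signed v A (lookup (mon_poly ?e * w (insert v A)) (u - lmon A))" by simp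
  qed simp
  also have "\<dots> = strand \<Delta> (pbd w) u A"
    using True by (simp add: strand_def pbd_def bd_def lookup_sum lookup_signed)
  finally show ?thesis .
next
  case False
  then have "strand \<Delta> w u (insert v A) = 0" for v
    using face_familyD(3)[OF \<Delta>, of "insert v A" u A] by (auto simp: strand_def)
  then show ?thesis using False by (simp add: bd_def strand_def)
qed

lemma pbd_assemble:
  assumes \<Delta>: "face_family \<Delta>" and h: "\<And>u A. h u A \<noteq> 0 \<Longrightarrow> A \<in> \<Delta> u"
  shows "pbd (assemble U h) A = assemble U (\<lambda>u. sbd V (h u)) A"
proof -
  have *: "mon_poly (sqf (S v - label A)) * single (u - lmon (insert v A)) (h u (insert v A)) =
      single (u - lmon A) (h u (insert v A))" if v: "v \<in> V - A" for u v
  proof (cases "h u (insert v A) = 0")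
    case False
    note F = face_familyD[OF \<Delta> h[OF False]]
    have "lmon (insert v A) = sqf (S v - label A) + lmon A" using v F lmon_insert by blast
    then have "u = (sqf (S v - label A) + (u - lmon (insert v A))) + lmon A"
      using F(2) by (simp add: ac_simps)
    then have "u - lmon A = sqf (S v - label A) + (u - lmon (insert v A))"
      by (metis add_diff_cancel_right')
    then show ?thesis by (simp add: mult_single)
  qed simp
  have single_signed: "signed v A (single k c) = single k (signed v A c)" for v k and c :: 'a
    by (simp add: signed_def single_uminus)
  have single_sum: "(\<Sum>v\<in>B. single k (f v)) = single k (sum f B)"
    for B :: "nat set" and k :: monomial and f :: "nat \<Rightarrow> 'a"
    by (induction B rule: infinite_finite_induct) (simp_all add: single_add)
  have "pbd (assemble U h) A = (\<Sum>v\<in>V - A. \<Sum>u\<in>U. signed v A (single (u - lmon A) (h u (insert v A))))"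
    unfolding pbd_def bd_def assemble_def by (intro sum.cong) (simp_all add: sum_distrib_left * signed_sum)
  also have "\<dots> = (\<Sum>u\<in>U. \<Sum>v\<in>V - A. signed v A (single (u - lmon A) (h u (insert v A))))"
    by (rule sum.swap)
  also have "\<dots> = assemble U (\<lambda>u. sbd V (h u)) A"
    by (simp add: assemble_def bd_def single_signed single_sum)
  finally show ?thesis .
qed

lemma assemble_strand:
  assumes \<Delta>: "face_family \<Delta>"
    and w: "\<And>A m. m \<in> keys (w A) \<Longrightarrow> A \<in> \<Delta> (m + lmon A) \<and> m + lmon A \<in> U"
    and U: "finite U"
  shows "assemble U (strand \<Delta> w) A = w A"
proof (rule poly_mapping_eqI)
  fix m
  have "(lookup (single (u - lmon A) (strand \<Delta> w u A)) m) =
      (if u = m + lmon A then lookup (w A) m else 0)" for u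
  proof (cases "A \<in> \<Delta> u")
    case True
    then have "u - lmon A = m \<longleftrightarrow> u = m + lmon A"
      using face_familyD(2)[OF \<Delta> True] by auto
    then show ?thesis using True by (auto simp: lookup_single when_def strand_def)
  next
    case False
    then show ?thesis using w[of m A] by (auto simp: strand_def in_keys_iff)
  qed
  then have "lookup (assemble U (strand \<Delta> w) A) m =
      (\<Sum>u\<in>U. if u = m + lmon A then lookup (w A) m else 0)"
    by (simp add: assemble_def lookup_sum)
  also have "\<dots> = lookup (w A) m"
    using U w[of m A] by (auto simp: in_keys_iff)
  finally show "lookup (assemble U (strand \<Delta> w) A) m = lookup (w A) m" .
qed

lemma schain_strand: "pchain \<Delta> p J w \<Longrightarrow> face_family \<Delta> \<Longrightarrow> schain (\<Delta> u) p (strand \<Delta> w u)"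
  unfolding schain_def strand_def pchain_def by (auto simp: in_keys_iff)

lemma pchain_assemble:
  assumes "face_family \<Delta>" "\<And>u. u \<in> U \<Longrightarrow> schain (\<Delta> u) p (h u)" "\<And>u. u \<in> U \<Longrightarrow> int (mon_degree u) \<in> J"
  shows "pchain \<Delta> p J (assemble U h)"
  unfolding pchain_def
proof (intro allI ballI)
  fix A m assume "m \<in> keys (assemble U h A)"
  then obtain u where u: "u \<in> U" "m \<in> keys (single (u - lmon A) (h u A))"
    using keys_sum unfolding assemble_def by fastforce
  then have m: "m = u - lmon A" "h u A \<noteq> 0" by (auto split: if_splits)
  then have A: "A \<in> \<Delta> u" "card A = p" using assms(2)[OF u(1)] by (auto simp: schain_def)
  have "m + lmon A = u" using face_familyD(2)[OF assms(1) A(1)] m by simp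
  then show "A \<in> \<Delta> (m + lmon A) \<and> card A = p \<and> int (mon_degree (m + lmon A)) \<in> J"
    using A assms(3)[OF u(1)] by simp
qed

definition pexact :: "'a::field itself \<Rightarrow> (monomial \<Rightarrow> nat set set) \<Rightarrow> nat \<Rightarrow> int set \<Rightarrow> bool" where
  "pexact TYPE('a) \<Delta> p J \<longleftrightarrow>
     (\<forall>w :: nat set \<Rightarrow> 'a mpoly. pchain \<Delta> p J w \<and> (\<forall>A. pbd w A = 0) \<longrightarrow>
        (\<exists>w'. pchain \<Delta> (Suc p) J w' \<and> (\<forall>A. pbd w' A = w A)))"

text \<open>A chain has finitely many strands. A bounding chain is obtained by bounding each strand; conversely
a simplicial cycle in multidegree \<open>u\<close> becomes a polynomial cycle with \<open>u\<close> as its only multidegree.\<close>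

theorem pexact_iff:
  assumes \<Delta>: "face_family \<Delta>"
  shows "pexact TYPE('a::field) \<Delta> p J \<longleftrightarrow>
     (\<forall>u. int (mon_degree u) \<in> J \<longrightarrow> exact_at TYPE('a) V (\<Delta> u) p)"
proof
  assume ex: "pexact TYPE('a) \<Delta> p J"
  show "\<forall>u. int (mon_degree u) \<in> J \<longrightarrow> exact_at TYPE('a) V (\<Delta> u) p"
  proof (intro allI impI exact_atI)
    fix u and c :: "nat set \<Rightarrow> 'a"
    assume u: "int (mon_degree u) \<in> J" and c: "schain (\<Delta> u) p c" and cyc: "\<And>A. sbd V c A = 0"
    define h where "h u' = (if u' = u then c else (\<lambda>_. 0))" for u'
    have h: "h u' A \<noteq> 0 \<Longrightarrow> A \<in> \<Delta> u'" for u' A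
      using c by (auto simp: h_def schain_def split: if_splits)
    have 1: "pchain \<Delta> p J (assemble {u} h)"
      by (rule pchain_assemble[OF \<Delta>]) (use c u in \<open>auto simp: h_def\<close>)
    have 2: "pbd (assemble {u} h) A = 0" for A
    proof -
      have "pbd (assemble {u} h) A = assemble {u} (\<lambda>u'. sbd V (h u')) A"
        by (rule pbd_assemble[OF \<Delta> h])
      also have "\<dots> = 0" using cyc by (simp add: assemble_def h_def)
      finally show ?thesis .
    qed
    obtain w' where w': "pchain \<Delta> (Suc p) J w'" "\<And>A. pbd w' A = assemble {u} h A"
      using ex 1 2 unfolding pexact_def by blast
    have "sbd V (strand \<Delta> w' u) A = c A" for A
    proof -
      have "sbd V (strand \<Delta> w' u) A = strand \<Delta> (pbd w') u A"
        by (rule strand_pbd[OF \<Delta>]) (use w'(1) in \<open>simp add: pchain_def\<close>)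
      also have "\<dots> = c A"
        using w'(2)[of A] c by (auto simp: strand_def assemble_def h_def schain_def)
      finally show ?thesis .
    qed
    then show "\<exists>c'. schain (\<Delta> u) (Suc p) c' \<and> (\<forall>A. sbd V c' A = c A)"
      using schain_strand[OF w'(1) \<Delta>] by blast
  qed
next
  assume ex: "\<forall>u. int (mon_degree u) \<in> J \<longrightarrow> exact_at TYPE('a) V (\<Delta> u) p"
  show "pexact TYPE('a) \<Delta> p J"
    unfolding pexact_def
  proof (intro allI impI)
    fix w :: "nat set \<Rightarrow> 'a mpoly"
    assume "pchain \<Delta> p J w \<and> (\<forall>A. pbd w A = 0)"
    then have w: "pchain \<Delta> p J w" and cyc: "\<And>A. pbd w A = 0" by blast+
    define U where "U = (\<Union>A\<in>Pow V. (\<lambda>m. m + lmon A) ` keys (w A))"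
    have U: "finite U" unfolding U_def using finite_V by auto
    have wD: "A \<in> \<Delta> (m + lmon A) \<and> m + lmon A \<in> U \<and> int (mon_degree (m + lmon A)) \<in> J"
      if "m \<in> keys (w A)" for A m
    proof -
      have *: "A \<in> \<Delta> (m + lmon A)" "int (mon_degree (m + lmon A)) \<in> J"
        using w that unfolding pchain_def by blast+
      then have "A \<in> Pow V" using face_familyD(1)[OF \<Delta>] by blast
      then show ?thesis using * that unfolding U_def by blast
    qed
    have degU: "int (mon_degree u) \<in> J" if "u \<in> U" for u
      using that wD unfolding U_def by blast
    have "\<exists>c'. schain (\<Delta> u) (Suc p) c' \<and> (\<forall>A. sbd V c' A = strand \<Delta> w u A)" if "u \<in> U" for u
    proof -
      have "exact_at TYPE('a) V (\<Delta> u) p" using ex degU[OF that] by blast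
      moreover have "sbd V (strand \<Delta> w u) A = 0" for A
        using strand_pbd[OF \<Delta>, of w u A] wD cyc by (simp add: strand_def)
      ultimately show ?thesis using schain_strand[OF w \<Delta>, of u] exact_atD by blast
    qed
    then obtain h where h: "\<And>u. u \<in> U \<Longrightarrow> schain (\<Delta> u) (Suc p) (h u)"
      "\<And>u A. u \<in> U \<Longrightarrow> sbd V (h u) A = strand \<Delta> w u A" by metis
    define h' where "h' u = (if u \<in> U then h u else (\<lambda>_. 0))" for u
    have "pchain \<Delta> (Suc p) J (assemble U h')"
      by (rule pchain_assemble[OF \<Delta>]) (use h(1) degU in \<open>auto simp: h'_def\<close>)
    moreover have "pbd (assemble U h') A = w A" for A
    proof -
      have "pbd (assemble U h') A = assemble U (\<lambda>u. sbd V (h' u)) A"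
        by (rule pbd_assemble[OF \<Delta>]) (use h(1) in \<open>auto simp: h'_def schain_def split: if_splits\<close>)
      also have "\<dots> = assemble U (strand \<Delta> w) A"
        unfolding assemble_def by (intro sum.cong) (use h(2) in \<open>simp_all add: h'_def\<close>)
      also have "\<dots> = w A" by (rule assemble_strand[OF \<Delta> _ U]) (use wD in blast)
      finally show ?thesis .
    qed
    ultimately show "\<exists>w'. pchain \<Delta> (Suc p) J w' \<and> (\<forall>A. pbd w' A = w A)" by blast
  qed
qed

end

section \<open>Koszul homology of graded modules\<close>

text \<open>The ambient group of type \<open>'b\<close> with commuting operators \<open>x v\<close> plays the part of a module over a
polynomial ring; graded modules enter as families \<open>int \<Rightarrow> 'b set\<close> of their homogeneous pieces.\<close>

locale koszul_action =
  fixes V :: "nat set" and x :: "nat \<Rightarrow> 'b::ab_group_add \<Rightarrow> 'b"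
  assumes finite_V: "finite V"
    and x_add: "x v (y + z) = x v y + x v z"
    and x_commute: "x v (x w y) = x w (x v y)"
begin

lemma x_zero [simp]: "x v 0 = 0"
  using additive_zero[of "x v", OF x_add] .

definition kbd :: "(nat set \<Rightarrow> 'b) \<Rightarrow> nat set \<Rightarrow> 'b" where
  "kbd = bd V (\<lambda>v A. x v)"

definition graded_submodule :: "(int \<Rightarrow> 'b set) \<Rightarrow> bool" where
  "graded_submodule M \<longleftrightarrow> (\<forall>j. 0 \<in> M j \<and> (\<forall>y\<in>M j. \<forall>z\<in>M j. y - z \<in> M j) \<and>
     (\<forall>v\<in>V. \<forall>y\<in>M j. x v y \<in> M (j + 1)))"

definition kchain :: "(int \<Rightarrow> 'b set) \<Rightarrow> nat \<Rightarrow> int \<Rightarrow> (nat set \<Rightarrow> 'b) \<Rightarrow> bool" where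
  "kchain M p j w \<longleftrightarrow> (\<forall>A. if A \<subseteq> V \<and> card A = p then w A \<in> M (j - int p) else w A = 0)"

definition koszul_exact :: "(int \<Rightarrow> 'b set) \<Rightarrow> nat \<Rightarrow> int \<Rightarrow> bool" where
  "koszul_exact M p j \<longleftrightarrow> (\<forall>w. kchain M p j w \<and> (\<forall>A. kbd w A = 0) \<longrightarrow>
     (\<exists>w'. kchain M (Suc p) j w' \<and> (\<forall>A. kbd w' A = w A)))"

text \<open>For a graded submodule \<open>Z\<close> of \<open>F\<close> this says that the map from the \<open>p\<close>-th Koszul homology of \<open>Z\<close> to
that of \<open>F\<close> is injective in degree \<open>j\<close>. By the long exact sequence its kernel is the image of the
connecting map from the homology of \<open>F / Z\<close> in homological degree \<open>p + 1\<close>.\<close>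

definition koszul_pure :: "(int \<Rightarrow> 'b set) \<Rightarrow> (int \<Rightarrow> 'b set) \<Rightarrow> nat \<Rightarrow> int \<Rightarrow> bool" where
  "koszul_pure Z F p j \<longleftrightarrow> (\<forall>y. kchain F (Suc p) j y \<and> kchain Z p j (kbd y) \<longrightarrow>
     (\<exists>y'. kchain Z (Suc p) j y' \<and> (\<forall>A. kbd y' A = kbd y A)))"

lemma graded_submoduleD:
  assumes "graded_submodule M"
  shows "0 \<in> M j" "\<lbrakk>y \<in> M j; z \<in> M j\<rbrakk> \<Longrightarrow> y - z \<in> M j" "\<lbrakk>v \<in> V; y \<in> M j\<rbrakk> \<Longrightarrow> x v y \<in> M (j + 1)"
    "y \<in> M j \<Longrightarrow> - y \<in> M j" "\<lbrakk>y \<in> M j; z \<in> M j\<rbrakk> \<Longrightarrow> y + z \<in> M j"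
proof -
  show 1: "0 \<in> M j" and 2: "\<lbrakk>y \<in> M j; z \<in> M j\<rbrakk> \<Longrightarrow> y - z \<in> M j"
    and "\<lbrakk>v \<in> V; y \<in> M j\<rbrakk> \<Longrightarrow> x v y \<in> M (j + 1)" for y z
    using assms by (auto simp: graded_submodule_def)
  show 3: "y \<in> M j \<Longrightarrow> - y \<in> M j" for y using 2[of 0 y] 1 by simp
  show "\<lbrakk>y \<in> M j; z \<in> M j\<rbrakk> \<Longrightarrow> y + z \<in> M j" using 2[of y "- z"] 3 by simp
qed

lemma graded_submodule_sum:
  assumes "graded_submodule M" "\<And>i. i \<in> B \<Longrightarrow> f i \<in> M j"
  shows "sum f B \<in> M j"
  using assms(2) by (induction B rule: infinite_finite_induct)
    (auto intro: graded_submoduleD[OF assms(1)])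

lemma kbd_kbd: "kbd (kbd w) A = 0"
  unfolding kbd_def by (rule bd_bd) (auto simp: finite_V x_add x_commute)

lemma kbd_diff: "kbd (\<lambda>A. w A - w' A) A = kbd w A - kbd w' A"
  unfolding kbd_def by (rule bd_diff) (rule x_add)

lemma kbd_hom:
  assumes "\<And>y z. f (y + z) = f y + f z" "\<And>v y. f (x v y) = x v (f y)"
  shows "kbd (\<lambda>A. f (w A)) A = f (kbd w A)"
  unfolding kbd_def bd_def
  by (simp add: additive_sum[of f, OF assms(1)] additive_signed[of f, OF assms(1)] assms(2))

lemma kchain_kbd:
  assumes M: "graded_submodule M" and w: "kchain M (Suc p) j w"
  shows "kchain M p j (kbd w)"
  unfolding kchain_def
proof
  fix A
  show "if A \<subseteq> V \<and> card A = p then kbd w A \<in> M (j - int p) else kbd w A = 0"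
  proof (cases "A \<subseteq> V \<and> card A = p")
    case True
    then have A: "A \<subseteq> V" "card A = p" "finite A" using finite_V finite_subset by auto
    have "signed v A (x v (w (insert v A))) \<in> M (j - int p)" if v: "v \<in> V - A" for v
    proof -
      have "w (insert v A) \<in> M (j - int (Suc p))"
        using w[unfolded kchain_def, rule_format, of "insert v A"] A v by simp
      from graded_submoduleD(3)[OF M _ this, of v] v
      have "x v (w (insert v A)) \<in> M (j - int p)" by simp
      then show ?thesis by (simp add: signed_def graded_submoduleD(4)[OF M])
    qed
    then have "(\<Sum>v\<in>V - A. signed v A (x v (w (insert v A)))) \<in> M (j - int p)"
      by (rule graded_submodule_sum[OF M])
    then show ?thesis using True by (simp add: kbd_def bd_def)
  next
    case False
    have "w (insert v A) = 0" if v: "v \<in> V - A" for v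
    proof (rule ccontr)
      assume "w (insert v A) \<noteq> 0"
      then have "insert v A \<subseteq> V" "card (insert v A) = Suc p"
        using w unfolding kchain_def by metis+
      moreover from this have "finite A" using finite_V finite_subset by (metis finite_insert)
      ultimately show False using False v by simp
    qed
    then show ?thesis using False by (auto simp: kbd_def bd_def intro!: sum.neutral)
  qed
qed

lemma kchain_diff:
  assumes "graded_submodule M" "kchain M p j w" "kchain M p j w'"
  shows "kchain M p j (\<lambda>A. w A - w' A)"
  using assms(2,3) graded_submoduleD(2)[OF assms(1)] unfolding kchain_def by (metis diff_self)

lemma kchain_hom:
  assumes "kchain F p j w" "\<And>i. f ` F i \<subseteq> M i" "f 0 = 0"
  shows "kchain M p j (\<lambda>A. f (w A))"
  using assms unfolding kchain_def by (metis image_subset_iff)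

lemma kchain_mono:
  assumes "kchain Z p j w" "\<And>i. Z i \<subseteq> F i"
  shows "kchain F p j w"
  using assms unfolding kchain_def by (metis subsetD)

lemma kchain_lift:
  assumes "kchain M p j w" "f 0 = 0" "\<And>i. M i \<subseteq> f ` F i"
  obtains y where "kchain F p j y" "\<And>A. f (y A) = w A"
proof -
  have "\<forall>A. \<exists>y. if A \<subseteq> V \<and> card A = p then y \<in> F (j - int p) \<and> f y = w A else y = 0 \<and> w A = 0"
    using assms(1,3) unfolding kchain_def by (metis imageE subsetD)
  then obtain y where
    y: "\<And>A. if A \<subseteq> V \<and> card A = p then y A \<in> F (j - int p) \<and> f (y A) = w A else y A = 0 \<and> w A = 0"
    by metis
  show ?thesis
  proof (rule that)
    show "kchain F p j y" using y unfolding kchain_def by metis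
    show "f (y A) = w A" for A using y[of A] assms(2) by metis
  qed
qed

text \<open>The part of the long exact sequence of \<open>0 \<rightarrow> Z \<rightarrow> F \<rightarrow> M \<rightarrow> 0\<close> around the connecting map. It
is injective because the homology of \<open>F\<close> vanishes at \<open>p + 1\<close>.\<close>

lemma koszul_exact_quotient_iff:
  assumes F: "graded_submodule F" and ex: "koszul_exact F (Suc p) j"
    and add: "\<And>y z. f (y + z) = f y + f z" and lin: "\<And>v y. f (x v y) = x v (f y)"
    and M: "\<And>i. M i = f ` F i" and Z: "\<And>i. Z i = {y \<in> F i. f y = 0}"
  shows "koszul_exact M (Suc p) j \<longleftrightarrow> koszul_pure Z F p j"
proof -
  have f0: "f 0 = 0" by (rule additive_zero[OF add])
  have fd: "f (y - z) = f y - f z" for y z by (rule additive_diff[OF add])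
  have ZF: "Z i \<subseteq> F i" for i using Z by auto
  have Zch: "kchain Z q j w \<longleftrightarrow> kchain F q j w \<and> (\<forall>A. f (w A) = 0)" for q w
  proof -
    have "(if P then w A \<in> Z i else w A = 0) \<longleftrightarrow> (if P then w A \<in> F i else w A = 0) \<and> f (w A) = 0" for P A i
      using f0 Z by auto
    then show ?thesis unfolding kchain_def by blast
  qed
  show ?thesis
  proof
    assume Mex: "koszul_exact M (Suc p) j"
    show "koszul_pure Z F p j"
      unfolding koszul_pure_def
    proof (intro allI impI, elim conjE)
      fix y assume y: "kchain F (Suc p) j y" "kchain Z p j (kbd y)"
      have "kchain M (Suc p) j (\<lambda>A. f (y A))" by (rule kchain_hom[OF y(1)]) (use M f0 in auto)
      moreover have "kbd (\<lambda>A. f (y A)) A = 0" for A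
        using y(2) by (simp add: kbd_hom[of f, OF add lin] Zch)
      ultimately obtain m where m: "kchain M (Suc (Suc p)) j m" "\<And>A. kbd m A = f (y A)"
        using Mex unfolding koszul_exact_def by blast
      obtain t where t: "kchain F (Suc (Suc p)) j t" and ft: "\<And>A. f (t A) = m A"
        using kchain_lift[where f = f, OF m(1) f0] M by blast
      have "kchain Z (Suc p) j (\<lambda>A. y A - kbd t A)"
        unfolding Zch
      proof
        show "kchain F (Suc p) j (\<lambda>A. y A - kbd t A)"
          by (rule kchain_diff[OF F y(1) kchain_kbd[OF F t]])
        show "\<forall>A. f (y A - kbd t A) = 0"
        proof
          fix A
          have "f (kbd t A) = kbd (\<lambda>A. f (t A)) A" by (simp only: kbd_hom[of f, OF add lin])
          also have "\<dots> = f (y A)" using m(2)[of A] by (simp only: ft)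
          finally show "f (y A - kbd t A) = 0" by (simp only: fd diff_self)
        qed
      qed
      moreover have "kbd (\<lambda>A. y A - kbd t A) A = kbd y A" for A
        by (simp add: kbd_diff kbd_kbd)
      ultimately show "\<exists>y'. kchain Z (Suc p) j y' \<and> (\<forall>A. kbd y' A = kbd y A)" by blast
    qed
  next
    assume pure: "koszul_pure Z F p j"
    show "koszul_exact M (Suc p) j"
      unfolding koszul_exact_def
    proof (intro allI impI, elim conjE)
      fix w assume w: "kchain M (Suc p) j w" and cyc: "\<forall>A. kbd w A = 0"
      obtain y where y: "kchain F (Suc p) j y" and fy: "\<And>A. f (y A) = w A"
        using kchain_lift[where f = f, OF w f0] M by blast
      have "f (kbd y A) = 0" for A
      proof -
        have "f (kbd y A) = kbd (\<lambda>A. f (y A)) A" by (simp only: kbd_hom[of f, OF add lin])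
        then show ?thesis using cyc by (simp only: fy)
      qed
      then have "kchain Z p j (kbd y)"
        using kchain_kbd[OF F y] unfolding Zch by blast
      then obtain z where z: "kchain Z (Suc p) j z" "\<And>A. kbd z A = kbd y A"
        using pure y unfolding koszul_pure_def by blast
      have zF: "kchain F (Suc p) j z" "\<And>A. f (z A) = 0" using z(1) unfolding Zch by blast+
      have "kchain F (Suc p) j (\<lambda>A. y A - z A)" by (rule kchain_diff[OF F y zF(1)])
      moreover have "kbd (\<lambda>A. y A - z A) A = 0" for A by (simp add: kbd_diff z(2))
      ultimately obtain t where t: "kchain F (Suc (Suc p)) j t" "\<And>A. kbd t A = y A - z A"
        using ex unfolding koszul_exact_def by blast
      have "kchain M (Suc (Suc p)) j (\<lambda>A. f (t A))" by (rule kchain_hom[OF t(1)]) (use M f0 in auto)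
      moreover have "kbd (\<lambda>A. f (t A)) A = w A" for A
        using t(2)[of A] by (simp add: kbd_hom[of f, OF add lin] fd fy zF(2))
      ultimately show "\<exists>w'. kchain M (Suc (Suc p)) j w' \<and> (\<forall>A. kbd w' A = w A)" by blast
    qed
  qed
qed

text \<open>
If every cycle with values in \<open>Z\<close> bounds in \<open>F\<close>, then the map on homology is zero, and its
injectivity says that the homology of \<open>Z\<close> vanishes.
\<close>

lemma koszul_exact_iff_pure:
  assumes "\<And>w. kchain Z p j w \<Longrightarrow> \<forall>A. kbd w A = 0 \<Longrightarrow> \<exists>y. kchain F (Suc p) j y \<and> (\<forall>A. kbd y A = w A)"
  shows "koszul_exact Z p j \<longleftrightarrow> koszul_pure Z F p j"
proof
  assume Zex: "koszul_exact Z p j"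
  show "koszul_pure Z F p j"
    unfolding koszul_pure_def
  proof (intro allI impI, elim conjE)
    fix y assume "kchain Z p j (kbd y)"
    then show "\<exists>y'. kchain Z (Suc p) j y' \<and> (\<forall>A. kbd y' A = kbd y A)"
      using Zex kbd_kbd unfolding koszul_exact_def by blast
  qed
next
  assume pure: "koszul_pure Z F p j"
  show "koszul_exact Z p j"
    unfolding koszul_exact_def
  proof (intro allI impI, elim conjE)
    fix w assume w: "kchain Z p j w" and "\<forall>A. kbd w A = 0"
    then obtain y where y: "kchain F (Suc p) j y" "\<And>A. kbd y A = w A" using assms by blast
    then have "kbd y = w" by (intro ext)
    then show "\<exists>w'. kchain Z (Suc p) j w' \<and> (\<forall>A. kbd w' A = w A)"
      using pure y w unfolding koszul_pure_def by metis
  qed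
qed

lemma koszul_exact_iff_pure_of_exact:
  assumes "koszul_exact F p j" "\<And>i. Z i \<subseteq> F i"
  shows "koszul_exact Z p j \<longleftrightarrow> koszul_pure Z F p j"
proof (rule koszul_exact_iff_pure)
  fix w assume "kchain Z p j w" "\<forall>A. kbd w A = 0"
  then show "\<exists>y. kchain F (Suc p) j y \<and> (\<forall>A. kbd y A = w A)"
    using assms(1) kchain_mono[where Z = Z and F = F, OF _ assms(2)] unfolding koszul_exact_def by blast
qed

lemma kchain_0_iff: "kchain M 0 j w \<longleftrightarrow> w {} \<in> M j \<and> (\<forall>A. A \<noteq> {} \<longrightarrow> w A = 0)"
proof -
  have "A \<subseteq> V \<and> card A = 0 \<longleftrightarrow> A = {}" for A using finite_V finite_subset by fastforce
  then show ?thesis unfolding kchain_def by auto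
qed

lemma kbd_empty: "kbd w {} = (\<Sum>v\<in>V. x v (w {v}))"
  by (simp add: kbd_def bd_def signed_def)

definition degree_one_chain :: "(nat \<Rightarrow> 'b) \<Rightarrow> nat set \<Rightarrow> 'b" where
  "degree_one_chain g A = (if \<exists>v\<in>V. A = {v} then g (THE v. A = {v}) else 0)"

lemma degree_one_chain: "v \<in> V \<Longrightarrow> degree_one_chain g {v} = g v"
  by (auto simp: degree_one_chain_def)

lemma kchain_degree_one_chain:
  assumes "\<And>v. v \<in> V \<Longrightarrow> g v \<in> M (j - 1)"
  shows "kchain M (Suc 0) j (degree_one_chain g)"
  unfolding kchain_def
proof
  fix A
  show "if A \<subseteq> V \<and> card A = Suc 0 then degree_one_chain g A \<in> M (j - int (Suc 0)) else degree_one_chain g A = 0"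
  proof (cases "\<exists>v\<in>V. A = {v}")
    case True
    then show ?thesis using assms degree_one_chain by auto
  next
    case False
    then have "\<not> (A \<subseteq> V \<and> card A = Suc 0)" by (auto simp: card_1_singleton_iff)
    then show ?thesis using False by (auto simp: degree_one_chain_def)
  qed
qed

lemma kbd_degree_one_chain: "kbd (degree_one_chain g) {} = (\<Sum>v\<in>V. x v (g v))"
  by (simp add: kbd_empty degree_one_chain)

lemma kbd_of_degree_one:
  assumes M: "graded_submodule M" and y: "kchain M (Suc 0) j y" and A: "A \<noteq> {}"
  shows "kbd y A = 0"
  using kchain_kbd[OF M y] A by (simp add: kchain_0_iff)

text \<open>With \<open>\<mm>\<close> the ideal of the variables, the right-hand side reads \<open>Z \<inter> \<mm>F \<subseteq> \<mm>Z\<close> in degree \<open>j\<close>, the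
injectivity of \<open>Z / \<mm>Z \<rightarrow> F / \<mm>F\<close>.\<close>

lemma koszul_pure_0_iff:
  assumes F: "graded_submodule F" and Z: "graded_submodule Z"
  shows "koszul_pure Z F 0 j \<longleftrightarrow>
    (\<forall>g. (\<forall>v\<in>V. g v \<in> F (j - 1)) \<and> (\<Sum>v\<in>V. x v (g v)) \<in> Z j \<longrightarrow>
      (\<exists>h. (\<forall>v\<in>V. h v \<in> Z (j - 1)) \<and> (\<Sum>v\<in>V. x v (h v)) = (\<Sum>v\<in>V. x v (g v))))"
    (is "_ \<longleftrightarrow> ?R")
proof
  assume pure: "koszul_pure Z F 0 j"
  show ?R
  proof (intro allI impI, elim conjE)
    fix g assume g: "\<forall>v\<in>V. g v \<in> F (j - 1)" and z: "(\<Sum>v\<in>V. x v (g v)) \<in> Z j"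
    let ?y = "degree_one_chain g"
    have y: "kchain F (Suc 0) j ?y" by (rule kchain_degree_one_chain) (use g in auto)
    have "kchain Z 0 j (kbd ?y)"
      using kbd_of_degree_one[OF F y] z by (simp add: kchain_0_iff kbd_degree_one_chain)
    then obtain y' where y': "kchain Z (Suc 0) j y'" "\<And>A. kbd y' A = kbd ?y A"
      using pure y unfolding koszul_pure_def by blast
    have "y' {v} \<in> Z (j - 1)" if "v \<in> V" for v
      using y'(1)[unfolded kchain_def, rule_format, of "{v}"] that by simp
    moreover have "(\<Sum>v\<in>V. x v (y' {v})) = (\<Sum>v\<in>V. x v (g v))"
      using y'(2)[of "{}"] by (simp add: kbd_degree_one_chain) (simp add: kbd_empty)
    ultimately show "\<exists>h. (\<forall>v\<in>V. h v \<in> Z (j - 1)) \<and> (\<Sum>v\<in>V. x v (h v)) = (\<Sum>v\<in>V. x v (g v))"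
      by (intro exI[of _ "\<lambda>v. y' {v}"]) blast
  qed
next
  assume R: ?R
  show "koszul_pure Z F 0 j"
    unfolding koszul_pure_def
  proof (intro allI impI, elim conjE)
    fix y assume y: "kchain F (Suc 0) j y" "kchain Z 0 j (kbd y)"
    have "\<forall>v\<in>V. y {v} \<in> F (j - 1)"
    proof
      fix v assume "v \<in> V"
      then show "y {v} \<in> F (j - 1)" using y(1)[unfolded kchain_def, rule_format, of "{v}"] by simp
    qed
    moreover have "(\<Sum>v\<in>V. x v (y {v})) \<in> Z j" using y(2) by (simp add: kchain_0_iff kbd_empty)
    ultimately obtain h where h: "\<forall>v\<in>V. h v \<in> Z (j - 1)"
      "(\<Sum>v\<in>V. x v (h v)) = (\<Sum>v\<in>V. x v (y {v}))"
      using R[rule_format, of "\<lambda>v. y {v}"] by blast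
    let ?y' = "degree_one_chain h"
    have y': "kchain Z (Suc 0) j ?y'" by (rule kchain_degree_one_chain) (use h in auto)
    moreover have "kbd ?y' A = kbd y A" for A
    proof (cases "A = {}")
      case True
      then show ?thesis using h(2) by (simp add: kbd_degree_one_chain) (simp add: kbd_empty)
    next
      case False
      then show ?thesis using kbd_of_degree_one[OF Z y'] kbd_of_degree_one[OF F y(1)] by simp
    qed
    ultimately show "\<exists>y'. kchain Z (Suc 0) j y' \<and> (\<forall>A. kbd y' A = kbd y A)" by blast
  qed
qed

text \<open>The map \<open>Z / \<mm>Z \<rightarrow> F / \<mm>F\<close> is zero if \<open>Z\<close> lies in \<open>\<mm>F\<close>.\<close>

lemma koszul_exact_0_iff_pure:
  assumes F: "graded_submodule F"
    and Zm: "\<And>z. z \<in> Z j \<Longrightarrow> \<exists>g. (\<forall>v\<in>V. g v \<in> F (j - 1)) \<and> (\<Sum>v\<in>V. x v (g v)) = z"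
  shows "koszul_exact Z 0 j \<longleftrightarrow> koszul_pure Z F 0 j"
proof (rule koszul_exact_iff_pure)
  fix w assume w: "kchain Z 0 j w"
  then obtain g where g: "\<forall>v\<in>V. g v \<in> F (j - 1)" "(\<Sum>v\<in>V. x v (g v)) = w {}"
    using Zm[of "w {}"] by (auto simp: kchain_0_iff)
  let ?y = "degree_one_chain g"
  have y: "kchain F (Suc 0) j ?y" by (rule kchain_degree_one_chain) (use g in auto)
  have "kbd ?y A = w A" for A
    using kbd_of_degree_one[OF F y] w g(2) by (cases "A = {}") (auto simp: kchain_0_iff kbd_degree_one_chain)
  then show "\<exists>y. kchain F (Suc 0) j y \<and> (\<forall>A. kbd y A = w A)" using y by blast
qed

end

section \<open>Graded free modules over the polynomial ring\<close>

lemma sum_fun_apply: "(\<Sum>i\<in>B. f i) b = (\<Sum>i\<in>B. f i b)"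
  by (induction B rule: infinite_finite_induct) simp_all

lemma signed_apply: "signed v A f b = signed v A (f b)"
  by (simp add: signed_def)

subsection \<open>Homogeneous components\<close>

lemma in_poly_ring_iff:
  "p \<in> carrier (poly_ring n) \<longleftrightarrow> keys p \<subseteq> monomials n"
  by (auto simp: poly_ring_def monomials_def)

lemma monomials_add: "m \<in> monomials n \<Longrightarrow> m' \<in> monomials n \<Longrightarrow> m + m' \<in> monomials n"
  by (simp add: monomials_def keys_add_monomial)

lemma keys_times_subset:
  fixes p q :: "'a::field mpoly"
  assumes "\<And>m m'. m \<in> keys p \<Longrightarrow> m' \<in> keys q \<Longrightarrow> m + m' \<in> N"
  shows "keys (p * q) \<subseteq> N"
  using keys_mult[of p q] assms by auto

lemma poly_ring_closed:
  fixes p q :: "'a::field mpoly"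
  shows "0 \<in> carrier (poly_ring n)"
    and "p \<in> carrier (poly_ring n) \<Longrightarrow> q \<in> carrier (poly_ring n) \<Longrightarrow> p + q \<in> carrier (poly_ring n)"
    and "p \<in> carrier (poly_ring n) \<Longrightarrow> q \<in> carrier (poly_ring n) \<Longrightarrow> p - q \<in> carrier (poly_ring n)"
    and "p \<in> carrier (poly_ring n) \<Longrightarrow> q \<in> carrier (poly_ring n) \<Longrightarrow> p * q \<in> carrier (poly_ring n)"
    and "m \<in> monomials n \<Longrightarrow> single m c \<in> carrier (poly_ring n)"
proof -
  show "0 \<in> carrier (poly_ring n)" by (simp add: in_poly_ring_iff)
  show "p \<in> carrier (poly_ring n) \<Longrightarrow> q \<in> carrier (poly_ring n) \<Longrightarrow> p + q \<in> carrier (poly_ring n)"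
    using keys_add[of p q] by (auto simp: in_poly_ring_iff)
  show "p \<in> carrier (poly_ring n) \<Longrightarrow> q \<in> carrier (poly_ring n) \<Longrightarrow> p - q \<in> carrier (poly_ring n)"
    using keys_add[of p "- q"] by (auto simp: in_poly_ring_iff in_keys_iff lookup_minus)
  show "p \<in> carrier (poly_ring n) \<Longrightarrow> q \<in> carrier (poly_ring n) \<Longrightarrow> p * q \<in> carrier (poly_ring n)"
    unfolding in_poly_ring_iff by (rule keys_times_subset) (auto intro: monomials_add)
  show "m \<in> monomials n \<Longrightarrow> single m c \<in> carrier (poly_ring n)"
    by (simp add: in_poly_ring_iff)
qed

lemma poly_ring_sum_closed:
  fixes f :: "'i \<Rightarrow> 'a::field mpoly"
  assumes "\<And>i. i \<in> B \<Longrightarrow> f i \<in> carrier (poly_ring n)"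
  shows "sum f B \<in> carrier (poly_ring n)"
  using assms by (induction B rule: infinite_finite_induct) (auto intro: poly_ring_closed)

lemma homogeneous_0 [simp]: "homogeneous e 0"
  by (simp add: homogeneous_def)

lemma homogeneous_diff: "homogeneous e p \<Longrightarrow> homogeneous e q \<Longrightarrow> homogeneous e (p - q)"
  unfolding homogeneous_def by (metis diff_zero in_keys_iff lookup_minus)

lemma homogeneous_mult:
  assumes "homogeneous a p" "homogeneous b q"
  shows "homogeneous (a + b) (p * q)"
  using keys_mult[of p q] assms unfolding homogeneous_def by (fastforce simp: mon_degree_add)

lemma homogeneous_add: "homogeneous e p \<Longrightarrow> homogeneous e q \<Longrightarrow> homogeneous e (p + q)"
  using keys_add[of p q] unfolding homogeneous_def by blast

lemma homogeneous_sum: "(\<And>i. i \<in> B \<Longrightarrow> homogeneous e (f i)) \<Longrightarrow> homogeneous e (sum f B)"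
  by (induction B rule: infinite_finite_induct) (auto intro: homogeneous_add)

lemma homogeneous_single: "int (mon_degree m) = e \<Longrightarrow> homogeneous e (single m c)"
  by (simp add: homogeneous_def)

lemma mon_degree_eq_0_iff: "mon_degree m = 0 \<longleftrightarrow> m = 0"
  by (auto simp: mon_degree_def in_keys_iff poly_mapping_eq_iff fun_eq_iff)

lemma mon_degree_0 [simp]: "mon_degree 0 = 0"
  by (simp add: mon_degree_eq_0_iff)

definition hcomp :: "int \<Rightarrow> 'a::field mpoly \<Rightarrow> 'a mpoly" where
  "hcomp e p = Poly_Mapping.mapp (\<lambda>m c. if int (mon_degree m) = e then c else 0) p"

lemma lookup_hcomp:
  "lookup (hcomp e p) m = (if int (mon_degree m) = e then lookup p m else 0)"
  by (auto simp: hcomp_def lookup_mapp when_def in_keys_iff)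

lemma hcomp_add: "hcomp e (p + q) = hcomp e p + hcomp e q"
  by (rule poly_mapping_eqI) (simp add: lookup_hcomp lookup_add)

lemma hcomp_sum: "hcomp e (sum f B) = (\<Sum>i\<in>B. hcomp e (f i))"
  by (rule additive_sum) (rule hcomp_add)

lemma homogeneous_hcomp: "homogeneous e (hcomp e p)"
  by (auto simp: homogeneous_def in_keys_iff lookup_hcomp split: if_splits)

lemma hcomp_homogeneous: "homogeneous e p \<Longrightarrow> hcomp e p = p"
  by (rule poly_mapping_eqI) (auto simp: homogeneous_def lookup_hcomp in_keys_iff)

lemma keys_hcomp: "keys (hcomp e p) \<subseteq> keys p"
  by (auto simp: in_keys_iff lookup_hcomp split: if_splits)

lemma hcomp_mult:
  assumes q: "homogeneous a q"
  shows "hcomp e (p * q) = hcomp (e - a) p * q"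
proof -
  define r where "r = p - hcomp (e - a) p"
  have r: "int (mon_degree m) \<noteq> e - a" if "m \<in> keys r" for m
    using that by (auto simp: r_def in_keys_iff lookup_minus lookup_hcomp split: if_splits)
  have "hcomp e (r * q) = 0"
  proof (rule ccontr)
    assume "hcomp e (r * q) \<noteq> 0"
    then obtain m where "lookup (hcomp e (r * q)) m \<noteq> 0"
      by (auto simp: poly_mapping_eq_iff fun_eq_iff)
    then have m: "m \<in> keys (r * q)" "int (mon_degree m) = e"
      by (auto simp: lookup_hcomp in_keys_iff split: if_splits)
    then obtain s t where "m = s + t" "s \<in> keys r" "t \<in> keys q"
      using keys_mult[of r q] by auto
    then show False using r[of s] q m(2) by (auto simp: homogeneous_def mon_degree_add)
  qed
  moreover have "p * q = hcomp (e - a) p * q + r * q" by (simp add: r_def algebra_simps)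
  moreover have "homogeneous e (hcomp (e - a) p * q)"
    using homogeneous_mult[OF homogeneous_hcomp q, of "e - a" p] by simp
  ultimately show ?thesis by (simp add: hcomp_add hcomp_homogeneous)
qed

subsection \<open>Monomial submodules of free modules\<close>

definition vmul :: "nat \<Rightarrow> (nat \<Rightarrow> 'a::field mpoly) \<Rightarrow> nat \<Rightarrow> 'a mpoly" where
  "vmul v f = (\<lambda>b. mon_poly (single v 1) * f b)"

text \<open>
The interval \<open>{1..n}\<close> is a parameter of the locales below; rewriting it to \<open>{Suc 0..n}\<close> would
separate the constants of these locales from their definitions.
\<close>

declare One_nat_def [simp del]

locale polynomial_setting =
  fixes n :: nat and field_type :: "'a::field itself"
begin

sublocale kos: koszul_action "{1..n}" "vmul :: nat \<Rightarrow> (nat \<Rightarrow> 'a mpoly) \<Rightarrow> nat \<Rightarrow> 'a mpoly"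
  by unfold_locales (auto simp: vmul_def fun_eq_iff algebra_simps)

sublocale lab: labelled_vertices "{1..n}" "\<lambda>v. {v}"
  by unfold_locales auto

text \<open>The degree \<open>j\<close> part of the free module of rank \<open>r\<close> whose basis element \<open>b\<close> has degree \<open>g b\<close>.\<close>

definition graded_free :: "nat \<Rightarrow> (nat \<Rightarrow> int) \<Rightarrow> int \<Rightarrow> (nat \<Rightarrow> 'a mpoly) set" where
  "graded_free r g j = {f \<in> free_mod n r. \<forall>b. homogeneous (j - g b) (f b)}"

definition monomial_closed :: "monomial set \<Rightarrow> bool" where
  "monomial_closed N \<longleftrightarrow> N \<subseteq> monomials n \<and> (\<forall>m\<in>N. \<forall>m'\<in>monomials n. m + m' \<in> N)"

definition monomial_submodule ::
  "monomial set \<Rightarrow> nat \<Rightarrow> (nat \<Rightarrow> int) \<Rightarrow> int \<Rightarrow> (nat \<Rightarrow> 'a mpoly) set" where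
  "monomial_submodule N r g j = {f \<in> graded_free r g j. \<forall>b. keys (f b) \<subseteq> N}"

text \<open>The upper Koszul simplicial complex of \<open>N\<close> in multidegree \<open>u\<close>.\<close>

definition faces :: "monomial set \<Rightarrow> monomial \<Rightarrow> nat set set" where
  "faces N u = {A. A \<subseteq> keys u \<and> keys u \<subseteq> {1..n} \<and> u - sqf A \<in> N}"

lemma label_eq [simp]: "lab.label A = A"
  by (simp add: lab.label_def)

lemma monomial_closed_monomials: "monomial_closed (monomials n)"
  by (auto simp: monomial_closed_def monomials_add)

lemma face_family_faces:
  assumes "monomial_closed N"
  shows "lab.face_family (faces N)"
  unfolding lab.face_family_def down_closed_def
proof (intro allI conjI ballI impI)
  fix u show "faces N u \<subseteq> Pow {1..n}" by (auto simp: faces_def)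
  fix A assume A: "A \<in> faces N u"
  then show "lab.label A \<subseteq> keys u" by (simp add: faces_def)
  fix B assume B: "B \<subseteq> A"
  have fin: "finite A" using A finite_subset[of A "{1..n}"] by (auto simp: faces_def)
  then have fB: "finite B" using B finite_subset by blast
  have "u - sqf B = (u - sqf A) + sqf (A - B)"
  proof (rule poly_mapping_eqI)
    fix i show "lookup (u - sqf B) i = lookup (u - sqf A + sqf (A - B)) i"
      using A B fin fB by (auto simp: lookup_minus lookup_add lookup_sqf faces_def in_keys_iff subset_iff)
  qed
  moreover have "sqf (A - B) \<in> monomials n"
    using A fin by (auto simp: monomials_def keys_sqf faces_def)
  ultimately have "u - sqf B \<in> N" using A assms by (simp add: faces_def monomial_closed_def)
  then show "B \<in> faces N u" using A B by (auto simp: faces_def)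
qed

text \<open>A Koszul chain splits into its coordinates, and the grading of the coordinate \<open>b\<close> is shifted by
\<open>g b\<close>.\<close>

lemma kchain_monomial_submodule_iff:
  assumes N: "monomial_closed N"
  shows "kos.kchain (monomial_submodule N r g) p j w \<longleftrightarrow>
    (\<forall>A b. b \<ge> r \<longrightarrow> w A b = 0) \<and> (\<forall>b<r. lab.pchain (faces N) p {j - g b} (\<lambda>A. w A b))"
    (is "?L \<longleftrightarrow> ?R")
proof
  assume L: ?L
  have D: "w A = 0 \<or> (A \<subseteq> {1..n} \<and> card A = p \<and> w A \<in> monomial_submodule N r g (j - int p))" for A
    using L unfolding kos.kchain_def by metis
  show ?R
  proof (intro conjI allI impI)
    show "w A b = 0" if "b \<ge> r" for A b
      using D[of A] that by (auto simp: monomial_submodule_def graded_free_def free_mod_def)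
    fix b assume b: "b < r"
    show "lab.pchain (faces N) p {j - g b} (\<lambda>A. w A b)"
      unfolding lab.pchain_def
    proof (intro allI ballI)
      fix A m assume m: "m \<in> keys (w A b)"
      then have "w A \<noteq> 0" by auto
      then have A: "A \<subseteq> {1..n}" "card A = p" and w: "w A \<in> monomial_submodule N r g (j - int p)"
        using D by blast+
      have fin: "finite A" using A finite_subset by blast
      have mN: "m \<in> N" using w m by (auto simp: monomial_submodule_def)
      then have keys: "keys m \<subseteq> {1..n}" using N by (auto simp: monomial_closed_def monomials_def)
      have "int (mon_degree m) = j - int p - g b"
        using w m by (auto simp: monomial_submodule_def graded_free_def homogeneous_def)
      then show "A \<in> faces N (m + sqf (lab.label A)) \<and> card A = p \<and>
          int (mon_degree (m + sqf (lab.label A))) \<in> {j - g b}"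
        using A fin mN keys by (auto simp: faces_def keys_add_monomial keys_sqf mon_degree_add mon_degree_sqf)
    qed
  qed
next
  assume R: ?R
  have F: "A \<subseteq> {1..n} \<and> card A = p \<and> m \<in> N \<and> int (mon_degree m) = j - int p - g b"
    if m: "m \<in> keys (w A b)" for A b m
  proof -
    have b: "b < r" using R m by (cases "b < r") auto
    then have *: "A \<in> faces N (m + sqf A)" "card A = p" "int (mon_degree (m + sqf A)) = j - g b"
      using R m unfolding lab.pchain_def by fastforce+
    then have A: "A \<subseteq> {1..n}" by (auto simp: faces_def)
    then have "finite A" using finite_subset by blast
    then show ?thesis using * A by (auto simp: faces_def mon_degree_add mon_degree_sqf)
  qed
  show ?L
    unfolding kos.kchain_def
  proof
    fix A
    show "if A \<subseteq> {1..n} \<and> card A = p then w A \<in> monomial_submodule N r g (j - int p) else w A = 0"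
    proof (cases "A \<subseteq> {1..n} \<and> card A = p")
      case True
      have "keys (w A b) \<subseteq> N" "homogeneous (j - int p - g b) (w A b)" for b
        using F[of _ A b] by (auto simp: homogeneous_def)
      moreover have "N \<subseteq> monomials n" using N by (simp add: monomial_closed_def)
      ultimately show ?thesis
        using True R by (auto simp: monomial_submodule_def graded_free_def free_mod_def in_poly_ring_iff)
    next
      case False
      have "w A b = 0" for b using F[of _ A b] False by (metis ex_in_conv keys_eq_empty)
      then have "w A = 0" by (simp add: fun_eq_iff)
      then show ?thesis using False by (simp only: if_False)
    qed
  qed
qed

lemma kbd_apply: "kos.kbd w A b = lab.pbd (\<lambda>A. w A b) A"
proof -
  have "sqf {v} = single v 1" for v by (simp add: sqf_def)
  then show ?thesis
    by (auto simp: kos.kbd_def lab.pbd_def bd_def sum_fun_apply signed_apply vmul_def insert_Diff_if intro!: sum.cong)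
qed

lemma koszul_exact_monomial_submodule_iff:
  assumes N: "monomial_closed N"
  shows "kos.koszul_exact (monomial_submodule N r g) p j \<longleftrightarrow>
    (\<forall>b<r. lab.pexact TYPE('a) (faces N) p {j - g b})"
proof
  assume ex: "kos.koszul_exact (monomial_submodule N r g) p j"
  show "\<forall>b<r. lab.pexact TYPE('a) (faces N) p {j - g b}"
    unfolding lab.pexact_def
  proof (intro allI impI, elim conjE)
    fix b w assume b: "b < r" and w: "lab.pchain (faces N) p {j - g b} w" "\<forall>A. lab.pbd w A = (0 :: 'a mpoly)"
    define W where "W A c = (if c = b then w A else 0)" for A c
    have Wc: "(\<lambda>A. W A c) = (if c = b then w else (\<lambda>_. 0))" for c by (auto simp: W_def fun_eq_iff)
    have "kos.kchain (monomial_submodule N r g) p j W"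
      unfolding kchain_monomial_submodule_iff[OF N] Wc
      using b w by (auto simp: W_def lab.pchain_def)
    moreover have "kos.kbd W A = 0" for A
    proof
      fix c show "kos.kbd W A c = 0 c"
        unfolding kbd_apply Wc using w(2) by (auto simp: lab.pbd_def bd_def)
    qed
    ultimately obtain W' where W': "kos.kchain (monomial_submodule N r g) (Suc p) j W'" "\<And>A. kos.kbd W' A = W A"
      using ex unfolding kos.koszul_exact_def by blast
    have "lab.pchain (faces N) (Suc p) {j - g b} (\<lambda>A. W' A b)"
      using W'(1) b unfolding kchain_monomial_submodule_iff[OF N] by blast
    moreover have "lab.pbd (\<lambda>A. W' A b) A = w A" for A
      using W'(2)[of A] unfolding kbd_apply[symmetric] by (simp add: W_def)
    ultimately show "\<exists>w'. lab.pchain (faces N) (Suc p) {j - g b} w' \<and> (\<forall>A. lab.pbd w' A = w A)" by blast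
  qed
next
  assume ex: "\<forall>b<r. lab.pexact TYPE('a) (faces N) p {j - g b}"
  show "kos.koszul_exact (monomial_submodule N r g) p j"
    unfolding kos.koszul_exact_def
  proof (intro allI impI, elim conjE)
    fix w assume w: "kos.kchain (monomial_submodule N r g) p j w" and cyc: "\<forall>A. kos.kbd w A = 0"
    have "\<exists>w'. lab.pchain (faces N) (Suc p) {j - g b} w' \<and> (\<forall>A. lab.pbd w' A = w A b)" if b: "b < r" for b
    proof -
      have "lab.pchain (faces N) p {j - g b} (\<lambda>A. w A b)"
        using w b unfolding kchain_monomial_submodule_iff[OF N] by blast
      moreover have "\<forall>A. lab.pbd (\<lambda>A. w A b) A = 0"
        using cyc unfolding kbd_apply[symmetric] by simp
      ultimately show ?thesis using ex b unfolding lab.pexact_def by blast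
    qed
    then obtain h where h: "\<And>b. b < r \<Longrightarrow> lab.pchain (faces N) (Suc p) {j - g b} (h b)"
      "\<And>b A. b < r \<Longrightarrow> lab.pbd (h b) A = w A b" by metis
    define w' where "w' A b = (if b < r then h b A else 0)" for A b
    have w'c: "(\<lambda>A. w' A b) = (if b < r then h b else (\<lambda>_. 0))" for b by (auto simp: w'_def fun_eq_iff)
    have "kos.kchain (monomial_submodule N r g) (Suc p) j w'"
      unfolding kchain_monomial_submodule_iff[OF N] w'c
      using h(1) by (auto simp: w'_def)
    moreover have "kos.kbd w' A = w A" for A
    proof
      fix b
      have "w A b = 0" if "b \<ge> r" using w that unfolding kchain_monomial_submodule_iff[OF N] by blast
      then show "kos.kbd w' A b = w A b"
        unfolding kbd_apply w'c using h(2) by (auto simp: lab.pbd_def bd_def)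
    qed
    ultimately show "\<exists>w'. kos.kchain (monomial_submodule N r g) (Suc p) j w' \<and> (\<forall>A. kos.kbd w' A = w A)" by blast
  qed
qed

lemma graded_free_eq: "graded_free r g j = monomial_submodule (monomials n) r g j"
  by (auto simp: monomial_submodule_def graded_free_def free_mod_def in_poly_ring_iff)
    (metis empty_subsetI keys_zero linorder_not_less subset_iff)

lemma faces_monomials:
  "faces (monomials n) u = (if keys u \<subseteq> {1..n} then Pow (keys u) else {})"
proof -
  have "u - sqf A \<in> monomials n" if "keys u \<subseteq> {1..n}" for A
    using that by (auto simp: monomials_def in_keys_iff lookup_minus)
  then show ?thesis by (auto simp: faces_def)
qed

text \<open>In multidegree \<open>u\<close> the faces are all subsets of the support of \<open>u\<close>. This is a cone unless \<open>u = 0\<close>,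
which contributes to \<open>p = 0\<close> only.\<close>

lemma koszul_exact_graded_free:
  assumes "p > 0"
  shows "kos.koszul_exact (graded_free r g) p j"
proof -
  have "lab.pexact TYPE('a) (faces (monomials n)) p i" for i
    unfolding lab.pexact_iff[OF face_family_faces[OF monomial_closed_monomials]]
  proof (intro allI impI)
    fix u
    show "exact_at TYPE('a) {1..n} (faces (monomials n) u) p"
    proof (cases "keys u \<subseteq> {1..n} \<and> keys u \<noteq> {}")
      case True
      then obtain v where "v \<in> keys u" by blast
      then show ?thesis using True
        by (intro exact_at_cone[where v = v]) (auto simp: faces_monomials)
    next
      case False
      then show ?thesis using assms by (intro exact_at_no_faces) (auto simp: faces_monomials split: if_splits)
    qed
  qed
  then show ?thesis
    unfolding graded_free_eq[abs_def] koszul_exact_monomial_submodule_iff[OF monomial_closed_monomials] by blast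
qed

lemma graded_submodule_graded_free: "kos.graded_submodule (graded_free r g)"
  unfolding kos.graded_submodule_def
proof (intro allI conjI ballI)
  fix j
  show "0 \<in> graded_free r g j"
    by (simp add: graded_free_def free_mod_def poly_ring_closed)
  show "y - z \<in> graded_free r g j" if "y \<in> graded_free r g j" "z \<in> graded_free r g j" for y z
    using that by (auto simp: graded_free_def free_mod_def poly_ring_closed homogeneous_diff)
  show "vmul v y \<in> graded_free r g (j + 1)" if v: "v \<in> {1..n}" and y: "y \<in> graded_free r g j" for v y
  proof -
    have s: "single v 1 \<in> monomials n" using v by (auto simp: monomials_def)
    have "homogeneous 1 (mon_poly (single v 1) :: 'a mpoly)"
      by (rule homogeneous_single) (simp add: mon_degree_def)
    then have "homogeneous (1 + (j - g b)) (mon_poly (single v 1) * y b)" for b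
      using y by (intro homogeneous_mult) (auto simp: graded_free_def)
    moreover have "1 + (j - g b) = j + 1 - g b" for b by simp
    ultimately show ?thesis using y s
      by (auto simp: graded_free_def free_mod_def vmul_def poly_ring_closed)
  qed
qed

text \<open>Decomposing a polynomial without constant term into multiples of the variables is an instance of
exactness at \<open>p = 0\<close>: away from multidegree \<open>0\<close> the Koszul complex of the ring is exact there
too.\<close>

lemma augmentation_ideal:
  assumes f: "f \<in> graded_free r g j" and const: "\<And>b. lookup (f b) 0 = 0"
  obtains h where "\<And>v. v \<in> {1..n} \<Longrightarrow> h v \<in> graded_free r g (j - 1)" "(\<Sum>v\<in>{1..n}. vmul v (h v)) = f"
proof -
  define \<Delta> where "\<Delta> u = (if u = 0 then {} else faces (monomials n) u)" for u
  have \<Delta>: "lab.face_family \<Delta>"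
    using face_family_faces[OF monomial_closed_monomials]
    unfolding lab.face_family_def \<Delta>_def down_closed_def by auto
  have ex: "lab.pexact TYPE('a) \<Delta> 0 i" for i
    unfolding lab.pexact_iff[OF \<Delta>]
  proof (intro allI impI)
    fix u
    show "exact_at TYPE('a) {1..n} (\<Delta> u) 0"
    proof (cases "keys u \<subseteq> {1..n} \<and> u \<noteq> 0")
      case True
      then obtain v where "v \<in> keys u" by fastforce
      then show ?thesis using True
        by (intro exact_at_cone[where v = v]) (auto simp: \<Delta>_def faces_monomials)
    next
      case False
      then have "\<Delta> u = {}" by (auto simp: \<Delta>_def faces_monomials)
      then show ?thesis by (intro exact_at_no_faces) simp
    qed
  qed
  have "\<exists>w'. lab.pchain \<Delta> (Suc 0) {j - g b} w' \<and> (\<forall>A. lab.pbd w' A = (if A = {} then f b else 0))"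
    if b: "b < r" for b
  proof -
    define w where "w A = (if A = {} then f b else 0)" for A :: "nat set"
    have "lab.pchain \<Delta> 0 {j - g b} w"
      unfolding lab.pchain_def
    proof (intro allI ballI)
      fix A m assume "m \<in> keys (w A)"
      then have A: "A = {}" and m: "m \<in> keys (f b)" by (auto simp: w_def split: if_splits)
      have "m \<noteq> 0" using m const[of b] by (auto simp: in_keys_iff)
      moreover have "keys m \<subseteq> {1..n}"
        using f b m by (auto simp: graded_free_def free_mod_def in_poly_ring_iff monomials_def)
      moreover have "int (mon_degree m) = j - g b" using f m by (auto simp: graded_free_def homogeneous_def)
      ultimately show "A \<in> \<Delta> (m + sqf (lab.label A)) \<and> card A = 0 \<and> int (mon_degree (m + sqf (lab.label A))) \<in> {j - g b}"
        using A by (simp add: \<Delta>_def faces_monomials)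
    qed
    moreover have "\<forall>A. lab.pbd w A = 0" by (auto simp: lab.pbd_def bd_def w_def intro!: sum.neutral)
    ultimately show ?thesis using ex unfolding lab.pexact_def w_def by blast
  qed
  then obtain w' where w': "\<And>b. b < r \<Longrightarrow> lab.pchain \<Delta> (Suc 0) {j - g b} (w' b)"
    "\<And>b A. b < r \<Longrightarrow> lab.pbd (w' b) A = (if A = {} then f b else 0)" by metis
  define h where "h v b = (if b < r then w' b {v} else 0)" for v b
  show ?thesis
  proof (rule that)
    fix v assume v: "v \<in> {1..n}"
    have *: "keys m \<subseteq> {1..n} \<and> int (mon_degree m) = j - 1 - g b"
      if "b < r" "m \<in> keys (w' b {v})" for b m
    proof -
      have "{v} \<in> \<Delta> (m + sqf {v})" "int (mon_degree (m + sqf {v})) = j - g b"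
        using w'(1)[OF that(1)] that(2) unfolding lab.pchain_def by fastforce+
      then show ?thesis
        by (auto simp: \<Delta>_def faces_monomials keys_add_monomial mon_degree_add mon_degree_sqf split: if_splits)
    qed
    then show "h v \<in> graded_free r g (j - 1)"
      by (auto simp: h_def graded_free_def free_mod_def in_poly_ring_iff monomials_def homogeneous_def)
  next
    show "(\<Sum>v\<in>{1..n}. vmul v (h v)) = f"
    proof
      fix b
      show "(\<Sum>v\<in>{1..n}. vmul v (h v)) b = f b"
      proof (cases "b < r")
        case True
        have "(\<Sum>v\<in>{1..n}. vmul v (h v)) b = lab.pbd (w' b) {}"
          using True by (simp add: sum_fun_apply vmul_def h_def lab.pbd_def bd_def signed_def sqf_def)
        then show ?thesis using w'(2)[OF True] by simp
      next
        case False
        then show ?thesis using f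
          by (simp add: sum_fun_apply vmul_def h_def graded_free_def free_mod_def)
      qed
    qed
  qed
qed

end

section \<open>Tor as Koszul homology\<close>

lemma trivial_FactGroup_iff:
  assumes "comm_group G" and H: "subgroup H G"
  shows "trivial_group (G Mod H) \<longleftrightarrow> carrier G \<subseteq> H"
proof -
  interpret G: comm_group G by fact
  have N: "H \<lhd> G" using H by (rule G.subgroup_imp_normal)
  have sub: "H \<subseteq> carrier G" using H by (rule subgroup.subset)
  show ?thesis
  proof
    assume "trivial_group (G Mod H)"
    then have "rcosets\<^bsub>G\<^esub> H = {H}" by (simp add: trivial_group_def FactGroup_def)
    then have "H #>\<^bsub>G\<^esub> g = H" if "g \<in> carrier G" for g
      using G.rcosetsI[OF sub that] by simp
    then show "carrier G \<subseteq> H" using G.rcos_self[OF _ H] by blast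
  next
    assume "carrier G \<subseteq> H"
    then have H_eq: "H = carrier G" using sub by blast
    have "H #>\<^bsub>G\<^esub> g = H" if "g \<in> carrier G" for g
      using that H H_eq G.coset_join2 by blast
    then have "rcosets\<^bsub>G\<^esub> H = {H}"
      using G.one_closed unfolding RCOSETS_def by auto
    then show "trivial_group (G Mod H)"
      using normal.factorgroup_is_group[OF N] by (simp add: trivial_group_def FactGroup_def)
  qed
qed

lemma comm_group_pointwise:
  fixes Z :: "('i \<Rightarrow> 'a::ab_group_add) set"
  assumes "(\<lambda>_. 0) \<in> Z" "\<And>v w. v \<in> Z \<Longrightarrow> w \<in> Z \<Longrightarrow> (\<lambda>b. v b + w b) \<in> Z"
    "\<And>v. v \<in> Z \<Longrightarrow> (\<lambda>b. - v b) \<in> Z"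
  shows "comm_group \<lparr>carrier = Z, monoid.mult = (\<lambda>v w b. v b + w b), one = (\<lambda>_. 0)\<rparr>"
proof (rule comm_groupI)
  fix v assume "v \<in> carrier \<lparr>carrier = Z, monoid.mult = (\<lambda>v w b. v b + w b), one = (\<lambda>_. 0)\<rparr>"
  then show "\<exists>w\<in>carrier \<lparr>carrier = Z, monoid.mult = (\<lambda>v w b. v b + w b), one = (\<lambda>_. 0)\<rparr>.
      w \<otimes>\<^bsub>\<lparr>carrier = Z, monoid.mult = (\<lambda>v w b. v b + w b), one = (\<lambda>_. 0)\<rparr>\<^esub> v =
      \<one>\<^bsub>\<lparr>carrier = Z, monoid.mult = (\<lambda>v w b. v b + w b), one = (\<lambda>_. 0)\<rparr>\<^esub>"
    using assms(3) by (intro bexI[of _ "\<lambda>b. - v b"]) auto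
qed (use assms in \<open>auto simp: algebra_simps\<close>)

text \<open>The homology groups are factor groups of groups of functions under pointwise addition; such a
factor group is trivial as soon as all cycles are boundaries.\<close>

lemma trivial_pointwise_quotient_iff:
  fixes Z :: "('i \<Rightarrow> 'a::ab_group_add) set"
  assumes Z: "(\<lambda>_. 0) \<in> Z" "\<And>v w. v \<in> Z \<Longrightarrow> w \<in> Z \<Longrightarrow> (\<lambda>b. v b + w b) \<in> Z"
    "\<And>v. v \<in> Z \<Longrightarrow> (\<lambda>b. - v b) \<in> Z"
    and B: "(\<lambda>_. 0) \<in> B" "\<And>v w. v \<in> B \<Longrightarrow> w \<in> B \<Longrightarrow> (\<lambda>b. v b + w b) \<in> B"
    "\<And>v. v \<in> B \<Longrightarrow> (\<lambda>b. - v b) \<in> B"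
    and BZ: "B \<subseteq> Z"
  shows "trivial_group (\<lparr>carrier = Z, monoid.mult = (\<lambda>v w b. v b + w b), one = (\<lambda>_. 0)\<rparr> Mod B) \<longleftrightarrow> Z \<subseteq> B"
proof -
  let ?G = "\<lparr>carrier = Z, monoid.mult = (\<lambda>v w b. v b + w b), one = (\<lambda>_. 0)\<rparr>"
  interpret G: comm_group ?G by (rule comm_group_pointwise[OF Z])
  have inv: "inv\<^bsub>?G\<^esub> v = (\<lambda>b. - v b)" if "v \<in> Z" for v
    by (rule G.inv_equality) (use that Z(3) in auto)
  have "subgroup B ?G"
    by (rule G.subgroupI) (use B BZ inv in \<open>auto simp: subset_iff\<close>)
  then show ?thesis using trivial_FactGroup_iff[OF G.comm_group_axioms] by simp
qed

text \<open>Vectors of scalars, as constant vectors of polynomials, form a section of the reduction modulo the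
variables.\<close>

definition lift_k :: "(nat \<Rightarrow> 'a::field) \<Rightarrow> nat \<Rightarrow> 'a mpoly" where
  "lift_k v = (\<lambda>b. single 0 (v b))"

definition const_k :: "(nat \<Rightarrow> 'a::field mpoly) \<Rightarrow> nat \<Rightarrow> 'a" where
  "const_k f = (\<lambda>b. lookup (f b) 0)"

lemma lookup_mult_0:
  fixes p q :: "'a::field mpoly"
  shows "lookup (p * q) 0 = lookup p 0 * lookup q 0"
proof -
  have zero: "0 = l + q \<longleftrightarrow> l = 0 \<and> q = 0" for l q :: monomial
    by (metis add.right_neutral keys_add_monomial keys_eq_empty Un_empty)
  have "(\<Sum>t. lookup q t when l = 0 \<and> t = 0) = (lookup q 0 when l = 0)" for l :: monomial
    by (cases "l = 0") simp_all
  then show ?thesis by (simp add: lookup_mult zero mult_when)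
qed

lemma const_lift_k [simp]: "const_k (lift_k v) = v"
  by (simp add: const_k_def lift_k_def)

lemma const_k_diff_map: "const_k (diff_map C i f) = diff_k C i (const_k f)"
  by (auto simp: const_k_def diff_map_def diff_k_def lookup_sum lookup_mult_0)

lemma const_k_diff: "const_k (f - g) = const_k f - const_k g"
  by (simp add: const_k_def lookup_minus fun_eq_iff)

lemma const_k_vmul: "const_k (vmul v f) = (\<lambda>_. 0)"
  by (simp add: const_k_def vmul_def lookup_mult_0 lookup_single poly_mapping_eq_iff fun_eq_iff when_def)

lemma const_k_sum_vmul: "const_k (\<Sum>v\<in>B. vmul v (h v)) = (\<lambda>_. 0)"
proof -
  have "lookup (vmul v (h v) b) 0 = 0" for v b
    using fun_cong[OF const_k_vmul, of v "h v" b] by (simp add: const_k_def)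
  then show ?thesis by (simp add: const_k_def sum_fun_apply lookup_sum)
qed

lemma diff_map_add: "diff_map C i (f + g) = diff_map C i f + diff_map C i g"
  by (auto simp: diff_map_def fun_eq_iff distrib_right sum.distrib)

lemma diff_map_vmul: "diff_map C i (vmul v f) = vmul v (diff_map C i f)"
  by (auto simp: diff_map_def vmul_def fun_eq_iff sum_distrib_left mult.assoc)

lemma diff_map_minus: "diff_map C i (f - g) = diff_map C i f - diff_map C i g"
  by (rule additive_diff[of "diff_map C i", OF diff_map_add])

lemma diff_map_sum: "diff_map C i (sum f B) = (\<Sum>b\<in>B. diff_map C i (f b))"
  by (rule additive_sum[of "diff_map C i", OF diff_map_add])

lemma diff_map_0: "diff_map C i 0 = 0"
  by (rule additive_zero[of "diff_map C i", OF diff_map_add])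

lemma diff_k_add: "diff_k C i (\<lambda>b. v b + w b) = (\<lambda>b. diff_k C i v b + diff_k C i w b)"
  by (auto simp: diff_k_def fun_eq_iff distrib_right sum.distrib)

lemma diff_k_uminus: "diff_k C i (\<lambda>b. - v b) = (\<lambda>b. - diff_k C i v b)"
  by (auto simp: diff_k_def fun_eq_iff sum_negf)

context polynomial_setting
begin

text \<open>A complex with its augmentation to the ring treated as the term in position \<open>0\<close>. The ideal then
becomes the image of the first differential and is handled like the other syzygy modules.\<close>

definition exact_complex :: "'a free_complex \<Rightarrow> bool" where
  "exact_complex C \<longleftrightarrow>
     (\<forall>i. \<forall>b<rnk C (Suc i). \<forall>c<rnk C i. mat C i b c \<in> carrier (poly_ring n) \<and>
        homogeneous (gdeg C (Suc i) b - gdeg C i c) (mat C i b c)) \<and>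
     (\<forall>i. {f \<in> free_mod n (rnk C (Suc i)). diff_map C i f = (\<lambda>_. 0)} =
          diff_map C (Suc i) ` free_mod n (rnk C (Suc (Suc i))))"

definition cfree :: "'a free_complex \<Rightarrow> nat \<Rightarrow> int \<Rightarrow> (nat \<Rightarrow> 'a mpoly) set" where
  "cfree C i = graded_free (rnk C i) (gdeg C i)"

definition cimage :: "'a free_complex \<Rightarrow> nat \<Rightarrow> int \<Rightarrow> (nat \<Rightarrow> 'a mpoly) set" where
  "cimage C i j = diff_map C i ` cfree C (Suc i) j"

definition vcomp :: "(nat \<Rightarrow> int) \<Rightarrow> int \<Rightarrow> (nat \<Rightarrow> 'a mpoly) \<Rightarrow> nat \<Rightarrow> 'a mpoly" where
  "vcomp g j f = (\<lambda>b. hcomp (j - g b) (f b))"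

lemma hcomp_closed: "p \<in> carrier (poly_ring n) \<Longrightarrow> hcomp e p \<in> carrier (poly_ring n)"
  using keys_hcomp[of e p] by (auto simp: in_poly_ring_iff)

lemma vcomp_in_graded_free:
  assumes "f \<in> free_mod n r"
  shows "vcomp g j f \<in> graded_free r g j"
proof -
  have "hcomp e 0 = (0 :: 'a mpoly)" for e by (simp add: hcomp_homogeneous)
  then show ?thesis using assms
    by (auto simp: vcomp_def graded_free_def free_mod_def hcomp_closed homogeneous_hcomp)
qed

lemma vcomp_graded_free: "f \<in> graded_free r g j \<Longrightarrow> vcomp g j f = f"
  by (auto simp: vcomp_def graded_free_def hcomp_homogeneous)

lemma graded_submodule_cfree: "kos.graded_submodule (cfree C i)"
  unfolding cfree_def by (rule graded_submodule_graded_free)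

context
  fixes C
  assumes C: "exact_complex C"
begin

text \<open>Since the matrix entries are homogeneous, the differentials commute with taking homogeneous
components; exactness therefore holds in each degree.\<close>

lemma diff_map_vcomp:
  "diff_map C i (vcomp (gdeg C (Suc i)) j f) = vcomp (gdeg C i) j (diff_map C i f)"
proof
  fix c
  show "diff_map C i (vcomp (gdeg C (Suc i)) j f) c = vcomp (gdeg C i) j (diff_map C i f) c"
  proof (cases "c < rnk C i")
    case True
    have "hcomp (j - gdeg C i c) (f b * mat C i b c) = hcomp (j - gdeg C (Suc i) b) (f b) * mat C i b c"
      if "b < rnk C (Suc i)" for b
    proof -
      have "homogeneous (gdeg C (Suc i) b - gdeg C i c) (mat C i b c)"
        using C True that unfolding exact_complex_def by blast
      from hcomp_mult[OF this, of "j - gdeg C i c" "f b"] show ?thesis by (simp add: algebra_simps)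
    qed
    then show ?thesis using True by (simp add: diff_map_def vcomp_def hcomp_sum)
  next
    case False
    then show ?thesis by (simp add: diff_map_def vcomp_def hcomp_homogeneous)
  qed
qed

lemma diff_map_free_mod:
  assumes "f \<in> free_mod n (rnk C (Suc i))"
  shows "diff_map C i f \<in> free_mod n (rnk C i)"
  using C assms unfolding exact_complex_def free_mod_def diff_map_def
  by (auto intro!: poly_ring_sum_closed poly_ring_closed)

lemma diff_map_cfree:
  assumes "f \<in> cfree C (Suc i) j"
  shows "diff_map C i f \<in> cfree C i j"
proof -
  have f: "f \<in> free_mod n (rnk C (Suc i))" "vcomp (gdeg C (Suc i)) j f = f"
    using assms vcomp_graded_free by (auto simp: cfree_def graded_free_def)
  have "diff_map C i f = vcomp (gdeg C i) j (diff_map C i f)"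
    using diff_map_vcomp[of i j f] f(2) by simp
  also have "\<dots> \<in> cfree C i j"
    unfolding cfree_def by (rule vcomp_in_graded_free[OF diff_map_free_mod[OF f(1)]])
  finally show ?thesis .
qed

lemma diff_map_diff_map:
  assumes "f \<in> free_mod n (rnk C (Suc (Suc i)))"
  shows "diff_map C i (diff_map C (Suc i) f) = 0"
proof -
  have "diff_map C (Suc i) f \<in> {f \<in> free_mod n (rnk C (Suc i)). diff_map C i f = (\<lambda>_. 0)}"
    using C assms unfolding exact_complex_def by blast
  then show ?thesis by (simp add: zero_fun_def)
qed

lemma cimage_eq_kernel: "cimage C (Suc i) j = {f \<in> cfree C (Suc i) j. diff_map C i f = 0}"
proof (intro equalityI subsetI)
  fix z assume "z \<in> cimage C (Suc i) j"
  then obtain f where f: "f \<in> cfree C (Suc (Suc i)) j" "z = diff_map C (Suc i) f"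
    by (auto simp: cimage_def)
  then have "f \<in> free_mod n (rnk C (Suc (Suc i)))" by (simp add: cfree_def graded_free_def)
  then show "z \<in> {f \<in> cfree C (Suc i) j. diff_map C i f = 0}"
    using diff_map_diff_map diff_map_cfree[OF f(1)] f(2) by simp
next
  fix z assume z: "z \<in> {f \<in> cfree C (Suc i) j. diff_map C i f = 0}"
  then have "z \<in> {f \<in> free_mod n (rnk C (Suc i)). diff_map C i f = (\<lambda>_. 0)}"
    by (simp add: cfree_def graded_free_def zero_fun_def)
  then obtain f where f: "f \<in> free_mod n (rnk C (Suc (Suc i)))" "z = diff_map C (Suc i) f"
    using C unfolding exact_complex_def by blast
  have "vcomp (gdeg C (Suc i)) j z = z"
    using z vcomp_graded_free unfolding cfree_def by blast
  then have "diff_map C (Suc i) (vcomp (gdeg C (Suc (Suc i))) j f) = z"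
    by (simp only: diff_map_vcomp f(2))
  then show "z \<in> cimage C (Suc i) j"
    using vcomp_in_graded_free[OF f(1)] unfolding cimage_def cfree_def by (metis imageI)
qed

lemma graded_submodule_cimage: "kos.graded_submodule (cimage C i)"
  unfolding kos.graded_submodule_def
proof (intro allI conjI ballI)
  note D = kos.graded_submoduleD[OF graded_submodule_cfree]
  fix j
  show "0 \<in> cimage C i j" unfolding cimage_def using D(1) diff_map_0 by (metis imageI)
  show "y - z \<in> cimage C i j" if "y \<in> cimage C i j" "z \<in> cimage C i j" for y z
    using that D(2) unfolding cimage_def by (auto simp flip: diff_map_minus)
  show "vmul v y \<in> cimage C i (j + 1)" if "v \<in> {1..n}" "y \<in> cimage C i j" for v y
    using that D(3) unfolding cimage_def by (auto simp flip: diff_map_vmul)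
qed

lemma cimage_subset: "cimage C i j \<subseteq> cfree C i j"
  using diff_map_cfree by (auto simp: cimage_def)

lemma koszul_exact_cimage_Suc:
  "kos.koszul_exact (cimage C i) (Suc p) j \<longleftrightarrow> kos.koszul_pure (cimage C (Suc i)) (cfree C (Suc i)) p j"
proof (rule kos.koszul_exact_quotient_iff[where f = "diff_map C i"])
  show "kos.graded_submodule (cfree C (Suc i))" by (rule graded_submodule_cfree)
  show "kos.koszul_exact (cfree C (Suc i)) (Suc p) j"
    unfolding cfree_def by (rule koszul_exact_graded_free) simp
qed (simp_all add: diff_map_add diff_map_vmul cimage_eq_kernel, simp add: cimage_def)

text \<open>Dimension shifting along \<open>0 \<rightarrow> Z\<^sub>i\<^sub>+\<^sub>1 \<rightarrow> F\<^sub>i\<^sub>+\<^sub>1 \<rightarrow> Z\<^sub>i \<rightarrow> 0\<close>, where \<open>Z\<^sub>i\<close> is the image in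
\<open>F\<^sub>i\<close>. At homological degree \<open>0\<close> the homology of the free module does not vanish, and injectivity
remains in place of exactness.\<close>

lemma koszul_exact_cimage:
  "kos.koszul_exact (cimage C 0) (Suc i) j \<longleftrightarrow> kos.koszul_pure (cimage C (Suc i)) (cfree C (Suc i)) 0 j"
proof -
  have step: "kos.koszul_exact (cimage C i) (Suc (Suc p)) j \<longleftrightarrow> kos.koszul_exact (cimage C (Suc i)) (Suc p) j"
    for i p
  proof -
    have "kos.koszul_exact (cimage C (Suc i)) (Suc p) j \<longleftrightarrow>
        kos.koszul_pure (cimage C (Suc i)) (cfree C (Suc i)) (Suc p) j"
      by (rule kos.koszul_exact_iff_pure_of_exact[OF _ cimage_subset])
        (simp_all add: cfree_def koszul_exact_graded_free)
    then show ?thesis using koszul_exact_cimage_Suc by blast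
  qed
  have "kos.koszul_exact (cimage C 0) (Suc (i + p)) j \<longleftrightarrow> kos.koszul_exact (cimage C i) (Suc p) j" for p
  proof (induction i arbitrary: p)
    case (Suc i)
    then show ?case using Suc.IH[of "Suc p"] step[of i p] by simp
  qed simp
  from this[of 0] show ?thesis using koszul_exact_cimage_Suc[of i 0] by simp
qed

lemma lift_k_cfree:
  assumes v: "v \<in> tensor_k C i j"
  shows "lift_k v \<in> cfree C i j"
proof -
  have "0 \<in> monomials n" by (simp add: monomials_def)
  then have "lift_k v b \<in> carrier (poly_ring n)" for b
    unfolding lift_k_def by (rule poly_ring_closed(5))
  moreover have "lift_k v b = 0" if "b \<ge> rnk C i" for b
  proof -
    have "v b = 0" using v that unfolding tensor_k_def by fastforce
    then show ?thesis by (simp add: lift_k_def)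
  qed
  moreover have "homogeneous (j - gdeg C i b) (lift_k v b)" for b
    using v by (cases "v b = 0") (auto simp: lift_k_def tensor_k_def homogeneous_def)
  ultimately show ?thesis by (simp add: cfree_def graded_free_def free_mod_def)
qed

lemma const_k_cfree: "f \<in> cfree C i j \<Longrightarrow> const_k f \<in> tensor_k C i j"
proof -
  assume f: "f \<in> cfree C i j"
  have "b < rnk C i \<and> gdeg C i b = j" if "const_k f b \<noteq> 0" for b
  proof -
    have "b < rnk C i" using f that by (auto simp: cfree_def graded_free_def free_mod_def const_k_def intro: leI ccontr)
    moreover have "0 \<in> keys (f b)" using that by (simp add: const_k_def in_keys_iff)
    then have "int (mon_degree 0) = j - gdeg C i b"
      using f unfolding cfree_def graded_free_def homogeneous_def by blast
    ultimately show ?thesis by simp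
  qed
  then show ?thesis by (simp add: tensor_k_def)
qed

lemma diff_k_tensor_k:
  assumes "t \<in> tensor_k C (Suc i) j"
  shows "diff_k C i t \<in> tensor_k C i j"
  using const_k_cfree[OF diff_map_cfree[OF lift_k_cfree[OF assms]]] by (simp add: const_k_diff_map)

lemma diff_k_diff_k:
  assumes "t \<in> tensor_k C (Suc (Suc i)) j"
  shows "diff_k C i (diff_k C (Suc i) t) = (\<lambda>_. 0)"
proof -
  have "lift_k t \<in> free_mod n (rnk C (Suc (Suc i)))"
    using lift_k_cfree[OF assms] by (simp add: cfree_def graded_free_def)
  from diff_map_diff_map[OF this]
  have "const_k (diff_map C i (diff_map C (Suc i) (lift_k t))) = (\<lambda>_. 0)"
    by (simp add: const_k_def)
  then show ?thesis by (simp add: const_k_diff_map)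
qed

lemma trivial_homology_k_iff:
  "trivial_group (homology_k C (Suc i) j) \<longleftrightarrow>
    (\<forall>v\<in>tensor_k C (Suc i) j. diff_k C i v = (\<lambda>_. 0) \<longrightarrow> v \<in> diff_k C (Suc i) ` tensor_k C (Suc (Suc i)) j)"
proof -
  have T: "(\<lambda>_. 0) \<in> tensor_k C i j" "v \<in> tensor_k C i j \<Longrightarrow> w \<in> tensor_k C i j \<Longrightarrow> (\<lambda>b. v b + w b) \<in> tensor_k C i j"
    "v \<in> tensor_k C i j \<Longrightarrow> (\<lambda>b. - v b) \<in> tensor_k C i j" for i v w
    by (auto simp: tensor_k_def) (metis add.right_neutral)+
  have 0: "diff_k C i (\<lambda>_. 0) = (\<lambda>_. 0)" for i by (simp add: diff_k_def fun_eq_iff)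
  have "trivial_group (homology_k C (Suc i) j) \<longleftrightarrow> cycles_k C (Suc i) j \<subseteq> boundaries_k C (Suc i) j"
    unfolding homology_k_def
  proof (rule trivial_pointwise_quotient_iff)
    show "(\<lambda>_. 0) \<in> boundaries_k C (Suc i) j" unfolding boundaries_k_def using T(1) 0 by (metis imageI)
    show "(\<lambda>b. v b + w b) \<in> boundaries_k C (Suc i) j"
      if "v \<in> boundaries_k C (Suc i) j" "w \<in> boundaries_k C (Suc i) j" for v w
      using that T(2) unfolding boundaries_k_def by (auto simp flip: diff_k_add)
    show "(\<lambda>b. - v b) \<in> boundaries_k C (Suc i) j" if "v \<in> boundaries_k C (Suc i) j" for v
      using that T(3) unfolding boundaries_k_def by (auto simp flip: diff_k_uminus)
    show "boundaries_k C (Suc i) j \<subseteq> cycles_k C (Suc i) j"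
      using diff_k_tensor_k diff_k_diff_k by (auto simp: boundaries_k_def cycles_k_def)
  qed (use T 0 in \<open>auto simp: cycles_k_def diff_k_add diff_k_uminus\<close>)
  then show ?thesis by (auto simp: cycles_k_def boundaries_k_def)
qed

text \<open>A scalar vector killed by the reduced differential lifts to \<open>F\<^sub>i\<^sub>+\<^sub>1\<close>, and the image of the lift lies
in \<open>Z\<^sub>i \<inter> \<mm>F\<^sub>i\<close>. It lies in \<open>\<mm>Z\<^sub>i\<close> exactly if the lift can be changed by an element of
\<open>\<mm>F\<^sub>i\<^sub>+\<^sub>1\<close> into a cycle, that is, into the image of some element of \<open>F\<^sub>i\<^sub>+\<^sub>2\<close>.\<close>

lemma trivial_homology_k_iff_pure:
  "trivial_group (homology_k C (Suc i) j) \<longleftrightarrow> kos.koszul_pure (cimage C i) (cfree C i) 0 j"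
  unfolding trivial_homology_k_iff
    kos.koszul_pure_0_iff[OF graded_submodule_cfree graded_submodule_cimage]
proof (intro iffI allI impI ballI, elim conjE)
  assume triv: "\<forall>v\<in>tensor_k C (Suc i) j. diff_k C i v = (\<lambda>_. 0) \<longrightarrow>
    v \<in> diff_k C (Suc i) ` tensor_k C (Suc (Suc i)) j"
  fix g assume z: "(\<Sum>v\<in>{1..n}. vmul v (g v)) \<in> cimage C i j"
  then obtain y where y: "y \<in> cfree C (Suc i) j" "(\<Sum>v\<in>{1..n}. vmul v (g v)) = diff_map C i y"
    by (auto simp: cimage_def)
  have "diff_k C i (const_k y) = (\<lambda>_. 0)"
    using const_k_sum_vmul[of g "{1..n}"] y(2) by (simp add: const_k_diff_map)
  then obtain t where t: "t \<in> tensor_k C (Suc (Suc i)) j" "const_k y = diff_k C (Suc i) t"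
    using triv const_k_cfree[OF y(1)] by blast
  note T = lift_k_cfree[OF t(1)]
  \<comment> \<open>Subtracting a boundary does not change the image and removes the constant terms.\<close>
  define y' where "y' = y - diff_map C (Suc i) (lift_k t)"
  have y': "y' \<in> cfree C (Suc i) j"
    unfolding y'_def using kos.graded_submoduleD(2)[OF graded_submodule_cfree y(1) diff_map_cfree[OF T]] .
  have "const_k y' = (\<lambda>_. 0)"
    unfolding y'_def const_k_diff const_k_diff_map using t(2) by (simp add: fun_eq_iff)
  then have c: "lookup (y' b) 0 = 0" for b by (simp add: const_k_def fun_eq_iff)
  obtain h where h: "\<And>v. v \<in> {1..n} \<Longrightarrow> h v \<in> cfree C (Suc i) (j - 1)" "(\<Sum>v\<in>{1..n}. vmul v (h v)) = y'"
    using augmentation_ideal[OF y'[unfolded cfree_def] c] unfolding cfree_def by blast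
  have "diff_map C i y' = diff_map C i y"
    using diff_map_diff_map[of "lift_k t" i] T
    by (simp add: y'_def diff_map_minus cfree_def graded_free_def)
  then have "(\<Sum>v\<in>{1..n}. vmul v (diff_map C i (h v))) = (\<Sum>v\<in>{1..n}. vmul v (g v))"
    using y(2) by (simp add: diff_map_sum diff_map_vmul flip: h(2))
  moreover have "\<forall>v\<in>{1..n}. diff_map C i (h v) \<in> cimage C i (j - 1)"
    using h(1) by (simp add: cimage_def)
  ultimately show "\<exists>h. (\<forall>v\<in>{1..n}. h v \<in> cimage C i (j - 1)) \<and>
      (\<Sum>v\<in>{1..n}. vmul v (h v)) = (\<Sum>v\<in>{1..n}. vmul v (g v))"
    by (intro exI[of _ "\<lambda>v. diff_map C i (h v)"]) blast
next
  assume pure: "\<forall>g. (\<forall>v\<in>{1..n}. g v \<in> cfree C i (j - 1)) \<and> (\<Sum>v\<in>{1..n}. vmul v (g v)) \<in> cimage C i j \<longrightarrow>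
    (\<exists>h. (\<forall>v\<in>{1..n}. h v \<in> cimage C i (j - 1)) \<and>
      (\<Sum>v\<in>{1..n}. vmul v (h v)) = (\<Sum>v\<in>{1..n}. vmul v (g v)))"
  fix v assume v: "v \<in> tensor_k C (Suc i) j" "diff_k C i v = (\<lambda>_. 0)"
  note y = lift_k_cfree[OF v(1)]
  have "const_k (diff_map C i (lift_k v)) = (\<lambda>_. 0)" using v(2) by (simp add: const_k_diff_map)
  then have c: "lookup (diff_map C i (lift_k v) b) 0 = 0" for b
    by (simp add: const_k_def fun_eq_iff)
  obtain g where g: "\<And>v. v \<in> {1..n} \<Longrightarrow> g v \<in> cfree C i (j - 1)"
    "(\<Sum>v\<in>{1..n}. vmul v (g v)) = diff_map C i (lift_k v)"
    using augmentation_ideal[OF diff_map_cfree[OF y, unfolded cfree_def] c] unfolding cfree_def by blast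
  have "(\<Sum>v\<in>{1..n}. vmul v (g v)) \<in> cimage C i j" unfolding g(2) cimage_def using y by blast
  with pure[THEN spec, of g] g(1) obtain h' where h': "\<forall>v\<in>{1..n}. h' v \<in> cimage C i (j - 1)"
    "(\<Sum>v\<in>{1..n}. vmul v (h' v)) = diff_map C i (lift_k v)"
    unfolding g(2) by blast
  then have "\<forall>v\<in>{1..n}. \<exists>h. h \<in> cfree C (Suc i) (j - 1) \<and> h' v = diff_map C i h"
    by (auto simp: cimage_def)
  then obtain h where h: "\<And>v. v \<in> {1..n} \<Longrightarrow> h v \<in> cfree C (Suc i) (j - 1) \<and> h' v = diff_map C i (h v)"
    by metis
  note D = kos.graded_submoduleD[OF graded_submodule_cfree]
  \<comment> \<open>The lift minus this element is a cycle with the same constant terms as the lift.\<close>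
  have hs: "(\<Sum>v\<in>{1..n}. vmul v (h v)) \<in> cfree C (Suc i) j"
  proof (rule kos.graded_submodule_sum[OF graded_submodule_cfree])
    fix v assume "v \<in> {1..n}"
    then show "vmul v (h v) \<in> cfree C (Suc i) j" using D(3)[of v "h v" C "Suc i" "j - 1"] h by simp
  qed
  have "diff_map C i (\<Sum>v\<in>{1..n}. vmul v (h v)) = (\<Sum>v\<in>{1..n}. vmul v (h' v))"
    using h by (simp add: diff_map_sum diff_map_vmul)
  then have "diff_map C i (lift_k v - (\<Sum>v\<in>{1..n}. vmul v (h v))) = 0"
    using h'(2) by (simp add: diff_map_minus)
  then have "lift_k v - (\<Sum>v\<in>{1..n}. vmul v (h v)) \<in> cimage C (Suc i) j"
    unfolding cimage_eq_kernel using D(2)[OF y hs] by simp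
  then obtain t where t: "t \<in> cfree C (Suc (Suc i)) j"
    "lift_k v - (\<Sum>v\<in>{1..n}. vmul v (h v)) = diff_map C (Suc i) t"
    by (auto simp: cimage_def)
  have "const_k (lift_k v - (\<Sum>v\<in>{1..n}. vmul v (h v))) = v"
    unfolding const_k_diff const_k_sum_vmul by (simp add: fun_eq_iff)
  then have "v = diff_k C (Suc i) (const_k t)" unfolding t(2) const_k_diff_map by simp
  then show "v \<in> diff_k C (Suc i) ` tensor_k C (Suc (Suc i)) j" using const_k_cfree[OF t(1)] by blast
qed

end

subsection \<open>Resolutions of ideals\<close>

definition augmented :: "'a free_complex \<Rightarrow> 'a free_complex" where
  "augmented F = \<lparr>rnk = (\<lambda>i. case i of 0 \<Rightarrow> 1 | Suc i' \<Rightarrow> rnk F i'),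
     gdeg = (\<lambda>i b. case i of 0 \<Rightarrow> 0 | Suc i' \<Rightarrow> gdeg F i' b),
     aug = (\<lambda>_. 0),
     mat = (\<lambda>i b c. case i of 0 \<Rightarrow> aug F b | Suc i' \<Rightarrow> mat F i' b c)\<rparr>"

lemma augmented_simps [simp]:
  "rnk (augmented F) 0 = 1" "rnk (augmented F) (Suc i) = rnk F i"
  "gdeg (augmented F) 0 b = 0" "gdeg (augmented F) (Suc i) b = gdeg F i b"
  "mat (augmented F) 0 b c = aug F b" "mat (augmented F) (Suc i) b c = mat F i b c"
  by (simp_all add: augmented_def)

lemma diff_map_augmented:
  "diff_map (augmented F) (Suc i) = diff_map F i"
  "diff_map (augmented F) 0 v = (\<lambda>c. if c = 0 then aug_map F v else 0)"
  by (auto simp: diff_map_def aug_map_def fun_eq_iff)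

lemma exact_complex_augmented:
  assumes F: "graded_free_resolution n I F"
  shows "exact_complex (augmented F)"
  unfolding exact_complex_def
proof (intro conjI allI impI)
  fix i b c assume "b < rnk (augmented F) (Suc i)" "c < rnk (augmented F) i"
  then show "mat (augmented F) i b c \<in> carrier (poly_ring n)"
    "homogeneous (gdeg (augmented F) (Suc i) b - gdeg (augmented F) i c) (mat (augmented F) i b c)"
    using F unfolding graded_free_resolution_def by (cases i; simp)+
next
  fix i
  show "{f \<in> free_mod n (rnk (augmented F) (Suc i)). diff_map (augmented F) i f = (\<lambda>_. 0)} =
      diff_map (augmented F) (Suc i) ` free_mod n (rnk (augmented F) (Suc (Suc i)))"
  proof (cases i)
    case 0
    have "diff_map (augmented F) 0 f = (\<lambda>_. 0) \<longleftrightarrow> aug_map F f = 0" for f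
      by (auto simp: diff_map_augmented fun_eq_iff)
    then show ?thesis using F 0 unfolding graded_free_resolution_def by (simp add: diff_map_augmented One_nat_def)
  next
    case (Suc i')
    then show ?thesis using F unfolding graded_free_resolution_def by (simp add: diff_map_augmented)
  qed
qed

definition ideal_module :: "'a mpoly set \<Rightarrow> int \<Rightarrow> (nat \<Rightarrow> 'a mpoly) set" where
  "ideal_module I j = {f. f 0 \<in> I \<and> homogeneous j (f 0) \<and> (\<forall>b>0. f b = 0)}"

lemma cimage_augmented:
  assumes F: "graded_free_resolution n I F"
  shows "cimage (augmented F) 0 j = ideal_module I j"
proof (intro equalityI subsetI)
  fix f assume "f \<in> cimage (augmented F) 0 j"
  then obtain g where g: "g \<in> cfree (augmented F) (Suc 0) j" "f = diff_map (augmented F) 0 g"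
    by (auto simp: cimage_def)
  have "g \<in> free_mod n (rnk F 0)" using g(1) by (simp add: cfree_def graded_free_def)
  then have "aug_map F g \<in> I" using F unfolding graded_free_resolution_def by blast
  moreover have "f \<in> cfree (augmented F) 0 j"
    using diff_map_cfree[OF exact_complex_augmented[OF F] g(1)] g(2) by simp
  then have "homogeneous j (f 0)" by (auto simp: cfree_def graded_free_def dest: spec[of _ 0])
  ultimately show "f \<in> ideal_module I j"
    using g(2) by (auto simp: ideal_module_def diff_map_augmented)
next
  fix f assume f: "f \<in> ideal_module I j"
  have "aug_map F ` free_mod n (rnk F 0) = I" using F by (simp add: graded_free_resolution_def)
  moreover have "f 0 \<in> I" using f by (simp add: ideal_module_def)
  ultimately obtain g where g: "g \<in> free_mod n (rnk F 0)" "f 0 = aug_map F g" by blast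
  have feq: "f = diff_map (augmented F) 0 g"
    using f g(2) by (auto simp: diff_map_augmented ideal_module_def fun_eq_iff)
  have "diff_map (augmented F) 0 (vcomp (gdeg (augmented F) (Suc 0)) j g) =
      vcomp (gdeg (augmented F) 0) j f"
    unfolding diff_map_vcomp[OF exact_complex_augmented[OF F]] feq ..
  also have "\<dots> = f"
  proof
    fix b show "vcomp (gdeg (augmented F) 0) j f b = f b"
      using f by (cases "b = 0") (auto simp: vcomp_def ideal_module_def hcomp_homogeneous)
  qed
  finally show "f \<in> cimage (augmented F) 0 j"
    using vcomp_in_graded_free[OF g(1)] unfolding cimage_def cfree_def
    by (metis augmented_simps(2) imageI)
qed

lemma aug_in_ideal:
  fixes F :: "'a free_complex"
  assumes F: "graded_free_resolution n I F" and b: "b < rnk F 0"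
  shows "aug F b \<in> I"
proof -
  define f where "f c = (if c = b then 1 else 0 :: 'a mpoly)" for c
  have "f \<in> free_mod n (rnk F 0)"
    using b by (auto simp: f_def free_mod_def in_poly_ring_iff monomials_def)
  moreover have "f c * aug F c = (if c = b then aug F c else 0)" for c by (simp add: f_def)
  then have "aug_map F f = aug F b"
    using b by (simp add: aug_map_def)
  moreover have "aug_map F ` free_mod n (rnk F 0) = I" using F by (simp add: graded_free_resolution_def)
  ultimately show ?thesis by (metis imageI)
qed

text \<open>Reduced modulo the variables the augmentation is zero, because the ideal contains no polynomial
with a constant term. Adjoining the ring therefore creates no new conditions on cycles.\<close>

lemma homology_k_augmented:
  assumes F: "graded_free_resolution n I F" and I: "\<And>p. p \<in> I \<Longrightarrow> lookup p 0 = 0"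
  shows "homology_k F i j = homology_k (augmented F) (Suc i) j"
proof -
  have T: "tensor_k (augmented F) (Suc i) j = tensor_k F i j" for i by (simp add: tensor_k_def)
  have D: "diff_k (augmented F) (Suc i) = diff_k F i" for i by (simp add: diff_k_def fun_eq_iff)
  have D0: "diff_k (augmented F) 0 v = (\<lambda>_. 0)" for v
    using I aug_in_ideal[OF F] by (auto simp: diff_k_def fun_eq_iff intro!: sum.neutral)
  have "cycles_k F i j = cycles_k (augmented F) (Suc i) j"
    using T D D0 by (cases i) (auto simp: cycles_k_def)
  then show ?thesis by (simp add: homology_k_def boundaries_k_def T D)
qed

theorem trivial_Tor_iff_koszul_exact:
  assumes F: "graded_free_resolution n I F" and I: "\<And>p. p \<in> I \<Longrightarrow> lookup p 0 = 0"
  shows "trivial_group (homology_k F i j) \<longleftrightarrow> kos.koszul_exact (ideal_module I) i j"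
proof -
  note C = exact_complex_augmented[OF F]
  have im: "cimage (augmented F) 0 = ideal_module I" using cimage_augmented[OF F] by (rule ext)
  have "trivial_group (homology_k F i j) \<longleftrightarrow>
      kos.koszul_pure (cimage (augmented F) i) (cfree (augmented F) i) 0 j"
    using trivial_homology_k_iff_pure[OF C, of i j] homology_k_augmented[OF F I, of i j] by simp
  also have "\<dots> \<longleftrightarrow> kos.koszul_exact (cimage (augmented F) 0) i j"
  proof (cases i)
    case 0
    have "kos.koszul_exact (cimage (augmented F) 0) 0 j \<longleftrightarrow>
        kos.koszul_pure (cimage (augmented F) 0) (cfree (augmented F) 0) 0 j"
    proof (rule kos.koszul_exact_0_iff_pure[OF graded_submodule_cfree])
      fix z assume z: "z \<in> cimage (augmented F) 0 j"
      then have const: "lookup (z b) 0 = 0" for b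
        unfolding im using I by (cases "b = 0") (auto simp: ideal_module_def)
      have "z \<in> cfree (augmented F) 0 j" using z cimage_subset[OF C] by blast
      from augmentation_ideal[OF this[unfolded cfree_def] const]
      obtain g where "\<And>v. v \<in> {1..n} \<Longrightarrow> g v \<in> cfree (augmented F) 0 (j - 1)" "(\<Sum>v\<in>{1..n}. vmul v (g v)) = z"
        unfolding cfree_def by blast
      then show "\<exists>g. (\<forall>v\<in>{1..n}. g v \<in> cfree (augmented F) 0 (j - 1)) \<and> (\<Sum>v\<in>{1..n}. vmul v (g v)) = z"
        by blast
    qed
    then show ?thesis using 0 by simp
  next
    case (Suc i')
    then show ?thesis using koszul_exact_cimage[OF C] by simp
  qed
  finally show ?thesis unfolding im .
qed

end

section \<open>Ideals generated by squarefree monomials\<close>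

subsection \<open>The Taylor resolution\<close>

definition squarefree_multiples :: "nat \<Rightarrow> nat set set \<Rightarrow> monomial set" where
  "squarefree_multiples n G = {m \<in> monomials n. \<exists>W\<in>G. W \<subseteq> keys m}"

definition squarefree_ideal :: "nat \<Rightarrow> nat set set \<Rightarrow> 'a::field mpoly set" where
  "squarefree_ideal n G = {p. keys p \<subseteq> squarefree_multiples n G}"

text \<open>The ideal is generated by the labels of the vertices. Its Taylor complex has one basis element for
each nonempty set of generators, in the degree of their least common multiple.\<close>

locale squarefree_generators = labelled_vertices V S for V S +
  fixes n :: nat
  assumes S_subset: "v \<in> V \<Longrightarrow> S v \<subseteq> {1..n}"
begin

definition rank :: "nat \<Rightarrow> nat" where
  "rank i = card {A. A \<subseteq> V \<and> card A = i}"

text \<open>The numbering of the basis elements in homological position \<open>i\<close> is arbitrary.\<close>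

definition face :: "nat \<Rightarrow> nat \<Rightarrow> nat set" where
  "face i = (SOME e. bij_betw e {..<rank i} {A. A \<subseteq> V \<and> card A = i})"

definition chain_of :: "nat \<Rightarrow> (nat \<Rightarrow> 'a::field mpoly) \<Rightarrow> nat set \<Rightarrow> 'a mpoly" where
  "chain_of i f A = (\<Sum>b<rank i. if A = face i b then f b else 0)"

text \<open>Matrix entries are coefficients of the boundaries of basis chains; signs and quotients of least
common multiples need not be written out again.\<close>

definition entry :: "nat \<Rightarrow> nat \<Rightarrow> nat \<Rightarrow> 'a::field mpoly" where
  "entry i b c = pbd (\<lambda>A. if A = face (Suc i) b then 1 else 0) (face i c)"

definition taylor :: "'a::field free_complex" where
  "taylor = \<lparr>rnk = (\<lambda>i. rank (Suc i)), gdeg = (\<lambda>i b. int (card (label (face (Suc i) b)))),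
     aug = (\<lambda>b. entry 0 b 0), mat = (\<lambda>i. entry (Suc i))\<rparr>"

lemma face_bij: "bij_betw (face i) {..<rank i} {A. A \<subseteq> V \<and> card A = i}"
proof -
  have "finite {A. A \<subseteq> V \<and> card A = i}"
    by (rule finite_subset[of _ "Pow V"]) (use finite_V in auto)
  then have "\<exists>e. bij_betw e {..<rank i} {A. A \<subseteq> V \<and> card A = i}"
    using ex_bij_betw_nat_finite unfolding rank_def atLeast0LessThan by blast
  then show ?thesis unfolding face_def by (rule someI_ex)
qed

lemma faceD:
  assumes "b < rank i"
  shows "face i b \<subseteq> V" "card (face i b) = i"
  using bij_betwE[OF face_bij, of i] assms by auto

lemma face_surj:
  assumes "A \<subseteq> V" "card A = i"
  obtains b where "b < rank i" "A = face i b"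
  using assms face_bij[of i] unfolding bij_betw_def by (metis (mono_tags, lifting) imageE lessThan_iff mem_Collect_eq)

lemma face_eq_iff: "b < rank i \<Longrightarrow> c < rank i \<Longrightarrow> face i b = face i c \<longleftrightarrow> b = c"
  using face_bij[of i] unfolding bij_betw_def inj_on_def by auto

lemma rank_0: "rank 0 = 1"
proof -
  have "{A. A \<subseteq> V \<and> card A = 0} = {{}}" using finite_V finite_subset by fastforce
  then show ?thesis by (simp add: rank_def)
qed

lemma face_0: "face 0 0 = {}"
  using faceD[of 0 0] rank_0 finite_V finite_subset by fastforce

lemma chain_of_face: "b < rank i \<Longrightarrow> chain_of i f (face i b) = f b"
proof -
  assume b: "b < rank i"
  have "chain_of i f (face i b) = (\<Sum>c<rank i. if c = b then f c else 0)"
    unfolding chain_of_def by (rule sum.cong) (use face_eq_iff b in auto)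
  then show ?thesis using b by simp
qed

lemma chain_of_outside: "\<not> (A \<subseteq> V \<and> card A = i) \<Longrightarrow> chain_of i f A = 0"
  unfolding chain_of_def using faceD by (intro sum.neutral) auto

lemma chain_of_restrict:
  assumes "\<And>A. w A \<noteq> 0 \<Longrightarrow> A \<subseteq> V \<and> card A = i"
  shows "chain_of i (\<lambda>b. if b < rank i then w (face i b) else 0) = w"
proof
  fix A
  show "chain_of i (\<lambda>b. if b < rank i then w (face i b) else 0) A = w A"
  proof (cases "A \<subseteq> V \<and> card A = i")
    case True
    then obtain b where "b < rank i" "A = face i b" using face_surj by blast
    then show ?thesis by (simp add: chain_of_face)
  next
    case False
    then show ?thesis using assms[of A] chain_of_outside by metis
  qed
qed

lemma sum_entry:
  "(\<Sum>b<rank (Suc i). f b * entry i b c) = pbd (chain_of (Suc i) f) (face i c)"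
proof -
  let ?A = "face i c"
  let ?e = "\<lambda>v. mon_poly (sqf (S v - label ?A)) :: 'a mpoly"
  have tm: "f b * signed v ?A (?e v * (if P then 1 else 0)) = signed v ?A (?e v * (if P then f b else 0))"
    for v b P by (cases P) (simp_all add: signed_def)
  have "(\<Sum>b<rank (Suc i). f b * entry i b c) =
      (\<Sum>b<rank (Suc i). \<Sum>v\<in>V - ?A. signed v ?A (?e v * (if insert v ?A = face (Suc i) b then f b else 0)))"
    unfolding entry_def pbd_def bd_def sum_distrib_left tm ..
  also have "\<dots> = (\<Sum>v\<in>V - ?A. \<Sum>b<rank (Suc i). signed v ?A (?e v * (if insert v ?A = face (Suc i) b then f b else 0)))"
    by (rule sum.swap)
  also have "\<dots> = pbd (chain_of (Suc i) f) ?A"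
    unfolding pbd_def bd_def chain_of_def sum_distrib_left signed_sum ..
  finally show ?thesis .
qed

lemma label_subset: "A \<subseteq> V \<Longrightarrow> label A \<subseteq> {1..n}"
  using S_subset by (auto simp: label_def)

lemma mon_poly_label_diff:
  assumes v: "v \<in> V" and A: "A \<subseteq> V"
  shows "(mon_poly (sqf (S v - label A)) :: 'a::field mpoly) \<in> carrier (poly_ring n)"
    and "homogeneous (int (card (label (insert v A))) - int (card (label A)))
      (mon_poly (sqf (S v - label A)) :: 'a mpoly)"
proof -
  have fin: "finite (S v - label A)" "finite (label A)" using v A finite_S finite_label by auto
  have "sqf (S v - label A) \<in> monomials n"
    using S_subset[OF v] fin by (auto simp: monomials_def keys_sqf)
  then show "(mon_poly (sqf (S v - label A)) :: 'a mpoly) \<in> carrier (poly_ring n)"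
    by (rule poly_ring_closed(5))
  have "label (insert v A) = (S v - label A) \<union> label A" by (auto simp: label_def)
  then have "card (label (insert v A)) = card (S v - label A) + card (label A)"
    using fin card_Un_disjoint[of "S v - label A" "label A"] by auto
  then show "homogeneous (int (card (label (insert v A))) - int (card (label A)))
      (mon_poly (sqf (S v - label A)) :: 'a mpoly)"
    using fin by (intro homogeneous_single) (simp add: mon_degree_sqf)
qed

lemma entry_graded:
  assumes b: "b < rank (Suc i)" and c: "c < rank i"
  shows "(entry i b c :: 'a::field mpoly) \<in> carrier (poly_ring n)"
    and "homogeneous (int (card (label (face (Suc i) b))) - int (card (label (face i c)))) (entry i b c :: 'a mpoly)"
proof -
  let ?A = "face i c" and ?B = "face (Suc i) b"
  let ?t = "\<lambda>v. signed v ?A (mon_poly (sqf (S v - label ?A)) * (if insert v ?A = ?B then 1 else 0)) :: 'a mpoly"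
  have t: "?t v \<in> carrier (poly_ring n) \<and> homogeneous (int (card (label ?B)) - int (card (label ?A))) (?t v)"
    if v: "v \<in> V - ?A" for v
  proof (cases "insert v ?A = ?B")
    case True
    have "v \<in> V" using v by blast
    note M = mon_poly_label_diff[OF this faceD(1)[OF c], where 'a = 'a]
    have "keys (?t v) = keys (mon_poly (sqf (S v - label ?A)) :: 'a mpoly)"
      using True by (simp add: keys_signed)
    then show ?thesis using M True by (simp add: in_poly_ring_iff homogeneous_def)
  next
    case False
    then show ?thesis by (simp add: poly_ring_closed)
  qed
  show "(entry i b c :: 'a mpoly) \<in> carrier (poly_ring n)"
    unfolding entry_def pbd_def bd_def by (rule poly_ring_sum_closed) (use t in blast)
  show "homogeneous (int (card (label ?B)) - int (card (label ?A))) (entry i b c :: 'a mpoly)"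
    unfolding entry_def pbd_def bd_def by (rule homogeneous_sum) (use t in blast)
qed

lemma pbd_pbd: "pbd (pbd w) A = (0 :: 'a::field mpoly)"
  unfolding pbd_def
proof (rule bd_bd)
  fix v w A and y :: "'a mpoly"
  assume vw: "v \<in> V - A" "w \<in> V - A"
  have sum: "sqf (S v - label A) + sqf (S w - label (insert v A)) = sqf (S v \<union> S w - label A)"
    if "v \<in> V" "w \<in> V" for v w
  proof -
    have "S v \<union> S w - label A = (S v - label A) \<union> (S w - label (insert v A))" by (auto simp: label_def)
    then show ?thesis using finite_S that by (auto simp: label_def intro!: sqf_Un[symmetric])
  qed
  have "sqf (S v - label A) + sqf (S w - label (insert v A)) = sqf (S w - label A) + sqf (S v - label (insert w A))"
    using sum[of v w] sum[of w v] vw by (simp add: Un_commute)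
  then show "mon_poly (sqf (S v - label A)) * (mon_poly (sqf (S w - label (insert v A))) * y) =
      mon_poly (sqf (S w - label A)) * (mon_poly (sqf (S v - label (insert w A))) * y)"
    by (simp add: mult.assoc[symmetric] mult_single)
qed (simp_all add: finite_V distrib_left)

lemma pbd_support:
  assumes "\<And>A. w A \<noteq> 0 \<Longrightarrow> A \<subseteq> V \<and> card A = Suc i" and "pbd w A \<noteq> 0"
  shows "A \<subseteq> V \<and> card A = i"
proof -
  have "\<exists>v\<in>V - A. w (insert v A) \<noteq> 0"
  proof (rule ccontr)
    assume "\<not> ?thesis"
    then have "pbd w A = 0" unfolding pbd_def bd_def by (intro sum.neutral) auto
    then show False using assms(2) by simp
  qed
  then obtain v where v: "v \<in> V - A" "insert v A \<subseteq> V" "card (insert v A) = Suc i" using assms(1) by blast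
  moreover have "finite A" using v(2) finite_V finite_subset by (metis finite_insert)
  ultimately show ?thesis by simp
qed

text \<open>In a multidegree \<open>u\<close> of the ideal these are all sets of generators that divide \<open>u\<close>, including the
empty set. Discarding the empty set in the remaining multidegrees makes the complex exact at
\<open>p = 0\<close> as well, and this describes the image of the augmentation.\<close>

definition generator_faces :: "monomial \<Rightarrow> nat set set" where
  "generator_faces u = {A. A \<subseteq> {v \<in> V. S v \<subseteq> keys u} \<and>
     u \<in> squarefree_multiples n (S ` V)}"

lemma face_family_generator_faces: "face_family generator_faces"
  unfolding face_family_def down_closed_def generator_faces_def label_def by blast

text \<open>Any generator that divides \<open>u\<close> is the apex of a cone.\<close>

lemma pexact_generator_faces: "pexact TYPE('a::field) generator_faces p J"
  unfolding pexact_iff[OF face_family_generator_faces]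
proof (intro allI impI)
  fix u
  show "exact_at TYPE('a) V (generator_faces u) p"
  proof (cases "u \<in> squarefree_multiples n (S ` V)")
    case True
    then obtain v where v: "v \<in> V" "S v \<subseteq> keys u" by (auto simp: squarefree_multiples_def)
    show ?thesis
      by (rule exact_at_cone[where v = v]) (use v finite_V in \<open>auto simp: generator_faces_def\<close>)
  next
    case False
    then show ?thesis by (intro exact_at_no_faces) (simp add: generator_faces_def)
  qed
qed

lemma in_generator_faces:
  assumes A: "A \<subseteq> V" "A \<noteq> {}" and m: "m \<in> monomials n"
  shows "A \<in> generator_faces (m + lmon A)"
proof -
  have keys: "keys (m + lmon A) = keys m \<union> label A"
    using finite_label[OF A(1)] by (simp add: keys_add_monomial keys_sqf)
  have S: "S v \<subseteq> label A" if "v \<in> A" for v using that by (auto simp: label_def)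
  have "m + lmon A \<in> monomials n"
    using m label_subset[OF A(1)] keys by (simp add: monomials_def)
  moreover obtain v where "v \<in> A" "v \<in> V" using A by blast
  ultimately have "m + lmon A \<in> squarefree_multiples n (S ` V)"
    using S keys by (auto simp: squarefree_multiples_def)
  then show ?thesis using A(1) S keys by (auto simp: generator_faces_def)
qed

lemma keys_of_pchain:
  assumes "pchain generator_faces p J w" "m \<in> keys (w A)"
  shows "m \<in> monomials n"
proof -
  have "A \<in> generator_faces (m + lmon A)" using assms unfolding pchain_def by blast
  then have "keys (m + lmon A) \<subseteq> {1..n}"
    by (simp add: generator_faces_def squarefree_multiples_def monomials_def)
  then show ?thesis by (simp add: monomials_def keys_add_monomial)
qed

lemma pchain_support:
  assumes "pchain generator_faces p J w" "w A \<noteq> 0"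
  shows "A \<subseteq> V \<and> card A = p"
proof -
  obtain m where "m \<in> keys (w A)" using assms(2) by (metis ex_in_conv keys_eq_empty)
  then have "A \<in> generator_faces (m + lmon A)" "card A = p" using assms(1) unfolding pchain_def by blast+
  then show ?thesis by (auto simp: generator_faces_def)
qed

lemma pchain_chain_of:
  assumes f: "f \<in> free_mod n (rank (Suc i))"
  shows "pchain generator_faces (Suc i) UNIV (chain_of (Suc i) f)"
  unfolding pchain_def
proof (intro allI ballI)
  fix A m assume m: "m \<in> keys (chain_of (Suc i) f A)"
  then have "chain_of (Suc i) f A \<noteq> 0" by auto
  then have A: "A \<subseteq> V" "card A = Suc i" using chain_of_outside by blast+
  then obtain b where b: "b < rank (Suc i)" "A = face (Suc i) b" by (rule face_surj)
  then have "m \<in> keys (f b)" using m by (simp add: chain_of_face)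
  then have "m \<in> monomials n" using f b by (auto simp: free_mod_def in_poly_ring_iff)
  moreover have "A \<noteq> {}" using A by auto
  ultimately show "A \<in> generator_faces (m + lmon A) \<and> card A = Suc i \<and> int (mon_degree (m + lmon A)) \<in> UNIV"
    using A in_generator_faces by simp
qed

lemma chain_lift:
  assumes w: "pchain generator_faces p UNIV w" and cyc: "\<And>A. pbd w A = 0"
  obtains f where "f \<in> free_mod n (rank (Suc p))" "pbd (chain_of (Suc p) f) = w"
proof -
  obtain w' where w': "pchain generator_faces (Suc p) UNIV w'" "\<And>A. pbd w' A = w A"
    using pexact_generator_faces w cyc unfolding pexact_def by blast
  define f where "f b = (if b < rank (Suc p) then w' (face (Suc p) b) else 0)" for b
  have "chain_of (Suc p) f = w'"
    unfolding f_def by (rule chain_of_restrict) (use pchain_support[OF w'(1)] in blast)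
  moreover have "pbd w' = w" using w'(2) by (rule ext)
  ultimately have "pbd (chain_of (Suc p) f) = w" by simp
  moreover have "f \<in> free_mod n (rank (Suc p))"
    using keys_of_pchain[OF w'(1)] by (auto simp: f_def free_mod_def in_poly_ring_iff)
  ultimately show ?thesis using that by blast
qed

lemma diff_map_taylor:
  assumes "c < rank (Suc i)"
  shows "diff_map taylor i f c = pbd (chain_of (Suc (Suc i)) f) (face (Suc i) c)"
  using assms by (simp add: diff_map_def taylor_def sum_entry)

lemma aug_map_taylor: "aug_map taylor f = pbd (chain_of 1 f) {}"
  using sum_entry[of f 0 0] by (simp add: aug_map_def taylor_def face_0 One_nat_def)

lemma chain_of_diff_map: "chain_of (Suc i) (diff_map taylor i f) = pbd (chain_of (Suc (Suc i)) f)"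
proof -
  have "diff_map taylor i f = (\<lambda>b. if b < rank (Suc i) then pbd (chain_of (Suc (Suc i)) f) (face (Suc i) b) else 0)"
    using diff_map_taylor by (auto simp: fun_eq_iff) (simp add: diff_map_def taylor_def)
  moreover have "chain_of (Suc i) (\<lambda>b. if b < rank (Suc i) then pbd (chain_of (Suc (Suc i)) f) (face (Suc i) b) else 0) =
      pbd (chain_of (Suc (Suc i)) f)"
  proof (rule chain_of_restrict)
    fix A assume "pbd (chain_of (Suc (Suc i)) f) A \<noteq> 0"
    then show "A \<subseteq> V \<and> card A = Suc i" using pbd_support[of "chain_of (Suc (Suc i)) f"] chain_of_outside by blast
  qed
  ultimately show ?thesis by simp
qed

lemma chain_of_inject:
  assumes "f \<in> free_mod n (rank i)" "g \<in> free_mod n (rank i)" "chain_of i f = chain_of i g"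
  shows "f = g"
proof
  fix b
  show "f b = g b"
  proof (cases "b < rank i")
    case True
    then show ?thesis using assms(3) chain_of_face by metis
  next
    case False
    then show ?thesis using assms(1,2) by (simp add: free_mod_def)
  qed
qed

lemma chain_of_0: "chain_of i (\<lambda>_. 0) = (\<lambda>_. 0)"
  by (simp add: chain_of_def fun_eq_iff)

lemma zero_in_free_mod: "(\<lambda>_. 0) \<in> free_mod n r"
  by (simp add: free_mod_def poly_ring_closed)

lemma diff_map_taylor_closed:
  assumes "f \<in> free_mod n (rank (Suc (Suc i)))"
  shows "diff_map taylor i f \<in> free_mod n (rank (Suc i))"
proof -
  have "diff_map taylor i f c \<in> carrier (poly_ring n)" if "c < rank (Suc i)" for c
    using that assms entry_graded(1)[of _ "Suc i" c]
    by (auto simp: diff_map_def taylor_def free_mod_def intro!: poly_ring_sum_closed poly_ring_closed)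
  then show ?thesis by (simp add: free_mod_def) (simp add: diff_map_def taylor_def)
qed

lemma diff_map_eq_0_iff:
  assumes "f \<in> free_mod n (rank (Suc (Suc i)))"
  shows "diff_map taylor i f = (\<lambda>_. 0) \<longleftrightarrow> pbd (chain_of (Suc (Suc i)) f) = (\<lambda>_. 0)"
proof
  assume "diff_map taylor i f = (\<lambda>_. 0)"
  then show "pbd (chain_of (Suc (Suc i)) f) = (\<lambda>_. 0)"
    by (simp add: chain_of_0 flip: chain_of_diff_map)
next
  assume "pbd (chain_of (Suc (Suc i)) f) = (\<lambda>_. 0)"
  then show "diff_map taylor i f = (\<lambda>_. 0)"
    using chain_of_inject[OF diff_map_taylor_closed[OF assms] zero_in_free_mod]
    by (simp add: chain_of_diff_map chain_of_0)
qed

lemma cycles_are_boundaries: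
  assumes f: "f \<in> free_mod n (rank (Suc i))" and cyc: "pbd (chain_of (Suc i) f) = (\<lambda>_. 0)"
  shows "f \<in> diff_map taylor i ` free_mod n (rank (Suc (Suc i)))"
proof -
  obtain g where g: "g \<in> free_mod n (rank (Suc (Suc i)))" "pbd (chain_of (Suc (Suc i)) g) = chain_of (Suc i) f"
    using chain_lift[OF pchain_chain_of[OF f]] cyc by (auto simp: fun_eq_iff)
  have "diff_map taylor i g = f"
    by (rule chain_of_inject[OF diff_map_taylor_closed[OF g(1)] f]) (simp add: chain_of_diff_map g(2))
  then show ?thesis using g(1) by blast
qed

lemma pbd_chain_of_diff_map: "pbd (chain_of (Suc i) (diff_map taylor i f)) = (\<lambda>_. 0)"
  unfolding chain_of_diff_map by (rule ext) (rule pbd_pbd)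

lemma aug_image: "aug_map taylor ` free_mod n (rank (Suc 0)) = (squarefree_ideal n (S ` V) :: 'a::field mpoly set)"
proof (intro equalityI subsetI)
  fix p :: "'a mpoly" assume "p \<in> aug_map taylor ` free_mod n (rank (Suc 0))"
  then obtain f where f: "f \<in> free_mod n (rank (Suc 0))" "p = pbd (chain_of (Suc 0) f) {}"
    by (auto simp: aug_map_taylor One_nat_def)
  have lab: "label {} = {}" by (simp add: label_def)
  have "keys (signed v {} (mon_poly (sqf (S v)) * chain_of (Suc 0) f {v})) \<subseteq> squarefree_multiples n (S ` V)"
    if v: "v \<in> V" for v
  proof
    fix m assume "m \<in> keys (signed v {} (mon_poly (sqf (S v)) * chain_of (Suc 0) f {v}))"
    then obtain m' where m': "m = sqf (S v) + m'" "m' \<in> keys (chain_of (Suc 0) f {v})"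
      by (auto simp: keys_signed keys_single_times)
    have "m' \<in> monomials n" by (rule keys_of_pchain[OF pchain_chain_of[OF f(1)] m'(2)])
    then show "m \<in> squarefree_multiples n (S ` V)"
      using v S_subset[OF v] finite_S[OF v] m'(1)
      by (auto simp: squarefree_multiples_def monomials_def keys_add_monomial keys_sqf)
  qed
  moreover have "p = (\<Sum>v\<in>V. signed v {} (mon_poly (sqf (S v)) * chain_of (Suc 0) f {v}))"
    by (simp add: f(2) pbd_def bd_def lab)
  ultimately show "p \<in> squarefree_ideal n (S ` V)"
    unfolding squarefree_ideal_def using keys_sum[of "\<lambda>v. signed v {} (mon_poly (sqf (S v)) * chain_of (Suc 0) f {v})" V]
    by blast
next
  fix p :: "'a mpoly" assume p: "p \<in> squarefree_ideal n (S ` V)"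
  define w where "w A = (if A = {} then p else 0)" for A :: "nat set"
  have "pchain generator_faces 0 UNIV w"
    unfolding pchain_def
  proof (intro allI ballI)
    fix A m assume "m \<in> keys (w A)"
    then have "A = {}" "m \<in> keys p" by (auto simp: w_def split: if_splits)
    moreover have "m \<in> squarefree_multiples n (S ` V)" using calculation p by (auto simp: squarefree_ideal_def)
    moreover have "label {} = {}" by (simp add: label_def)
    ultimately show "A \<in> generator_faces (m + lmon A) \<and> card A = 0 \<and> int (mon_degree (m + lmon A)) \<in> UNIV"
      by (simp add: generator_faces_def)
  qed
  moreover have "pbd w A = 0" for A unfolding pbd_def bd_def w_def by (intro sum.neutral) auto
  ultimately obtain f where f: "f \<in> free_mod n (rank (Suc 0))" "pbd (chain_of (Suc 0) f) = w"
    using chain_lift by blast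
  then have "aug_map taylor f = p" by (simp add: aug_map_taylor One_nat_def w_def)
  then show "p \<in> aug_map taylor ` free_mod n (rank (Suc 0))" using f(1) by blast
qed

text \<open>The differentials are the boundary operator on chains with \<open>i + 2\<close> vertices, the augmentation is
the one on chains with a single vertex, and both are exact because their strands are cones.\<close>

theorem taylor_resolution:
  "graded_free_resolution n (squarefree_ideal n (S ` V) :: 'a::field mpoly set) taylor"
  unfolding graded_free_resolution_def
proof (intro conjI allI impI)
  have rnk: "rnk taylor i = rank (Suc i)" for i by (simp add: taylor_def)
  show "aug_map taylor ` free_mod n (rnk taylor 0) = (squarefree_ideal n (S ` V) :: 'a mpoly set)"
    unfolding rnk by (rule aug_image)
  show "{f \<in> free_mod n (rnk taylor 0). aug_map taylor f = (0 :: 'a mpoly)} =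
      diff_map taylor 0 ` free_mod n (rnk taylor 1)"
  proof (intro equalityI subsetI)
    fix f assume "f \<in> {f \<in> free_mod n (rnk taylor 0). aug_map taylor f = (0 :: 'a mpoly)}"
    then have f: "f \<in> free_mod n (rank (Suc 0))" "pbd (chain_of (Suc 0) f) {} = 0"
      by (auto simp: rnk aug_map_taylor One_nat_def)
    have "pbd (chain_of (Suc 0) f) A = 0" for A
    proof (rule ccontr)
      assume nz: "pbd (chain_of (Suc 0) f) A \<noteq> 0"
      then have "A \<subseteq> V \<and> card A = 0" using pbd_support[of "chain_of (Suc 0) f" 0] chain_of_outside by blast
      then have "A = {}" using finite_V finite_subset by fastforce
      then show False using f(2) nz by simp
    qed
    then show "f \<in> diff_map taylor 0 ` free_mod n (rnk taylor 1)"
      using cycles_are_boundaries[OF f(1)] by (simp add: rnk One_nat_def fun_eq_iff)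
  next
    fix f :: "nat \<Rightarrow> 'a mpoly" assume "f \<in> diff_map taylor 0 ` free_mod n (rnk taylor 1)"
    then obtain g where g: "g \<in> free_mod n (rank (Suc (Suc 0)))" "f = diff_map taylor 0 g"
      by (auto simp: rnk One_nat_def)
    then show "f \<in> {f \<in> free_mod n (rnk taylor 0). aug_map taylor f = 0}"
      using diff_map_taylor_closed[OF g(1)] pbd_chain_of_diff_map[of 0 g]
      by (simp add: rnk aug_map_taylor One_nat_def)
  qed
  show "{f \<in> free_mod n (rnk taylor (Suc i)). diff_map taylor i f = (\<lambda>_. 0 :: 'a mpoly)} =
      diff_map taylor (Suc i) ` free_mod n (rnk taylor (Suc (Suc i)))" for i
  proof (intro equalityI subsetI)
    fix f assume "f \<in> {f \<in> free_mod n (rnk taylor (Suc i)). diff_map taylor i f = (\<lambda>_. 0 :: 'a mpoly)}"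
    then have f: "f \<in> free_mod n (rank (Suc (Suc i)))" "diff_map taylor i f = (\<lambda>_. 0)" by (auto simp: rnk)
    then show "f \<in> diff_map taylor (Suc i) ` free_mod n (rnk taylor (Suc (Suc i)))"
      using cycles_are_boundaries[OF f(1)] diff_map_eq_0_iff[OF f(1)] by (simp add: rnk)
  next
    fix f :: "nat \<Rightarrow> 'a mpoly" assume "f \<in> diff_map taylor (Suc i) ` free_mod n (rnk taylor (Suc (Suc i)))"
    then obtain g where g: "g \<in> free_mod n (rank (Suc (Suc (Suc i))))" "f = diff_map taylor (Suc i) g"
      by (auto simp: rnk)
    then show "f \<in> {f \<in> free_mod n (rnk taylor (Suc i)). diff_map taylor i f = (\<lambda>_. 0)}"
      using diff_map_taylor_closed[OF g(1)] diff_map_eq_0_iff[OF diff_map_taylor_closed[OF g(1)]]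
        pbd_chain_of_diff_map[of "Suc i" g] by (simp add: rnk)
  qed
  fix i b c
  have "label {} = {}" by (simp add: label_def)
  then show "b < rnk taylor 0 \<Longrightarrow> (aug taylor b :: 'a mpoly) \<in> carrier (poly_ring n)"
    "b < rnk taylor 0 \<Longrightarrow> homogeneous (gdeg taylor 0 b) (aug taylor b :: 'a mpoly)"
    using entry_graded[of b 0 0, where 'a = 'a] by (simp_all add: taylor_def rank_0 face_0)
  show "b < rnk taylor (Suc i) \<Longrightarrow> c < rnk taylor i \<Longrightarrow> (mat taylor i b c :: 'a mpoly) \<in> carrier (poly_ring n)"
    "b < rnk taylor (Suc i) \<Longrightarrow> c < rnk taylor i \<Longrightarrow>
      homogeneous (gdeg taylor (Suc i) b - gdeg taylor i c) (mat taylor i b c :: 'a mpoly)"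
    using entry_graded[of b "Suc i" c, where 'a = 'a] by (simp_all add: taylor_def)
qed

end

lemma graded_free_resolution_squarefree_ideal:
  assumes "G \<subseteq> Pow {1..n}"
  shows "\<exists>F. graded_free_resolution n (squarefree_ideal n G :: 'a::field mpoly set) F"
proof -
  have "finite G" using assms finite_subset by blast
  then obtain S where S: "bij_betw S {..<card G} G"
    using ex_bij_betw_nat_finite unfolding atLeast0LessThan by blast
  then have im: "S ` {..<card G} = G" by (simp add: bij_betw_def)
  interpret squarefree_generators "{..<card G}" S n
  proof
    show "S v \<subseteq> {1..n}" if "v \<in> {..<card G}" for v using that im assms by blast
    then show "finite (S v)" if "v \<in> {..<card G}" for v using that finite_subset by blast
  qed simp
  show ?thesis using taylor_resolution[where 'a = 'a] unfolding im by blast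
qed

subsection \<open>Generators and Tor\<close>

lemma finite_generator:
  assumes "G \<subseteq> Pow {1..n}" "W \<in> G"
  shows "finite W" "sqf W \<in> monomials n"
proof -
  show "finite W" using assms finite_subset by blast
  then show "sqf W \<in> monomials n" using assms by (auto simp: monomials_def keys_sqf)
qed

lemma squarefree_multiples_add:
  "m \<in> squarefree_multiples n G \<Longrightarrow> m' \<in> monomials n \<Longrightarrow> m + m' \<in> squarefree_multiples n G"
  by (auto simp: squarefree_multiples_def monomials_add keys_add_monomial)

lemma squarefree_ideal_eq_genideal:
  assumes G: "G \<subseteq> Pow {1..n}"
  shows "(squarefree_ideal n G :: 'a::field mpoly set) = Idl\<^bsub>poly_ring n\<^esub> (mon_poly ` sqf ` G)"
proof -
  let ?R = "poly_ring n :: 'a mpoly ring" and ?I = "squarefree_ideal n G :: 'a mpoly set"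
  interpret R: cring ?R by (rule cring_poly_ring)
  have ops: "(\<oplus>\<^bsub>?R\<^esub>) = (+)" "(\<otimes>\<^bsub>?R\<^esub>) = (*)" "\<zero>\<^bsub>?R\<^esub> = 0" by (simp_all add: poly_ring_def)
  note fin = finite_generator[OF G]
  have sub: "?I \<subseteq> carrier ?R" by (auto simp: squarefree_ideal_def squarefree_multiples_def in_poly_ring_iff)
  have mult: "p * q \<in> ?I" if "p \<in> ?I" "q \<in> carrier ?R" for p q
  proof -
    have "m + m' \<in> squarefree_multiples n G"
      if "m \<in> keys p" "m' \<in> keys q" for m m'
      using \<open>p \<in> ?I\<close> \<open>q \<in> carrier ?R\<close> that
      by (intro squarefree_multiples_add) (auto simp: squarefree_ideal_def in_poly_ring_iff)
    then show ?thesis unfolding squarefree_ideal_def mem_Collect_eq by (rule keys_times_subset)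
  qed
  have ideal: "ideal ?I ?R"
  proof (rule idealI)
    show "ring ?R" by (rule R.ring_axioms)
    show "subgroup ?I (add_monoid ?R)"
    proof (rule group.subgroupI)
      show "Group.group (add_monoid ?R)" by (rule R.a_group)
      show "?I \<subseteq> carrier (add_monoid ?R)" using sub by simp
      show "?I \<noteq> {}" by (auto simp: squarefree_ideal_def intro: exI[of _ 0])
      fix p assume p: "p \<in> ?I"
      have "- p \<in> ?I" using p by (simp add: squarefree_ideal_def)
      moreover have "\<ominus>\<^bsub>?R\<^esub> p = - p"
        by (rule R.minus_equality) (use p calculation sub in \<open>auto simp: ops\<close>)
      ultimately show "inv\<^bsub>add_monoid ?R\<^esub> p \<in> ?I" by (simp add: a_inv_def)
      fix q assume "q \<in> ?I"
      then show "p \<otimes>\<^bsub>add_monoid ?R\<^esub> q \<in> ?I"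
        using p keys_add[of p q] by (auto simp: ops squarefree_ideal_def)
    qed
    fix p q assume "p \<in> ?I" "q \<in> carrier ?R"
    then show "q \<otimes>\<^bsub>?R\<^esub> p \<in> ?I" "p \<otimes>\<^bsub>?R\<^esub> q \<in> ?I" using mult by (simp_all add: ops mult.commute)
  qed
  have gens: "mon_poly ` sqf ` G \<subseteq> ?I"
    using fin by (auto simp: squarefree_ideal_def squarefree_multiples_def keys_sqf)
  have least: "?I \<subseteq> J" if J: "ideal J ?R" "mon_poly ` sqf ` G \<subseteq> J" for J
  proof
    interpret J: ideal J ?R by fact
    fix p assume p: "p \<in> ?I"
    have single_in: "single m c \<in> J" if m: "m \<in> keys p" for m c
    proof -
      have "m \<in> squarefree_multiples n G" using p m by (auto simp: squarefree_ideal_def)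
      then obtain W where W: "W \<in> G" "W \<subseteq> keys m" "m \<in> monomials n"
        by (auto simp: squarefree_multiples_def)
      then obtain m' where m': "m = m' + sqf W" using sqf_adds_iff[OF fin(1)] by blast
      then have "m' \<in> monomials n" using W(3) by (simp add: monomials_def keys_add_monomial)
      then have "single m' c \<in> carrier ?R" by (rule poly_ring_closed(5))
      moreover have "mon_poly (sqf W) \<in> J" using J(2) W(1) by blast
      ultimately have "single m' c \<otimes>\<^bsub>?R\<^esub> mon_poly (sqf W) \<in> J" by (intro J.I_l_closed)
      then show ?thesis by (simp add: ops mult_single m')
    qed
    have "(\<Sum>m\<in>K. single m (lookup p m)) \<in> J"
      if "finite K" "K \<subseteq> keys p" for K
      using that
    proof (induction K rule: finite_induct)
      case empty
      then show ?case using J.zero_closed by (simp add: ops)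
    next
      case (insert m K)
      then have "single m (lookup p m) \<oplus>\<^bsub>?R\<^esub>
          (\<Sum>m\<in>K. single m (lookup p m)) \<in> J"
        by (intro J.a_closed single_in) auto
      then show ?case using insert.hyps by (simp add: ops)
    qed
    moreover have "(\<Sum>m\<in>keys p. single m (lookup p m)) = p"
      by (rule poly_mapping_eqI) (simp add: lookup_sum lookup_single when_def in_keys_iff)
    ultimately show "p \<in> J" by (metis finite_keys order_refl)
  qed
  show ?thesis unfolding genideal_def using ideal gens least by blast
qed

lemma squarefree_monomial_ideal_squarefree_ideal:
  assumes G: "G \<subseteq> Pow {1..n}" and card: "\<And>W. W \<in> G \<Longrightarrow> card W = d"
  shows "squarefree_monomial_ideal_gen_in_degree n d (squarefree_ideal n G :: 'a::field mpoly set)"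
proof -
  note fin = finite_generator[OF G]
  have "monomial_ideal n (squarefree_ideal n G :: 'a mpoly set)"
    unfolding monomial_ideal_def using squarefree_ideal_eq_genideal[OF G, where 'a = 'a] fin
    by (intro exI[of _ "sqf ` G"]) auto
  moreover have "squarefree_mon m \<and> mon_degree m = d"
    if "m \<in> minimal_gens n (squarefree_ideal n G :: 'a mpoly set)" for m
  proof -
    have m: "(mon_poly m :: 'a mpoly) \<in> squarefree_ideal n G"
      and min: "\<And>m'. m' \<in> monomials n \<Longrightarrow> (mon_poly m' :: 'a mpoly) \<in> squarefree_ideal n G \<Longrightarrow>
        (\<forall>i. lookup m' i \<le> lookup m i) \<Longrightarrow> m' = m"
      using that unfolding minimal_gens_def by blast+
    obtain W where W: "W \<in> G" "W \<subseteq> keys m"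
      using m by (auto simp: squarefree_ideal_def squarefree_multiples_def)
    note f = fin[OF W(1)]
    have "(mon_poly (sqf W) :: 'a mpoly) \<in> squarefree_ideal n G"
      using f W by (auto simp: squarefree_ideal_def squarefree_multiples_def keys_sqf)
    moreover have "\<forall>i. lookup (sqf W) i \<le> lookup m i"
      using W(2) f(1) by (auto simp: lookup_sqf in_keys_iff)
    ultimately have "sqf W = m" using min f(2) by blast
    then show ?thesis using f(1) card[OF W(1)] by (auto simp: squarefree_mon_def lookup_sqf mon_degree_sqf)
  qed
  ultimately show ?thesis by (simp add: squarefree_monomial_ideal_gen_in_degree_def)
qed

context polynomial_setting
begin

lemma monomial_closed_squarefree_multiples: "monomial_closed (squarefree_multiples n G)"
  by (auto simp: monomial_closed_def squarefree_multiples_def monomials_add keys_add_monomial)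

lemma ideal_module_squarefree_ideal:
  "ideal_module (squarefree_ideal n G) = monomial_submodule (squarefree_multiples n G) 1 (\<lambda>_. 0)"
proof (rule ext, rule Set.set_eqI)
  fix j f
  have N: "squarefree_multiples n G \<subseteq> monomials n" by (auto simp: squarefree_multiples_def)
  note defs = ideal_module_def squarefree_ideal_def monomial_submodule_def graded_free_def free_mod_def
    in_poly_ring_iff
  show "f \<in> ideal_module (squarefree_ideal n G) j \<longleftrightarrow>
      f \<in> monomial_submodule (squarefree_multiples n G) 1 (\<lambda>_. 0) j"
  proof
    assume f: "f \<in> ideal_module (squarefree_ideal n G) j"
    then have "keys (f b) \<subseteq> squarefree_multiples n G \<and> homogeneous j (f b)" for b
      by (cases "b = 0") (auto simp: defs)
    then show "f \<in> monomial_submodule (squarefree_multiples n G) 1 (\<lambda>_. 0) j"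
      using f N by (auto simp: defs One_nat_def)
  next
    assume "f \<in> monomial_submodule (squarefree_multiples n G) 1 (\<lambda>_. 0) j"
    then show "f \<in> ideal_module (squarefree_ideal n G) j"
      by (auto simp: defs One_nat_def Suc_le_eq dest: spec[of _ 0])
  qed
qed

text \<open>A form of Hochster's formula, with the upper Koszul complexes of the ideal.\<close>

theorem trivial_Tor_squarefree_ideal_iff:
  assumes G: "G \<subseteq> Pow {1..n}" "{} \<notin> G"
  shows "trivial_group (Tor_k n (squarefree_ideal n G :: 'a mpoly set) i j) \<longleftrightarrow>
    (\<forall>u. int (mon_degree u) = j \<longrightarrow> exact_at TYPE('a) {1..n} (faces (squarefree_multiples n G) u) i)"
proof -
  let ?I = "squarefree_ideal n G :: 'a mpoly set"
  let ?F = "SOME F. graded_free_resolution n ?I F"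
  have F: "graded_free_resolution n ?I ?F"
    using graded_free_resolution_squarefree_ideal[OF G(1), where 'a = 'a] by (rule someI_ex)
  have const: "lookup p 0 = 0" if "p \<in> ?I" for p
  proof (rule ccontr)
    assume "lookup p 0 \<noteq> 0"
    then have "0 \<in> squarefree_multiples n G" using that by (auto simp: squarefree_ideal_def in_keys_iff)
    then show False using G(2) by (auto simp: squarefree_multiples_def)
  qed
  note N = monomial_closed_squarefree_multiples
  have "trivial_group (Tor_k n ?I i j) \<longleftrightarrow> kos.koszul_exact (ideal_module ?I) i j"
    unfolding Tor_k_def by (rule trivial_Tor_iff_koszul_exact[OF F const])
  also have "\<dots> \<longleftrightarrow> lab.pexact TYPE('a) (faces (squarefree_multiples n G)) i {j}"
    unfolding ideal_module_squarefree_ideal koszul_exact_monomial_submodule_iff[OF N] by simp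
  also have "\<dots> \<longleftrightarrow> (\<forall>u. int (mon_degree u) = j \<longrightarrow> exact_at TYPE('a) {1..n} (faces (squarefree_multiples n G) u) i)"
    unfolding lab.pexact_iff[OF face_family_faces[OF N]] by simp
  finally show ?thesis .
qed

end

section \<open>The ideal attached to a partition into blocks\<close>

text \<open>The vertices in \<open>{1..n}\<close> are partitioned by the values of \<open>blk\<close>. The generators are the squarefree
monomials of degree \<open>d\<close> divisible by the product of a whole block.\<close>

locale blocks = polynomial_setting n field_type
  for n :: nat and field_type :: "'a::field itself" +
  fixes d :: nat and blk :: "nat \<Rightarrow> nat"
begin

definition block :: "nat \<Rightarrow> nat set" where
  "block \<beta> = {a \<in> {1..n}. blk a = \<beta>}"

definition gens :: "nat set set" where
  "gens = {W. W \<subseteq> {1..n} \<and> card W = d \<and> (\<exists>\<beta>\<in>blk ` {1..n}. block \<beta> \<subseteq> W)}"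

lemma faces_sqf:
  assumes W: "W \<subseteq> {1..n}" and d: "\<And>\<beta>. card (block \<beta>) \<le> d"
  shows "A \<in> faces (squarefree_multiples n gens) (sqf W) \<longleftrightarrow>
    A \<subseteq> W \<and> d \<le> card (W - A) \<and> (\<exists>\<beta>\<in>blk ` {1..n}. block \<beta> \<subseteq> W - A)"
proof (cases "A \<subseteq> W")
  case True
  have fin: "finite W" "finite A" using W True finite_subset by (blast, meson finite_atLeastAtMost finite_subset)
  have keys: "keys (sqf W - sqf A) = W - A"
    by (rule Set.set_eqI) (use fin True in \<open>auto simp: in_keys_iff lookup_minus lookup_sqf\<close>)
  have "(\<exists>U\<in>gens. U \<subseteq> W - A) \<longleftrightarrow> d \<le> card (W - A) \<and> (\<exists>\<beta>\<in>blk ` {1..n}. block \<beta> \<subseteq> W - A)"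
  proof
    assume "\<exists>U\<in>gens. U \<subseteq> W - A"
    then obtain U \<beta> where "U \<subseteq> W - A" "card U = d" "\<beta> \<in> blk ` {1..n}" "block \<beta> \<subseteq> U"
      by (auto simp: gens_def)
    then show "d \<le> card (W - A) \<and> (\<exists>\<beta>\<in>blk ` {1..n}. block \<beta> \<subseteq> W - A)"
      using card_mono[of "W - A" U] fin by blast
  next
    assume R: "d \<le> card (W - A) \<and> (\<exists>\<beta>\<in>blk ` {1..n}. block \<beta> \<subseteq> W - A)"
    then obtain \<beta> where \<beta>: "\<beta> \<in> blk ` {1..n}" "block \<beta> \<subseteq> W - A" by blast
    obtain U where "block \<beta> \<subseteq> U" "U \<subseteq> W - A" "card U = d"
      using exists_subset_between[OF d conjunct1[OF R] \<beta>(2)] fin by blast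
    then show "\<exists>U\<in>gens. U \<subseteq> W - A" using \<beta>(1) W by (auto simp: gens_def)
  qed
  then show ?thesis
    using True W fin keys by (auto simp: faces_def squarefree_multiples_def monomials_def keys_sqf)
next
  case False
  have "finite W" using W finite_subset by blast
  then show ?thesis using False by (simp add: faces_def keys_sqf)
qed

text \<open>Removing one of several factors \<open>x\<^sub>v\<close> from a monomial does not change its support, on which
membership in the ideal depends: the complex is a cone with apex \<open>v\<close>.\<close>

lemma exact_at_non_squarefree:
  assumes v: "lookup u v \<ge> 2"
  shows "exact_at TYPE('a) {1..n} (faces (squarefree_multiples n G) u) i"
proof (cases "keys u \<subseteq> {1..n}")
  case True
  have vk: "v \<in> keys u" using v by (simp add: in_keys_iff)
  show ?thesis
  proof (rule exact_at_cone[where v = v])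
    show "faces (squarefree_multiples n G) u \<subseteq> Pow {1..n}" by (auto simp: faces_def)
    show "v \<in> {1..n}" using vk True by blast
    fix A assume A: "A \<in> faces (squarefree_multiples n G) u"
    then have fin: "finite A" using True finite_subset by (fastforce simp: faces_def)
    have "keys (u - sqf (insert v A)) = keys (u - sqf A)"
      by (rule Set.set_eqI) (use fin v in \<open>auto simp: in_keys_iff lookup_minus lookup_sqf\<close>)
    then show "insert v A \<in> faces (squarefree_multiples n G) u"
      using A vk by (simp add: faces_def squarefree_multiples_def monomials_def)
  qed simp
next
  case False
  then show ?thesis by (intro exact_at_no_faces) (simp add: faces_def)
qed

lemma saturated_faces:
  assumes W: "W \<subseteq> {1..n}" and sat: "\<And>v. v \<in> W \<Longrightarrow> block (blk v) \<subseteq> W"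
  shows "{A. A \<subseteq> W \<and> (\<exists>\<beta>\<in>blk ` {1..n}. block \<beta> \<subseteq> W - A)} = missing blk W"
proof (intro equalityI subsetI)
  fix A assume "A \<in> {A. A \<subseteq> W \<and> (\<exists>\<beta>\<in>blk ` {1..n}. block \<beta> \<subseteq> W - A)}"
  then obtain v where v: "A \<subseteq> W" "v \<in> {1..n}" "block (blk v) \<subseteq> W - A" by blast
  then have "v \<in> W" by (auto simp: block_def)
  moreover have "blk v \<notin> blk ` A"
  proof
    assume "blk v \<in> blk ` A"
    then obtain a where "a \<in> A" "blk a = blk v" by auto
    then have "a \<in> block (blk v)" using v(1) W by (auto simp: block_def)
    then show False using v(3) \<open>a \<in> A\<close> by blast
  qed
  ultimately show "A \<in> missing blk W" using v(1) unfolding missing_def by blast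
next
  fix A assume "A \<in> missing blk W"
  then have A: "A \<subseteq> W" "blk ` A \<noteq> blk ` W" by (simp_all add: missing_def)
  then have "\<exists>v\<in>W. blk v \<notin> blk ` A" by blast
  then obtain v where v: "v \<in> W" "blk v \<notin> blk ` A" by blast
  have "x \<notin> A" if "x \<in> block (blk v)" for x
  proof
    assume "x \<in> A"
    then have "blk x \<in> blk ` A" by (rule imageI)
    then show False using v(2) that by (simp add: block_def)
  qed
  then have "block (blk v) \<subseteq> W - A" using sat[OF v(1)] by blast
  then show "A \<in> {A. A \<subseteq> W \<and> (\<exists>\<beta>\<in>blk ` {1..n}. block \<beta> \<subseteq> W - A)}" using A(1) v W by blast
qed

text \<open>If \<open>card W > i + d\<close>, faces with at most \<open>i + 1\<close> elements leave at least \<open>d\<close> elements of \<open>W\<close>, so the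
truncation in degree \<open>d\<close> is invisible at position \<open>i\<close>. An element of \<open>W\<close> whose block is not contained
in \<open>W\<close> is the apex of a cone; otherwise \<open>W\<close> is a union of blocks.\<close>

lemma exact_at_sqf:
  assumes W: "W \<subseteq> {1..n}" and d: "\<And>\<beta>. card (block \<beta>) \<le> d"
    and large: "card W > i + d"
  shows "exact_at TYPE('a) {1..n} (faces (squarefree_multiples n gens) (sqf W)) i \<longleftrightarrow>
    (\<forall>v\<in>W. block (blk v) \<subseteq> W) \<longrightarrow> Suc i \<noteq> card (blk ` W)"
proof -
  have fin: "finite W" using W finite_subset by blast
  let ?\<Delta> = "{A. A \<subseteq> W \<and> (\<exists>\<beta>\<in>blk ` {1..n}. block \<beta> \<subseteq> W - A)}"
  have "exact_at TYPE('a) {1..n} (faces (squarefree_multiples n gens) (sqf W)) i \<longleftrightarrow>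
      exact_at TYPE('a) {1..n} ?\<Delta> i"
  proof (rule exact_at_cong)
    fix A :: "nat set" assume A: "card A = i \<or> card A = Suc i"
    have "d \<le> card (W - A)" if "A \<subseteq> W"
      using A large that fin card_Diff_subset[of A W] finite_subset[of A W] by auto
    then show "A \<in> faces (squarefree_multiples n gens) (sqf W) \<longleftrightarrow> A \<in> ?\<Delta>"
      using faces_sqf[OF W d] by blast
  qed
  also have "\<dots> \<longleftrightarrow> (\<forall>v\<in>W. block (blk v) \<subseteq> W) \<longrightarrow> Suc i \<noteq> card (blk ` W)"
  proof (cases "\<forall>v\<in>W. block (blk v) \<subseteq> W")
    case True
    then have "?\<Delta> = missing blk W" by (intro saturated_faces[OF W]) blast
    then show ?thesis using True exact_at_missing[OF fin W, of blk i, where 'a = 'a] by simp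
  next
    case False
    then obtain v where v: "v \<in> W" "\<not> block (blk v) \<subseteq> W" by blast
    have "exact_at TYPE('a) {1..n} ?\<Delta> i"
    proof (rule exact_at_cone[where v = v])
      show "?\<Delta> \<subseteq> Pow {1..n}" "v \<in> {1..n}" using W v by blast+
      fix A assume "A \<in> ?\<Delta>"
      then obtain \<beta> where \<beta>: "A \<subseteq> W" "\<beta> \<in> blk ` {1..n}" "block \<beta> \<subseteq> W - A" by blast
      then have "\<beta> \<noteq> blk v" using v by blast
      then have "v \<notin> block \<beta>" by (simp add: block_def)
      then show "insert v A \<in> ?\<Delta>" using \<beta> v by blast
    qed simp
    then show ?thesis using False by blast
  qed
  finally show ?thesis .
qed

text \<open>
If \<open>card W < i + d\<close>, there are no faces with \<open>i\<close> elements; \<open>card W = i + d\<close> is the row in which the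
truncation creates homology; beyond it only the classes of the blocks remain.
\<close>

lemma nonexact_degrees:
  assumes d: "\<And>\<beta>. card (block \<beta>) \<le> d"
    and nex: "\<not> exact_at TYPE('a) {1..n} (faces (squarefree_multiples n gens) u) i"
  shows "mon_degree u = i + d \<or>
    (\<exists>W\<subseteq>{1..n}. card W = mon_degree u \<and> card W > i + d \<and> Suc i = card (blk ` W))"
proof -
  have keys: "keys u \<subseteq> {1..n}"
  proof (rule ccontr)
    assume "\<not> ?thesis"
    then have "exact_at TYPE('a) {1..n} (faces (squarefree_multiples n gens) u) i"
      by (intro exact_at_no_faces) (simp add: faces_def)
    then show False using nex by blast
  qed
  let ?W = "keys u"
  have le: "lookup u v \<le> 1" for v
  proof (rule ccontr)
    assume "\<not> ?thesis"
    then have "2 \<le> lookup u v" by simp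
    then show False using exact_at_non_squarefree nex by blast
  qed
  have u: "u = sqf ?W"
  proof (rule poly_mapping_eqI)
    fix v show "lookup u v = lookup (sqf ?W) v"
    proof (cases "lookup u v = 0")
      case False
      then have "lookup u v = 1" using le[of v] by linarith
      then show ?thesis by (simp add: lookup_sqf in_keys_iff)
    qed (simp add: lookup_sqf in_keys_iff)
  qed
  then have deg: "mon_degree u = card ?W" using mon_degree_sqf[of ?W] by simp
  have nexW: "\<not> exact_at TYPE('a) {1..n} (faces (squarefree_multiples n gens) (sqf ?W)) i"
    using nex u by simp
  consider "card ?W < i + d" | "card ?W = i + d" | "card ?W > i + d" by linarith
  then show ?thesis
  proof cases
    case 1
    have "exact_at TYPE('a) {1..n} (faces (squarefree_multiples n gens) (sqf ?W)) i"
    proof (rule exact_at_no_faces)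
      fix A assume "A \<in> faces (squarefree_multiples n gens) (sqf ?W)"
      then have A: "A \<subseteq> ?W" "d \<le> card (?W - A)" using faces_sqf[OF keys d] by blast+
      then show "card A \<noteq> i" using 1 card_Diff_subset[of A ?W] finite_subset[of A ?W] card_mono[of ?W A] by auto
    qed
    then show ?thesis using nexW by blast
  next
    case 2
    then show ?thesis using deg by simp
  next
    case 3
    then have "Suc i = card (blk ` ?W)" using exact_at_sqf[OF keys d 3] nexW by blast
    then show ?thesis using keys deg 3 by metis
  qed
qed

end

section \<open>The regularity of the ideal\<close>

text \<open>Consecutive numbers \<open>1, 2, \<dots>\<close> fall into blocks of size \<open>k + 1\<close>. Truncated subtraction would put
\<open>0\<close> into the first block as well.\<close>

definition block_index :: "nat \<Rightarrow> nat \<Rightarrow> nat" where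
  "block_index k a = (a - 1) div (k + 1)"

lemma card_le_card_block_index:
  assumes fin: "finite W" and pos: "0 \<notin> W"
  shows "card W \<le> card (block_index k ` W) * (k + 1)"
proof -
  let ?J = "\<lambda>\<beta>. {\<beta> * (k + 1) + 1..\<beta> * (k + 1) + (k + 1)}"
  have "a \<in> ?J (block_index k a)" if "a \<in> W" for a
  proof -
    have "(a - 1) div (k + 1) * (k + 1) + (a - 1) mod (k + 1) = a - 1" by (rule div_mult_mod_eq)
    moreover have "(a - 1) mod (k + 1) < k + 1" by simp
    moreover have "a \<noteq> 0" using that pos by (intro notI) simp
    ultimately show ?thesis unfolding block_index_def atLeastAtMost_iff by linarith
  qed
  then have "W \<subseteq> (\<Union>\<beta>\<in>block_index k ` W. ?J \<beta>)" by blast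
  then have "card W \<le> card (\<Union>\<beta>\<in>block_index k ` W. ?J \<beta>)"
    by (rule card_mono[rotated]) (simp add: fin)
  also have "\<dots> \<le> (\<Sum>\<beta>\<in>block_index k ` W. card (?J \<beta>))" by (rule card_UN_le) (simp add: fin)
  finally show ?thesis by simp
qed

locale odd_degree_blocks = blocks n field_type d "block_index k"
  for n :: nat and field_type :: "'a::field itself" and d k :: nat +
  assumes d: "d = 2 * k + 1" and k: "k \<ge> 1" and n: "n \<ge> d"
begin

lemma d_pos: "d > 0" and block_le_degree: "k + 1 \<le> d"
  using d k by simp_all

lemma card_block: "card (block \<beta>) \<le> d"
proof -
  have "block_index k ` block \<beta> \<subseteq> {\<beta>}" by (auto simp: block_def)
  from card_mono[OF _ this] have "card (block_index k ` block \<beta>) * (k + 1) \<le> 1 * (k + 1)" by (intro mult_le_mono1) simp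
  moreover have "card (block \<beta>) \<le> card (block_index k ` block \<beta>) * (k + 1)"
    by (rule card_le_card_block_index) (auto simp: block_def)
  ultimately have "card (block \<beta>) \<le> 1 * (k + 1)" by (rule order.trans[rotated])
  then show ?thesis using block_le_degree by simp
qed

lemma gens_subset: "gens \<subseteq> Pow {1..n}" and empty_not_in_gens: "{} \<notin> gens"
  and card_gens: "W \<in> gens \<Longrightarrow> card W = d"
  using d_pos by (auto simp: gens_def)

lemmas trivial_Tor_gens_iff = trivial_Tor_squarefree_ideal_iff[OF gens_subset empty_not_in_gens]

lemma nontrivial_Tor_degrees:
  assumes "\<not> trivial_group (Tor_k n (squarefree_ideal n gens :: 'a mpoly set) i j)"
  shows "j = int (i + d) \<or>
    (\<exists>W\<subseteq>{1..n}. int (card W) = j \<and> card W > i + d \<and> Suc i = card (block_index k ` W))"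
proof -
  have "\<not> (\<forall>u. int (mon_degree u) = j \<longrightarrow>
      exact_at TYPE('a) {1..n} (faces (squarefree_multiples n gens) u) i)"
    using assms unfolding trivial_Tor_gens_iff .
  then obtain u where u: "int (mon_degree u) = j"
    "\<not> exact_at TYPE('a) {1..n} (faces (squarefree_multiples n gens) u) i"
    unfolding not_all not_imp by (elim exE conjE)
  from nonexact_degrees[OF card_block u(2)] show ?thesis
  proof (elim disjE exE conjE)
    assume "mon_degree u = i + d"
    then show ?thesis using u(1) by simp
  next
    fix W assume "W \<subseteq> {1..n}" "card W = mon_degree u" "card W > i + d" "Suc i = card (block_index k ` W)"
    then show ?thesis using u(1) by (intro disjI2 exI[of _ W]) simp
  qed
qed

text \<open>
A set with \<open>d\<close> elements that contains a block is the support of a generator: only the empty face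
leaves \<open>d\<close> elements.
\<close>

lemma nontrivial_Tor_0:
  "\<not> trivial_group (Tor_k n (squarefree_ideal n gens :: 'a mpoly set) 0 (int d))"
proof -
  let ?W = "{1..d}"
  have W: "?W \<subseteq> {1..n}" using n by auto
  have "block 0 \<subseteq> ?W"
  proof
    fix a assume "a \<in> block 0"
    then have "a \<ge> 1" "(a - 1) div (k + 1) = 0" by (auto simp: block_def block_index_def)
    then show "a \<in> ?W" using block_le_degree by (auto simp: div_eq_0_iff)
  qed
  moreover have "0 \<in> block_index k ` {1..n}" using n d_pos by (intro image_eqI[of _ _ 1]) (auto simp: block_index_def)
  ultimately have "\<exists>\<beta>\<in>block_index k ` {1..n}. block \<beta> \<subseteq> ?W - {}"
    by (intro bexI[of _ 0]) (simp_all only: Diff_empty)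
  then have "{} \<in> faces (squarefree_multiples n gens) (sqf ?W)"
    unfolding faces_sqf[OF W card_block] by simp
  moreover have "card A \<noteq> Suc 0" if "A \<in> faces (squarefree_multiples n gens) (sqf ?W)" for A
  proof -
    have "A \<subseteq> ?W" "d \<le> card (?W - A)" using that unfolding faces_sqf[OF W card_block] by blast+
    then show ?thesis using card_Diff_subset[of A ?W] finite_subset[of A ?W] d_pos by auto
  qed
  ultimately have "\<not> exact_at TYPE('a) {1..n} (faces (squarefree_multiples n gens) (sqf ?W)) 0"
    by (rule not_exact_at_0)
  moreover have "int (mon_degree (sqf ?W)) = int d" by (simp add: mon_degree_sqf)
  ultimately show ?thesis using trivial_Tor_gens_iff[of 0 "int d"] by blast
qed

lemma nontrivial_Tor_top:
  assumes i: "Suc i = card (block_index k ` {1..n})" "n > i + d"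
  shows "\<not> trivial_group (Tor_k n (squarefree_ideal n gens :: 'a mpoly set) i (int n))"
proof -
  have "\<not> exact_at TYPE('a) {1..n} (faces (squarefree_multiples n gens) (sqf {1..n})) i"
    using exact_at_sqf[OF _ card_block, of "{1..n}" i] i by (auto simp: block_def)
  moreover have "int (mon_degree (sqf {1..n})) = int n" by (simp add: mon_degree_sqf)
  ultimately show ?thesis using trivial_Tor_gens_iff[of i "int n"] by blast
qed

end

text \<open>For \<open>n > d\<close>, division of \<open>n - 1\<close> by \<open>k + 1\<close> with quotient \<open>q\<close> and remainder \<open>r\<close> gives
\<open>k n = (k q + r) (k + 1) + (k - r)\<close>, so the integer part of \<open>k n / (k + 1)\<close> is
\<open>k q + r = n - 1 - q\<close>. For \<open>n = d\<close> one has \<open>q = 1\<close>, and the maximum is \<open>d\<close>.\<close>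

lemma f_bound_eq:
  fixes n k d :: nat
  assumes d: "d = 2 * k + 1" and k: "k \<ge> 1" and n: "n \<ge> d"
  shows "f_bound n d = max (int d) (int n - int ((n - 1) div (k + 1)))"
proof -
  define q r where "q = (n - 1) div (k + 1)" and "r = (n - 1) mod (k + 1)"
  have "q * (k + 1) + r = n - 1" unfolding q_def r_def by (rule div_mult_mod_eq)
  then have nq: "n = q * (k + 1) + r + 1" using n d by simp
  have "(n - 1) mod (k + 1) < k + 1" by simp
  then have r: "r \<le> k" unfolding r_def by linarith
  show ?thesis
  proof (cases "n = d")
    case True
    have "q \<ge> 1"
    proof (rule ccontr)
      assume "\<not> q \<ge> 1"
      then have "q = 0" by simp
      then have "n = r + 1" using nq by simp
      then show False using True d k r by simp
    qed
    then show ?thesis using True by (simp add: f_bound_def q_def[symmetric])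
  next
    case False
    have num: "k * n = (k * q + r) * (k + 1) + (k - r)"
    proof -
      have "(k * q + r) * (k + 1) + (k - r) = k * q * (k + 1) + r * k + (r + (k - r))" by (simp add: algebra_simps)
      also have "r + (k - r) = k" using r by simp
      finally show ?thesis unfolding nq by (simp add: algebra_simps)
    qed
    have div: "k * n div (k + 1) = k * q + r"
      unfolding num by (simp only: div_mult_self3[of "k + 1"]) (use r in simp)
    have "(real d - 1) * real n / (real d + 1) = (2 * real (k * n)) / (2 * real (k + 1))"
      by (simp add: d algebra_simps)
    also have "\<dots> = real (k * n) / real (k + 1)" by (rule mult_divide_mult_cancel_left) simp
    finally have "\<lfloor>(real d - 1) * real n / (real d + 1)\<rfloor> = int (k * n div (k + 1))"
      by (simp only: floor_divide_of_nat_eq)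
    then have f: "f_bound n d = int (k * q + r) + 1" using n False by (simp add: f_bound_def div)
    have "2 * (k + 1) \<le> n" using n False d by simp
    then have "k * (2 * (k + 1)) \<le> k * n" by (rule mult_le_mono2)
    then have "2 * k * (k + 1) \<le> k * n" by (simp only: ac_simps)
    then have le: "2 * k \<le> k * q + r"
      using div_le_mono[of "2 * k * (k + 1)" "k * n" "k + 1"] unfolding div by simp
    have nq': "int n - int q = int (k * q + r) + 1" unfolding nq by (simp add: algebra_simps)
    have "int d \<le> int n - int q" unfolding nq' d using le by linarith
    then show ?thesis unfolding f q_def[symmetric] by (simp only: max_absorb2 nq')
  qed
qed

theorem lemma2p16:
  fixes d k n :: nat
  assumes "d = 2 * k + 1" and "d \<ge> 3" and "n \<ge> d"
  shows "\<exists>I :: ('a::field) mpoly set.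
           squarefree_monomial_ideal_gen_in_degree n d I \<and>
           linearly_presented n d I \<and>
           reg n I = f_bound n d"
proof -
  have k: "k \<ge> 1" using assms by simp
  let ?blk = "block_index k"
  interpret odd_degree_blocks n "TYPE('a)" d k by unfold_locales (use assms k in auto)
  let ?I = "squarefree_ideal n gens :: 'a mpoly set"
  have "linearly_presented n d ?I"
    unfolding linearly_presented_def
  proof (intro allI impI, rule ccontr)
    fix j assume j: "j \<noteq> int d + 1" and nt: "\<not> trivial_group (Tor_k n ?I 1 j)"
    then obtain W where W: "W \<subseteq> {1..n}" "card W > 1 + d" "Suc 1 = card (?blk ` W)"
      using nontrivial_Tor_degrees[OF nt] by auto
    have "card W \<le> card (?blk ` W) * (k + 1)"
      by (rule card_le_card_block_index) (use W(1) finite_subset in auto)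
    also have "\<dots> = 2 * (k + 1)" unfolding W(3)[symmetric] by simp
    finally show False using W(2) assms(1) by simp
  qed
  moreover have "reg n ?I = f_bound n d"
  proof -
    define s where "s = card (?blk ` {1..n})"
    have "?blk ` {1..n} = {0..(n - 1) div (k + 1)}"
    proof (intro equalityI subsetI)
      fix \<beta> assume "\<beta> \<in> ?blk ` {1..n}"
      then show "\<beta> \<in> {0..(n - 1) div (k + 1)}" by (auto simp: block_index_def intro!: div_le_mono)
    next
      fix \<beta> assume "\<beta> \<in> {0..(n - 1) div (k + 1)}"
      then have "\<beta> * (k + 1) \<le> (n - 1) div (k + 1) * (k + 1)" by (intro mult_right_mono) auto
      also have "\<dots> \<le> n - 1" by (rule div_times_less_eq_dividend)
      finally have "\<beta> * (k + 1) + 1 \<in> {1..n}" using assms by auto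
      moreover have "?blk (\<beta> * (k + 1) + 1) = \<beta>" by (simp add: block_index_def)
      ultimately show "\<beta> \<in> ?blk ` {1..n}" by (metis imageI)
    qed
    then have s: "s = (n - 1) div (k + 1) + 1" by (simp add: s_def)
    define R where "R = {j - int i | i j. \<not> trivial_group (Tor_k n ?I i j)}"
    have bounds: "int d \<le> t \<and> t \<le> max (int d) (int n - int s + 1)" if "t \<in> R" for t
    proof -
      obtain i j where t: "t = j - int i" "\<not> trivial_group (Tor_k n ?I i j)"
        using \<open>t \<in> R\<close> unfolding R_def by blast
      from nontrivial_Tor_degrees[OF t(2)] show ?thesis
      proof (elim disjE exE conjE)
        assume "j = int (i + d)"
        then show ?thesis using t by simp
      next
        fix W assume W: "W \<subseteq> {1..n}" "int (card W) = j" "card W > i + d" "Suc i = card (?blk ` W)"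
        have fin: "finite W" using W(1) finite_subset by blast
        \<comment> \<open>Every block that does not meet W has an element outside W.\<close>
        have "?blk ` {1..n} = ?blk ` W \<union> ?blk ` ({1..n} - W)" using W(1) by auto
        then have "s \<le> card (?blk ` W) + card (?blk ` ({1..n} - W))"
          unfolding s_def by (metis card_Un_le)
        also have "card (?blk ` ({1..n} - W)) \<le> card ({1..n} - W)" by (intro card_image_le) simp
        also have "card ({1..n} - W) = n - card W" using card_Diff_subset[OF fin W(1)] by simp
        finally have "s \<le> Suc i + (n - card W)" using W(4) by simp
        moreover have "card W \<le> n" using card_mono[OF _ W(1)] by simp
        ultimately show ?thesis using t W(2,3) by linarith
      qed
    qed
    have fin: "finite R" by (rule finite_subset[of _ "{int d..max (int d) (int n - int s + 1)}"]) (use bounds in auto)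
    have "max (int d) (int n - int s + 1) \<in> R"
    proof (cases "int d < int n - int s + 1")
      case True
      have "Suc (s - 1) = card (?blk ` {1..n})" using s s_def by simp
      moreover have "n > (s - 1) + d" using True s by linarith
      ultimately have "\<not> trivial_group (Tor_k n ?I (s - 1) (int n))" by (rule nontrivial_Tor_top)
      then have "int n - int (s - 1) \<in> R" unfolding R_def
        by (intro CollectI exI[of _ "s - 1"] exI[of _ "int n"] conjI refl)
      moreover have "max (int d) (int n - int s + 1) = int n - int (s - 1)" using True s by linarith
      ultimately show ?thesis by simp
    next
      case False
      have "int d - int 0 \<in> R" unfolding R_def
        by (intro CollectI exI[of _ 0] exI[of _ "int d"] conjI refl nontrivial_Tor_0)
      moreover have "max (int d) (int n - int s + 1) = int d - int 0" using False by linarith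
      ultimately show ?thesis by simp
    qed
    then have "Max R = max (int d) (int n - int s + 1)"
      using fin bounds by (intro Max_eqI) auto
    also have "\<dots> = f_bound n d" using f_bound_eq[OF assms(1) k assms(3)] s by simp
    finally show ?thesis by (simp add: reg_def R_def)
  qed
  ultimately show ?thesis
    using squarefree_monomial_ideal_squarefree_ideal[OF gens_subset card_gens, where 'a = 'a] by blast
qed

end
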